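(* Let $(\mathcal G,\mathcal L)$ be a twisted étale groupoid. Every $*$-homomorphism $\psi:\mathfrak C_c(\mathcal G,\mathcal L)\to B$ into a $C^*$-algebra $B$ is automatically $\|\cdot\|_I$-contractive. In fact, $$\|\psi(f)\|\le\|f\|_{d_*}^{1/2}\,\|f\|_{r_*}^{1/2}\le\|f\|_I,\qquad f\in\mathfrak C_c(\mathcal G,\mathcal L).$$
   Context: $\mathbb F\in\{\mathbb R,\mathbb C\}$ is the scalar field of all algebras. A $C^*$-algebra is a Banach $*$-algebra with $\|a^*a\|=\|a\|^2$ and, if $\mathbb F=\mathbb R$, also $\|a^*a\|\le\|a^*a+b^*b\|$ for all $a,b$. $\mathcal G$ is an étale groupoid (a topological groupoid whose range and domain maps $r,d:\mathcal G\to X\subseteq\mathcal G$ are local homeomorphisms) with locally compact Hausdorff unit space $X$ ($\mathcal G$ need not be Hausdorff). A bisection is an open $U\subseteq\mathcal G$ such that $r|_U,d|_U$ are homeomorphisms onto open sets; $\mathrm{Bis}(\mathcal G)$ is the set of bisections. A twist $\mathcal L$ is a Fell line bundle over $\mathcal G$: a (locally trivial) line bundle $\bigsqcup_\gamma L_\gamma$ of one-dimensional Banach spaces over $\mathbb F$, with continuous modulus $|\cdot|$, a continuous associative multiplication consisting of bilinear maps $L_\gamma\times L_\eta\to L_{\gamma\eta}$ ($d(\gamma)=r(\eta)$) with $|zw|=|z||w|$, and a continuous antimultiplicative modulus-preserving involution of conjugate-linear maps $L_\gamma\to L_{\gamma^{-1}}$ with $z\cdot z^*=|z|^2\in L_{r(\gamma)}\cong\mathbb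 F$; one assumes $\mathcal L|_X=X\times\mathbb F$. $C_c(U,\mathcal L)$ denotes continuous compactly supported sections over open $U$ extended by $0$; $\mathfrak C_c(\mathcal G,\mathcal L)=\mathrm{span}\{f\in C_c(U,\mathcal L):U\in\mathrm{Bis}(\mathcal G)\}$ is a $*$-algebra with $(f*g)(\gamma)=\sum_{r(\eta)=r(\gamma)}f(\eta)\cdot g(\eta^{-1}\gamma)$, $f^*(\gamma)=f(\gamma^{-1})^*$. Norms: $\|f\|_{d_*}=\sup_{x\in X}\sum_{d(\gamma)=x}|f(\gamma)|$, $\|f\|_{r_*}=\sup_{x\in X}\sum_{r(\gamma)=x}|f(\gamma)|$, $\|f\|_I=\max\{\|f\|_{d_*},\|f\|_{r_*}\}$. *)

theory Defs
  imports "HOL-Analysis.Analysis" "HOL-Algebra.Module" "HOL-Algebra.Free_Abelian_Groups"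
begin

text \<open>
  The scalar field is a set \<open>F\<close> of complex numbers with \<open>F \<in> {\<real>, UNIV}\<close>, so that the real and the
  complex case are treated at once; \<^const>\<open>cnj\<close> is the identity on \<^term>\<open>\<real> :: complex set\<close>.
\<close>

definition scalar_ring :: "complex set \<Rightarrow> complex ring" where
  "scalar_ring F = \<lparr>carrier = F, monoid.mult = (*), one = 1, ring.zero = 0, add = (+)\<rparr>"

section \<open>Etale groupoids\<close>

text \<open>The arrows of a groupoid are the points of \<open>garr\<close>. Products \<open>gmul \<gamma> \<eta>\<close> are only
  meaningful for \<open>gdom \<gamma> = gran \<eta>\<close>.\<close>

record 'g groupoid =
  garr :: "'g topology"
  gunits :: "'g set"
  gran :: "'g \<Rightarrow> 'g"
  gdom :: "'g \<Rightarrow> 'g"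
  gmul :: "'g \<Rightarrow> 'g \<Rightarrow> 'g"
  ginv :: "'g \<Rightarrow> 'g"

abbreviation arrows :: "'g groupoid \<Rightarrow> 'g set" where
  "arrows G \<equiv> topspace (garr G)"

definition unit_space :: "'g groupoid \<Rightarrow> 'g topology" where
  "unit_space G = subtopology (garr G) (gunits G)"

definition homeomorphic_onto_open_on :: "'a topology \<Rightarrow> 'b topology \<Rightarrow> 'a set \<Rightarrow> ('a \<Rightarrow> 'b) \<Rightarrow> bool" where
  "homeomorphic_onto_open_on S T U f \<longleftrightarrow>
     openin S U \<and> openin T (f ` U) \<and>
     homeomorphic_map (subtopology S U) (subtopology T (f ` U)) f"

definition local_homeomorphism :: "'a topology \<Rightarrow> 'b topology \<Rightarrow> ('a \<Rightarrow> 'b) \<Rightarrow> bool" where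
  "local_homeomorphism S T f \<longleftrightarrow>
     (\<forall>x\<in>topspace S. \<exists>U. x \<in> U \<and> homeomorphic_onto_open_on S T U f)"

locale topological_groupoid =
  fixes G :: "'g groupoid"
  assumes units_subset: "gunits G \<subseteq> arrows G"
    and ran_units: "\<gamma> \<in> arrows G \<Longrightarrow> gran G \<gamma> \<in> gunits G"
    and dom_units: "\<gamma> \<in> arrows G \<Longrightarrow> gdom G \<gamma> \<in> gunits G"
    and ran_unit: "x \<in> gunits G \<Longrightarrow> gran G x = x"
    and dom_unit: "x \<in> gunits G \<Longrightarrow> gdom G x = x"
    and mul_closed: "\<lbrakk>\<gamma> \<in> arrows G; \<eta> \<in> arrows G; gdom G \<gamma> = gran G \<eta>\<rbrakk> \<Longrightarrow> gmul G \<gamma> \<eta> \<in> arrows G"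
    and ran_mul: "\<lbrakk>\<gamma> \<in> arrows G; \<eta> \<in> arrows G; gdom G \<gamma> = gran G \<eta>\<rbrakk>
                    \<Longrightarrow> gran G (gmul G \<gamma> \<eta>) = gran G \<gamma>"
    and dom_mul: "\<lbrakk>\<gamma> \<in> arrows G; \<eta> \<in> arrows G; gdom G \<gamma> = gran G \<eta>\<rbrakk>
                    \<Longrightarrow> gdom G (gmul G \<gamma> \<eta>) = gdom G \<eta>"
    and mul_assoc: "\<lbrakk>\<gamma> \<in> arrows G; \<eta> \<in> arrows G; \<zeta> \<in> arrows G;
                     gdom G \<gamma> = gran G \<eta>; gdom G \<eta> = gran G \<zeta>\<rbrakk>
                    \<Longrightarrow> gmul G (gmul G \<gamma> \<eta>) \<zeta> = gmul G \<gamma> (gmul G \<eta> \<zeta>)"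
    and ran_mul_self: "\<gamma> \<in> arrows G \<Longrightarrow> gmul G (gran G \<gamma>) \<gamma> = \<gamma>"
    and mul_dom_self: "\<gamma> \<in> arrows G \<Longrightarrow> gmul G \<gamma> (gdom G \<gamma>) = \<gamma>"
    and inv_closed: "\<gamma> \<in> arrows G \<Longrightarrow> ginv G \<gamma> \<in> arrows G"
    and ran_inv: "\<gamma> \<in> arrows G \<Longrightarrow> gran G (ginv G \<gamma>) = gdom G \<gamma>"
    and dom_inv: "\<gamma> \<in> arrows G \<Longrightarrow> gdom G (ginv G \<gamma>) = gran G \<gamma>"
    and mul_inv: "\<gamma> \<in> arrows G \<Longrightarrow> gmul G \<gamma> (ginv G \<gamma>) = gran G \<gamma>"
    and inv_mul: "\<gamma> \<in> arrows G \<Longrightarrow> gmul G (ginv G \<gamma>) \<gamma> = gdom G \<gamma>"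
    and continuous_mul:
      "continuous_map
         (subtopology (prod_topology (garr G) (garr G)) {(\<gamma>, \<eta>). gdom G \<gamma> = gran G \<eta>})
         (garr G) (\<lambda>(\<gamma>, \<eta>). gmul G \<gamma> \<eta>)"
    and continuous_inv: "continuous_map (garr G) (garr G) (ginv G)"

text \<open>Only the unit space is required to be Hausdorff.\<close>

locale etale_groupoid = topological_groupoid +
  assumes ran_local_homeomorphism: "local_homeomorphism (garr G) (unit_space G) (gran G)"
    and dom_local_homeomorphism: "local_homeomorphism (garr G) (unit_space G) (gdom G)"
    and locally_compact_units: "locally_compact_space (unit_space G)"
    and Hausdorff_units: "Hausdorff_space (unit_space G)"

definition bisections :: "'g groupoid \<Rightarrow> 'g set set" where
  "bisections G =
     {U. homeomorphic_onto_open_on (garr G) (unit_space G) U (gran G) \<and>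
         homeomorphic_onto_open_on (garr G) (unit_space G) U (gdom G)}"

section \<open>Fell line bundles\<close>

text \<open>
  The points of \<open>ltop\<close> form the total space. The vector space structure of the fibre over \<open>\<gamma>\<close>
  is \<open>lfib \<gamma>\<close>; the fields \<open>mult\<close> and \<open>one\<close> which every \<open>module\<close> record carries play no role.
  The map \<open>ltriv\<close> is the identification of the product bundle over the unit space with the
  restricted bundle.
\<close>

record ('g, 'l) line_bundle =
  ltop :: "'l topology"
  lproj :: "'l \<Rightarrow> 'g"
  lfib :: "'g \<Rightarrow> (complex, 'l) module"
  lmod :: "'l \<Rightarrow> real"
  lmul :: "'l \<Rightarrow> 'l \<Rightarrow> 'l"
  lstar :: "'l \<Rightarrow> 'l"
  ltriv :: "'g \<Rightarrow> complex \<Rightarrow> 'l"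

abbreviation fibre :: "('g, 'l) line_bundle \<Rightarrow> 'g \<Rightarrow> 'l set" where
  "fibre L \<gamma> \<equiv> carrier (lfib L \<gamma>)"

definition local_trivialization ::
    "complex set \<Rightarrow> 'g groupoid \<Rightarrow> ('g, 'l) line_bundle \<Rightarrow> 'g set \<Rightarrow> ('l \<Rightarrow> 'g \<times> complex) \<Rightarrow> bool" where
  "local_trivialization F G L U \<phi> \<longleftrightarrow>
     homeomorphic_map (subtopology (ltop L) {z. lproj L z \<in> U})
       (prod_topology (subtopology (garr G) U) (top_of_set F)) \<phi> \<and>
     (\<forall>\<gamma>\<in>U. \<forall>z\<in>fibre L \<gamma>. fst (\<phi> z) = \<gamma> \<and>
        (\<forall>w\<in>fibre L \<gamma>. snd (\<phi> (z \<oplus>\<^bsub>lfib L \<gamma>\<^esub> w)) = snd (\<phi> z) + snd (\<phi> w)) \<and>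
        (\<forall>c\<in>F. snd (\<phi> (c \<odot>\<^bsub>lfib L \<gamma>\<^esub> z)) = c * snd (\<phi> z)))"

locale twisted_etale_groupoid = etale_groupoid G
  for F :: "complex set" and G :: "'g groupoid" and L :: "('g, 'l) line_bundle" +
  assumes scalars: "F \<in> {\<real>, UNIV}"
    and proj_continuous: "continuous_map (ltop L) (garr G) (lproj L)"
    and fibre_carrier: "\<gamma> \<in> arrows G \<Longrightarrow> fibre L \<gamma> = {z \<in> topspace (ltop L). lproj L z = \<gamma>}"
    and fibre_vector_space: "\<gamma> \<in> arrows G \<Longrightarrow> Module.module (scalar_ring F) (lfib L \<gamma>)"
    and fibre_one_dimensional:
      "\<gamma> \<in> arrows G \<Longrightarrow>
         \<exists>e\<in>fibre L \<gamma>. e \<noteq> \<zero>\<^bsub>lfib L \<gamma>\<^esub> \<and> fibre L \<gamma> = {c \<odot>\<^bsub>lfib L \<gamma>\<^esub> e | c. c \<in> F}"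
    and mod_nonneg: "z \<in> topspace (ltop L) \<Longrightarrow> 0 \<le> lmod L z"
    and mod_eq_0: "\<lbrakk>\<gamma> \<in> arrows G; z \<in> fibre L \<gamma>\<rbrakk> \<Longrightarrow> lmod L z = 0 \<longleftrightarrow> z = \<zero>\<^bsub>lfib L \<gamma>\<^esub>"
    and mod_scale: "\<lbrakk>\<gamma> \<in> arrows G; z \<in> fibre L \<gamma>; c \<in> F\<rbrakk>
                      \<Longrightarrow> lmod L (c \<odot>\<^bsub>lfib L \<gamma>\<^esub> z) = cmod c * lmod L z"
    and mod_triangle: "\<lbrakk>\<gamma> \<in> arrows G; z \<in> fibre L \<gamma>; w \<in> fibre L \<gamma>\<rbrakk>
                         \<Longrightarrow> lmod L (z \<oplus>\<^bsub>lfib L \<gamma>\<^esub> w) \<le> lmod L z + lmod L w"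
    and fibre_complete:
      "\<gamma> \<in> arrows G \<Longrightarrow>
         Metric_space.mcomplete (fibre L \<gamma>) (\<lambda>z w. lmod L (z \<ominus>\<^bsub>lfib L \<gamma>\<^esub> w))"
    and locally_trivial:
      "\<gamma> \<in> arrows G \<Longrightarrow> \<exists>U \<phi>. openin (garr G) U \<and> \<gamma> \<in> U \<and> local_trivialization F G L U \<phi>"
    and mod_continuous: "continuous_map (ltop L) euclideanreal (lmod L)"
    and lmul_fibre:
      "\<lbrakk>\<gamma> \<in> arrows G; \<eta> \<in> arrows G; gdom G \<gamma> = gran G \<eta>; z \<in> fibre L \<gamma>; w \<in> fibre L \<eta>\<rbrakk>
         \<Longrightarrow> lmul L z w \<in> fibre L (gmul G \<gamma> \<eta>)"
    and lmul_add_left: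
      "\<lbrakk>\<gamma> \<in> arrows G; \<eta> \<in> arrows G; gdom G \<gamma> = gran G \<eta>;
        z \<in> fibre L \<gamma>; z' \<in> fibre L \<gamma>; w \<in> fibre L \<eta>\<rbrakk>
         \<Longrightarrow> lmul L (z \<oplus>\<^bsub>lfib L \<gamma>\<^esub> z') w = lmul L z w \<oplus>\<^bsub>lfib L (gmul G \<gamma> \<eta>)\<^esub> lmul L z' w"
    and lmul_add_right:
      "\<lbrakk>\<gamma> \<in> arrows G; \<eta> \<in> arrows G; gdom G \<gamma> = gran G \<eta>;
        z \<in> fibre L \<gamma>; w \<in> fibre L \<eta>; w' \<in> fibre L \<eta>\<rbrakk>
         \<Longrightarrow> lmul L z (w \<oplus>\<^bsub>lfib L \<eta>\<^esub> w') = lmul L z w \<oplus>\<^bsub>lfib L (gmul G \<gamma> \<eta>)\<^esub> lmul L z w'"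
    and lmul_scale_left:
      "\<lbrakk>\<gamma> \<in> arrows G; \<eta> \<in> arrows G; gdom G \<gamma> = gran G \<eta>; z \<in> fibre L \<gamma>; w \<in> fibre L \<eta>; c \<in> F\<rbrakk>
         \<Longrightarrow> lmul L (c \<odot>\<^bsub>lfib L \<gamma>\<^esub> z) w = c \<odot>\<^bsub>lfib L (gmul G \<gamma> \<eta>)\<^esub> lmul L z w"
    and lmul_scale_right:
      "\<lbrakk>\<gamma> \<in> arrows G; \<eta> \<in> arrows G; gdom G \<gamma> = gran G \<eta>; z \<in> fibre L \<gamma>; w \<in> fibre L \<eta>; c \<in> F\<rbrakk>
         \<Longrightarrow> lmul L z (c \<odot>\<^bsub>lfib L \<eta>\<^esub> w) = c \<odot>\<^bsub>lfib L (gmul G \<gamma> \<eta>)\<^esub> lmul L z w"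
    and lmul_assoc:
      "\<lbrakk>\<gamma> \<in> arrows G; \<eta> \<in> arrows G; \<zeta> \<in> arrows G; gdom G \<gamma> = gran G \<eta>; gdom G \<eta> = gran G \<zeta>;
        z \<in> fibre L \<gamma>; w \<in> fibre L \<eta>; v \<in> fibre L \<zeta>\<rbrakk>
         \<Longrightarrow> lmul L (lmul L z w) v = lmul L z (lmul L w v)"
    and mod_lmul:
      "\<lbrakk>\<gamma> \<in> arrows G; \<eta> \<in> arrows G; gdom G \<gamma> = gran G \<eta>; z \<in> fibre L \<gamma>; w \<in> fibre L \<eta>\<rbrakk>
         \<Longrightarrow> lmod L (lmul L z w) = lmod L z * lmod L w"
    and lmul_continuous:
      "continuous_map
         (subtopology (prod_topology (ltop L) (ltop L))
            {(z, w). gdom G (lproj L z) = gran G (lproj L w)})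
         (ltop L) (\<lambda>(z, w). lmul L z w)"
    and lstar_fibre: "\<lbrakk>\<gamma> \<in> arrows G; z \<in> fibre L \<gamma>\<rbrakk> \<Longrightarrow> lstar L z \<in> fibre L (ginv G \<gamma>)"
    and lstar_add:
      "\<lbrakk>\<gamma> \<in> arrows G; z \<in> fibre L \<gamma>; w \<in> fibre L \<gamma>\<rbrakk>
         \<Longrightarrow> lstar L (z \<oplus>\<^bsub>lfib L \<gamma>\<^esub> w) = lstar L z \<oplus>\<^bsub>lfib L (ginv G \<gamma>)\<^esub> lstar L w"
    and lstar_scale:
      "\<lbrakk>\<gamma> \<in> arrows G; z \<in> fibre L \<gamma>; c \<in> F\<rbrakk>
         \<Longrightarrow> lstar L (c \<odot>\<^bsub>lfib L \<gamma>\<^esub> z) = cnj c \<odot>\<^bsub>lfib L (ginv G \<gamma>)\<^esub> lstar L z"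
    and lstar_lstar: "\<lbrakk>\<gamma> \<in> arrows G; z \<in> fibre L \<gamma>\<rbrakk> \<Longrightarrow> lstar L (lstar L z) = z"
    and lstar_lmul:
      "\<lbrakk>\<gamma> \<in> arrows G; \<eta> \<in> arrows G; gdom G \<gamma> = gran G \<eta>; z \<in> fibre L \<gamma>; w \<in> fibre L \<eta>\<rbrakk>
         \<Longrightarrow> lstar L (lmul L z w) = lmul L (lstar L w) (lstar L z)"
    and mod_lstar: "\<lbrakk>\<gamma> \<in> arrows G; z \<in> fibre L \<gamma>\<rbrakk> \<Longrightarrow> lmod L (lstar L z) = lmod L z"
    and lstar_continuous: "continuous_map (ltop L) (ltop L) (lstar L)"
    and lmul_lstar:
      "\<lbrakk>\<gamma> \<in> arrows G; z \<in> fibre L \<gamma>\<rbrakk>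
         \<Longrightarrow> lmul L z (lstar L z) = ltriv L (gran G \<gamma>) (complex_of_real ((lmod L z)\<^sup>2))"
    and triv_homeomorphism:
      "homeomorphic_map (prod_topology (unit_space G) (top_of_set F))
         (subtopology (ltop L) {z. lproj L z \<in> gunits G}) (\<lambda>(x, s). ltriv L x s)"
    and triv_fibre: "\<lbrakk>x \<in> gunits G; s \<in> F\<rbrakk> \<Longrightarrow> ltriv L x s \<in> fibre L x"
    and triv_add: "\<lbrakk>x \<in> gunits G; s \<in> F; t \<in> F\<rbrakk>
                     \<Longrightarrow> ltriv L x (s + t) = ltriv L x s \<oplus>\<^bsub>lfib L x\<^esub> ltriv L x t"
    and triv_scale: "\<lbrakk>x \<in> gunits G; s \<in> F; t \<in> F\<rbrakk>
                       \<Longrightarrow> ltriv L x (s * t) = s \<odot>\<^bsub>lfib L x\<^esub> ltriv L x t"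
    and triv_mul: "\<lbrakk>x \<in> gunits G; s \<in> F; t \<in> F\<rbrakk>
                     \<Longrightarrow> ltriv L x (s * t) = lmul L (ltriv L x s) (ltriv L x t)"
    and triv_star: "\<lbrakk>x \<in> gunits G; s \<in> F\<rbrakk> \<Longrightarrow> ltriv L x (cnj s) = lstar L (ltriv L x s)"
    and triv_mod: "\<lbrakk>x \<in> gunits G; s \<in> F\<rbrakk> \<Longrightarrow> lmod L (ltriv L x s) = cmod s"

section \<open>The algebra of quasi-continuous compactly supported sections\<close>

text \<open>Sections are extensional functions, so that they are determined by their values on arrows.\<close>

definition sections :: "'g groupoid \<Rightarrow> ('g, 'l) line_bundle \<Rightarrow> ('g \<Rightarrow> 'l) set" where
  "sections G L = (\<Pi>\<^sub>E \<gamma>\<in>arrows G. fibre L \<gamma>)"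

definition sec_zero :: "'g groupoid \<Rightarrow> ('g, 'l) line_bundle \<Rightarrow> 'g \<Rightarrow> 'l" where
  "sec_zero G L = (\<lambda>\<gamma>\<in>arrows G. \<zero>\<^bsub>lfib L \<gamma>\<^esub>)"

definition sec_add :: "'g groupoid \<Rightarrow> ('g, 'l) line_bundle \<Rightarrow> ('g \<Rightarrow> 'l) \<Rightarrow> ('g \<Rightarrow> 'l) \<Rightarrow> 'g \<Rightarrow> 'l" where
  "sec_add G L f g = (\<lambda>\<gamma>\<in>arrows G. f \<gamma> \<oplus>\<^bsub>lfib L \<gamma>\<^esub> g \<gamma>)"

definition sec_scale :: "'g groupoid \<Rightarrow> ('g, 'l) line_bundle \<Rightarrow> complex \<Rightarrow> ('g \<Rightarrow> 'l) \<Rightarrow> 'g \<Rightarrow> 'l" where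
  "sec_scale G L c f = (\<lambda>\<gamma>\<in>arrows G. c \<odot>\<^bsub>lfib L \<gamma>\<^esub> f \<gamma>)"

text \<open>The support is the closure relative to \<open>U\<close>, not to the possibly non-Hausdorff groupoid.\<close>

definition Cc :: "'g groupoid \<Rightarrow> ('g, 'l) line_bundle \<Rightarrow> 'g set \<Rightarrow> ('g \<Rightarrow> 'l) set" where
  "Cc G L U =
     {f \<in> sections G L.
        continuous_map (subtopology (garr G) U) (ltop L) f \<and>
        compactin (subtopology (garr G) U)
          (subtopology (garr G) U closure_of {\<gamma> \<in> U. f \<gamma> \<noteq> \<zero>\<^bsub>lfib L \<gamma>\<^esub>}) \<and>
        (\<forall>\<gamma>\<in>arrows G - U. f \<gamma> = \<zero>\<^bsub>lfib L \<gamma>\<^esub>)}"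

inductive_set Cc_alg :: "complex set \<Rightarrow> 'g groupoid \<Rightarrow> ('g, 'l) line_bundle \<Rightarrow> ('g \<Rightarrow> 'l) set"
  for F G L where
  zero: "sec_zero G L \<in> Cc_alg F G L"
| base: "\<lbrakk>U \<in> bisections G; f \<in> Cc G L U\<rbrakk> \<Longrightarrow> f \<in> Cc_alg F G L"
| add: "\<lbrakk>f \<in> Cc_alg F G L; g \<in> Cc_alg F G L\<rbrakk> \<Longrightarrow> sec_add G L f g \<in> Cc_alg F G L"
| scale: "\<lbrakk>c \<in> F; f \<in> Cc_alg F G L\<rbrakk> \<Longrightarrow> sec_scale G L c f \<in> Cc_alg F G L"

text \<open>Since \<^const>\<open>gfinprod\<close> over the additive group of a fibre discards vanishing terms, this is
  the sum over the whole range fibre whenever only finitely many terms are nonzero, which is the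
  case for \<open>f\<close> and \<open>g\<close> in \<^const>\<open>Cc_alg\<close>.\<close>

definition conv :: "'g groupoid \<Rightarrow> ('g, 'l) line_bundle \<Rightarrow> ('g \<Rightarrow> 'l) \<Rightarrow> ('g \<Rightarrow> 'l) \<Rightarrow> 'g \<Rightarrow> 'l" where
  "conv G L f g =
     (\<lambda>\<gamma>\<in>arrows G.
        gfinprod (add_monoid (lfib L \<gamma>)) (\<lambda>\<eta>. lmul L (f \<eta>) (g (gmul G (ginv G \<eta>) \<gamma>)))
          {\<eta> \<in> arrows G. gran G \<eta> = gran G \<gamma>})"

definition sec_star :: "'g groupoid \<Rightarrow> ('g, 'l) line_bundle \<Rightarrow> ('g \<Rightarrow> 'l) \<Rightarrow> 'g \<Rightarrow> 'l" where
  "sec_star G L f = (\<lambda>\<gamma>\<in>arrows G. lstar L (f (ginv G \<gamma>)))"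

text \<open>The suprema are taken in \<^typ>\<open>ennreal\<close>, where sums always exist and the supremum over an
  empty unit space is 0. They are finite on \<^const>\<open>Cc_alg\<close>.\<close>

definition norm_d :: "'g groupoid \<Rightarrow> ('g, 'l) line_bundle \<Rightarrow> ('g \<Rightarrow> 'l) \<Rightarrow> real" where
  "norm_d G L f =
     enn2real (SUP x\<in>gunits G. \<Sum>\<^sub>\<infinity>\<gamma>\<in>{\<gamma> \<in> arrows G. gdom G \<gamma> = x}. ennreal (lmod L (f \<gamma>)))"

definition norm_r :: "'g groupoid \<Rightarrow> ('g, 'l) line_bundle \<Rightarrow> ('g \<Rightarrow> 'l) \<Rightarrow> real" where
  "norm_r G L f =
     enn2real (SUP x\<in>gunits G. \<Sum>\<^sub>\<infinity>\<gamma>\<in>{\<gamma> \<in> arrows G. gran G \<gamma> = x}. ennreal (lmod L (f \<gamma>)))"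

definition norm_I :: "'g groupoid \<Rightarrow> ('g, 'l) line_bundle \<Rightarrow> ('g \<Rightarrow> 'l) \<Rightarrow> real" where
  "norm_I G L f = max (norm_d G L f) (norm_r G L f)"

section \<open>C*-algebras over the scalar field and *-homomorphisms\<close>

text \<open>The type classes provide a real Banach algebra, not necessarily unital; for \<open>F = UNIV\<close> the
  operation \<open>sc\<close> is the complex scalar multiplication extending the real one.\<close>

locale cstar_algebra =
  fixes F :: "complex set"
    and sc :: "complex \<Rightarrow> 'b \<Rightarrow> 'b :: {real_normed_algebra, banach}"
    and st :: "'b \<Rightarrow> 'b"
  assumes scalar_field: "F \<in> {\<real>, UNIV}"
    and sc_of_real: "sc (complex_of_real t) a = t *\<^sub>R a"
    and sc_add_left: "\<lbrakk>c \<in> F; c' \<in> F\<rbrakk> \<Longrightarrow> sc (c + c') a = sc c a + sc c' a"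
    and sc_add_right: "c \<in> F \<Longrightarrow> sc c (a + b) = sc c a + sc c b"
    and sc_sc: "\<lbrakk>c \<in> F; c' \<in> F\<rbrakk> \<Longrightarrow> sc c (sc c' a) = sc (c * c') a"
    and sc_mult_left: "c \<in> F \<Longrightarrow> sc c a * b = sc c (a * b)"
    and sc_mult_right: "c \<in> F \<Longrightarrow> a * sc c b = sc c (a * b)"
    and norm_sc: "c \<in> F \<Longrightarrow> norm (sc c a) = cmod c * norm a"
    and st_add: "st (a + b) = st a + st b"
    and st_sc: "c \<in> F \<Longrightarrow> st (sc c a) = sc (cnj c) (st a)"
    and st_mult: "st (a * b) = st b * st a"
    and st_st: "st (st a) = a"
    and cstar_identity: "norm (st a * a) = (norm a)\<^sup>2"
    and real_cstar_inequality: "F = \<real> \<Longrightarrow> norm (st a * a) \<le> norm (st a * a + st b * b)"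

definition star_homomorphism ::
    "complex set \<Rightarrow> 'g groupoid \<Rightarrow> ('g, 'l) line_bundle \<Rightarrow>
     (complex \<Rightarrow> 'b \<Rightarrow> 'b :: {real_normed_algebra, banach}) \<Rightarrow> ('b \<Rightarrow> 'b) \<Rightarrow> (('g \<Rightarrow> 'l) \<Rightarrow> 'b) \<Rightarrow> bool" where
  "star_homomorphism F G L sc st \<psi> \<longleftrightarrow>
     (\<forall>f\<in>Cc_alg F G L. \<forall>g\<in>Cc_alg F G L. \<psi> (sec_add G L f g) = \<psi> f + \<psi> g) \<and>
     (\<forall>c\<in>F. \<forall>f\<in>Cc_alg F G L. \<psi> (sec_scale G L c f) = sc c (\<psi> f)) \<and>
     (\<forall>f\<in>Cc_alg F G L. \<forall>g\<in>Cc_alg F G L. \<psi> (conv G L f g) = \<psi> f * \<psi> g) \<and>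
     (\<forall>f\<in>Cc_alg F G L. \<psi> (sec_star G L f) = st (\<psi> f))"

end

theory Submission
  imports Defs
begin

text \<open>
  Let \<open>h\<close> be a section supported in a bisection. It is a product \<open>a * b\<close> in which \<open>a\<close> is a function on the
  unit space with \<open>a\<^sup>2 \<approx> |h|\<close>, as a function of the range, and \<open>b\<close> is supported in the same bisection with
  \<open>b\<^sup>* * b \<approx> |h|\<close>, as a function of the domain (\<open>piece_factorization\<close>). If \<open>f\<close> is a sum of such sections \<open>h\<^sub>q = a\<^sub>q * b\<^sub>q\<close>,
  the Cauchy--Schwarz inequality for the Hilbert module \<open>B\<close> bounds \<open>(norm (\<psi> f))\<^sup>2\<close> by the product of the
  suprema of \<open>\<Sum> |h\<^sub>q|\<close> over the range fibres and over the domain fibres. The theorem follows once these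
  suprema are almost as small as the norms \<open>norm_r\<close> and \<open>norm_d\<close> of \<open>f\<close>. Two points need work.

  The first is the choice of the sections \<open>h\<^sub>q\<close>. As the groupoid need not be Hausdorff, the summands of \<open>f\<close> in
  a given decomposition can cancel at some arrows, and the groupoid need not admit
  partitions of unity. But near a unit \<open>x\<close> any two bisections through the same arrow over \<open>x\<close> coincide. Adding
  up the sections on coinciding bisections leaves one term for each arrow over \<open>x\<close>, and by continuity
  the sum of the moduli is at most the norm plus \<open>\<epsilon>\<close> on a neighbourhood of \<open>x\<close> (\<open>local_estimate\<close>). A partition of unity
  on the Hausdorff unit space, applied to the range and the domain simultaneously, produces a decomposition
  that satisfies the two bounds at once (\<open>splitting_exists\<close>).

  The second is the Cauchy--Schwarz inequality in an abstract, possibly real, possibly nonunital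
  C*-algebra (\<open>Cauchy_Schwarz_operators\<close>). It rests on the positivity of \<open>st c * c\<close> (\<open>pos_star_mult\<close>). Positivity
  of an operator \<open>P\<close> on \<open>B\<close> is defined by \<open>norm (s - P) \<le> s\<close> for some \<open>s \<ge> 0\<close>, which makes positive operators a convex cone.
  The remaining tool is a square root of \<open>1 - u\<close> for \<open>norm u < 1\<close>, found by iteration.
\<close>

section \<open>Bounded operators on a Banach space form a Banach algebra\<close>

text \<open>Operators on a single space are given a type of their own because the type classes for rings
  and Banach algebras cannot be instantiated at the type of bounded operators between two spaces.
  The identity operator is \<open>1\<close>; the zero space is not excluded, so \<open>0 = 1\<close> is possible.\<close>

typedef (overloaded) ('a::real_normed_vector) endo = "UNIV :: ('a \<Rightarrow>\<^sub>L 'a) set"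
  morphisms blinfun_of_endo endo_of_blinfun
  by simp

setup_lifting type_definition_endo

instantiation endo :: (real_normed_vector) real_normed_algebra
begin

lift_definition zero_endo :: "'a endo" is 0 .
lift_definition plus_endo :: "'a endo \<Rightarrow> 'a endo \<Rightarrow> 'a endo" is "(+)" .
lift_definition minus_endo :: "'a endo \<Rightarrow> 'a endo \<Rightarrow> 'a endo" is "(-)" .
lift_definition uminus_endo :: "'a endo \<Rightarrow> 'a endo" is uminus .
lift_definition times_endo :: "'a endo \<Rightarrow> 'a endo \<Rightarrow> 'a endo" is "(o\<^sub>L)" .
lift_definition scaleR_endo :: "real \<Rightarrow> 'a endo \<Rightarrow> 'a endo" is "(*\<^sub>R)" .
lift_definition norm_endo :: "'a endo \<Rightarrow> real" is norm .

definition dist_endo :: "'a endo \<Rightarrow> 'a endo \<Rightarrow> real" where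
  "dist_endo a b = norm (a - b)"
definition [code del]:
  "(uniformity :: ('a endo \<times> 'a endo) filter) = (INF e\<in>{0 <..}. principal {(x, y). dist x y < e})"
definition open_endo :: "'a endo set \<Rightarrow> bool" where
  [code del]: "open_endo S = (\<forall>x\<in>S. \<forall>\<^sub>F (x', y) in uniformity. x' = x \<longrightarrow> y \<in> S)"
definition sgn_endo :: "'a endo \<Rightarrow> 'a endo" where
  "sgn_endo x = scaleR (inverse (norm x)) x"

instance
proof
  fix a b c :: "'a endo" and r s :: real
  show "a + b + c = a + (b + c)" "a + b = b + a" "0 + a = a" "- a + a = 0" "a - b = a + - b"
    "r *\<^sub>R (a + b) = r *\<^sub>R a + r *\<^sub>R b" "(r + s) *\<^sub>R a = r *\<^sub>R a + s *\<^sub>R a"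
    "r *\<^sub>R s *\<^sub>R a = (r * s) *\<^sub>R a" "1 *\<^sub>R a = a"
    by (transfer; simp add: algebra_simps; fail)+
  show "a * b * c = a * (b * c)"
    by transfer (auto intro!: blinfun_eqI)
  show "(a + b) * c = a * c + b * c" "a * (b + c) = a * b + a * c"
    "r *\<^sub>R a * b = r *\<^sub>R (a * b)" "a * r *\<^sub>R b = r *\<^sub>R (a * b)"
    by (transfer; auto intro!: blinfun_eqI simp: blinfun.bilinear_simps)+
  show "norm (a * b) \<le> norm a * norm b"
    by transfer (rule norm_blinfun_compose)
  show "norm a = 0 \<longleftrightarrow> a = 0" "norm (a + b) \<le> norm a + norm b" "norm (r *\<^sub>R a) = \<bar>r\<bar> * norm a"
    by (transfer; simp add: norm_triangle_ineq)+
qed (simp_all add: dist_endo_def open_endo_def uniformity_endo_def sgn_endo_def)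

end

instantiation endo :: (real_normed_vector) monoid_mult
begin
lift_definition one_endo :: "'a endo" is id_blinfun .
instance
  by (standard; transfer; auto intro!: blinfun_eqI)
end

instance endo :: (banach) banach
proof
  fix X :: "nat \<Rightarrow> 'a endo"
  assume "Cauchy X"
  then have "Cauchy (\<lambda>n. blinfun_of_endo (X n))"
    by (simp add: Cauchy_def dist_norm norm_endo.rep_eq minus_endo.rep_eq)
  then obtain T where "(\<lambda>n. blinfun_of_endo (X n)) \<longlonglongrightarrow> T"
    using Cauchy_convergent convergent_def by blast
  then have "X \<longlonglongrightarrow> endo_of_blinfun T"
    by (simp add: LIMSEQ_def dist_norm norm_endo.rep_eq minus_endo.rep_eq endo_of_blinfun_inverse)
  then show "convergent X"
    by (auto simp: convergent_def)
qed

lift_definition act :: "'a::real_normed_vector endo \<Rightarrow> 'a \<Rightarrow> 'a" (infixr "\<bullet>\<^sub>e" 75) is blinfun_apply .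

lemma act_simps [simp]:
  "(S + T) \<bullet>\<^sub>e b = S \<bullet>\<^sub>e b + T \<bullet>\<^sub>e b" "(S - T) \<bullet>\<^sub>e b = S \<bullet>\<^sub>e b - T \<bullet>\<^sub>e b" "(- T) \<bullet>\<^sub>e b = - (T \<bullet>\<^sub>e b)"
  "(S * T) \<bullet>\<^sub>e b = S \<bullet>\<^sub>e (T \<bullet>\<^sub>e b)" "1 \<bullet>\<^sub>e b = b" "0 \<bullet>\<^sub>e b = 0" "(r *\<^sub>R T) \<bullet>\<^sub>e b = r *\<^sub>R (T \<bullet>\<^sub>e b)"
  "T \<bullet>\<^sub>e (a + b) = T \<bullet>\<^sub>e a + T \<bullet>\<^sub>e b" "T \<bullet>\<^sub>e (a - b) = T \<bullet>\<^sub>e a - T \<bullet>\<^sub>e b" "T \<bullet>\<^sub>e (- b) = - (T \<bullet>\<^sub>e b)"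
  "T \<bullet>\<^sub>e (r *\<^sub>R b) = r *\<^sub>R (T \<bullet>\<^sub>e b)" "T \<bullet>\<^sub>e 0 = 0"
  by (transfer; simp add: blinfun.bilinear_simps)+

lemma act_sum_left: "(sum f I) \<bullet>\<^sub>e b = (\<Sum>i\<in>I. f i \<bullet>\<^sub>e b)"
  by (induction I rule: infinite_finite_induct) auto

lemma endo_eqI: "(\<And>b. S \<bullet>\<^sub>e b = T \<bullet>\<^sub>e b) \<Longrightarrow> S = T"
  by transfer (rule blinfun_eqI)

lemma norm_act_le: "norm (T \<bullet>\<^sub>e b) \<le> norm T * norm b"
  by transfer (rule norm_blinfun)

lemma norm_endo_le: "(\<And>b. norm (T \<bullet>\<^sub>e b) \<le> C * norm b) \<Longrightarrow> 0 \<le> C \<Longrightarrow> norm T \<le> C"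
  by transfer (rule norm_blinfun_bound)

lemma bounded_linear_act: "bounded_linear (\<lambda>T. T \<bullet>\<^sub>e b)"
  by (rule bounded_linear_intro[where K = "norm b"]) (simp_all add: norm_act_le)

lift_definition lmult :: "'a::real_normed_algebra \<Rightarrow> 'a endo" is blinfun_mult_right .

lemma lmult_act [simp]: "lmult a \<bullet>\<^sub>e b = a * b"
  by transfer simp

lemma norm_lmult_le: "norm (lmult a) \<le> norm a"
  by (rule norm_endo_le) (simp_all add: norm_mult_ineq)

lemma lmult_simps [simp]:
  "lmult (a + b) = lmult a + lmult b" "lmult (a - b) = lmult a - lmult b"
  "lmult (- a) = - lmult a" "lmult 0 = 0"
  "lmult (a * b) = lmult a * lmult b" "lmult (r *\<^sub>R a) = r *\<^sub>R lmult a"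
  by (rule endo_eqI; simp add: algebra_simps)+

lemma lmult_sum: "lmult (sum f I) = (\<Sum>i\<in>I. lmult (f i))"
  by (induction I rule: infinite_finite_induct) auto

section \<open>Positive operators on a C*-algebra\<close>

context cstar_algebra
begin

lemma of_real_in_F: "complex_of_real t \<in> F"
  using scalar_field by auto

lemma st_scaleR: "st (t *\<^sub>R a) = t *\<^sub>R st a"
  using st_sc[OF of_real_in_F, of t a] by (simp add: sc_of_real)

lemma st_0 [simp]: "st 0 = 0"
  using st_scaleR[of 0 0] by simp

lemma st_diff: "st (a - b) = st a - st b"
  using st_add[of "a - b" b] by simp

lemma st_sum: "st (sum f I) = (\<Sum>i\<in>I. st (f i))"
  by (induction I rule: infinite_finite_induct) (auto simp: st_add)

lemma sc_diff_right: "c \<in> F \<Longrightarrow> sc c (a - b) = sc c a - sc c b"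
  using sc_add_right[of c "a - b" b] by (simp add: algebra_simps)

lemma sc_i:
  assumes F: "\<And>c. c \<in> F"
  shows "sc (- \<i>) a = - sc \<i> a" "sc \<i> (sc \<i> a) = - a"
proof -
  show "sc (- \<i>) a = - sc \<i> a"
    using sc_add_left[OF F F, of "- \<i>" \<i> a] sc_of_real[of 0 a] by (simp add: eq_neg_iff_add_eq_0)
  show "sc \<i> (sc \<i> a) = - a"
    using sc_sc[OF F F, of \<i> \<i> a] sc_of_real[of "- 1" a] by simp
qed

lemma norm_st [simp]: "norm (st a) = norm a"
proof -
  have le: "norm b \<le> norm (st b)" for b
  proof (cases "b = 0")
    case False
    have "norm b * norm b \<le> norm (st b) * norm b"
      using norm_mult_ineq[of "st b" b] by (simp add: cstar_identity power2_eq_square)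
    then show ?thesis using False by simp
  qed simp
  from le[of a] le[of "st a"] show ?thesis by (simp add: st_st)
qed

text \<open>The algebra need not have a unit. It is a Hilbert module over itself for the pairing
  \<open>st a * b\<close>, and the adjointable operators on this module contain the identity and all left
  multiplications. They serve as a unitization that needs no new norm.\<close>

definition adj :: "'b endo \<Rightarrow> 'b endo \<Rightarrow> bool" where
  "adj T S \<longleftrightarrow> (\<forall>a b. st (T \<bullet>\<^sub>e a) * b = st a * (S \<bullet>\<^sub>e b))"

definition sym :: "'b endo \<Rightarrow> bool" where
  "sym T \<longleftrightarrow> adj T T"

lemma adjD: "adj T S \<Longrightarrow> st (T \<bullet>\<^sub>e a) * b = st a * (S \<bullet>\<^sub>e b)"
  by (simp add: adj_def)

lemma adj_swap: "adj T S \<Longrightarrow> adj S T"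
  unfolding adj_def by (metis st_mult st_st)

lemma adj_add: "adj T S \<Longrightarrow> adj T' S' \<Longrightarrow> adj (T + T') (S + S')"
  by (simp add: adj_def st_add algebra_simps)

lemma adj_diff: "adj T S \<Longrightarrow> adj T' S' \<Longrightarrow> adj (T - T') (S - S')"
  by (simp add: adj_def st_diff algebra_simps)

lemma adj_scaleR: "adj T S \<Longrightarrow> adj (r *\<^sub>R T) (r *\<^sub>R S)"
  by (simp add: adj_def st_scaleR)

lemma adj_mult: "adj T S \<Longrightarrow> adj T' S' \<Longrightarrow> adj (T * T') (S' * S)"
  by (simp add: adj_def)

lemma adj_lmult: "adj (lmult a) (lmult (st a))"
  by (simp add: adj_def st_mult algebra_simps)

lemma sym_intros:
  "sym 0" "sym 1" "sym S \<Longrightarrow> sym T \<Longrightarrow> sym (S + T)" "sym S \<Longrightarrow> sym T \<Longrightarrow> sym (S - T)"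
  "sym S \<Longrightarrow> sym (r *\<^sub>R S)" "sym S \<Longrightarrow> sym T \<Longrightarrow> S * T = T * S \<Longrightarrow> sym (S * T)"
  "st a = a \<Longrightarrow> sym (lmult a)"
  unfolding sym_def
  by (auto intro: adj_add adj_diff adj_scaleR) (auto simp: adj_def st_mult algebra_simps,
      metis act_simps(4))

lemma sym_power: "sym T \<Longrightarrow> sym (T ^ n)"
  by (induction n) (auto intro!: sym_intros simp: power_commutes)

lemma adj_mult_sym: "adj T S \<Longrightarrow> sym (S * T)"
  unfolding sym_def by (rule adj_mult[OF adj_swap])

lemma closed_sym: "closed {T. sym T}"
proof -
  have eq: "{T. sym T} = (\<Inter>a. \<Inter>b. {T. st b * (T \<bullet>\<^sub>e a) - st (st a * (T \<bullet>\<^sub>e b)) = 0})"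
    unfolding sym_def adj_def by (auto simp: st_mult st_st)
  have "bounded_linear st"
    by (rule bounded_linear_intro[where K = 1]) (simp_all add: st_add st_scaleR)
  then have "closed {T. st b * (T \<bullet>\<^sub>e a) - st (st a * (T \<bullet>\<^sub>e b)) = 0}" for a b
    by (intro closed_Collect_eq continuous_intros bounded_linear.continuous_on[OF bounded_linear_act]
        bounded_linear.continuous_on[of st])
  then show ?thesis
    unfolding eq by (intro closed_INT ballI) auto
qed

text \<open>The C*-identity passes to operators because \<open>(norm (T b))\<^sup>2 = norm (st b * T (T b))\<close>.\<close>

lemma norm_sym_square: 
  assumes "sym T" shows "norm (T * T) = (norm T)\<^sup>2"
proof (rule antisym)
  show "norm (T * T) \<le> (norm T)\<^sup>2"
    by (simp add: norm_mult_ineq power2_eq_square)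
  have "norm T \<le> sqrt (norm (T * T))"
  proof (rule norm_endo_le)
    fix b
    have "(norm (T \<bullet>\<^sub>e b))\<^sup>2 = norm (st b * ((T * T) \<bullet>\<^sub>e b))"
      using assms by (simp add: cstar_identity[symmetric] sym_def adjD)
    also have "\<dots> \<le> norm b * norm ((T * T) \<bullet>\<^sub>e b)"
      using norm_mult_ineq[of "st b" "(T * T) \<bullet>\<^sub>e b"] by simp
    also have "\<dots> \<le> norm b * (norm (T * T) * norm b)"
      by (intro mult_left_mono norm_act_le) simp
    also have "\<dots> = (sqrt (norm (T * T)) * norm b)\<^sup>2"
      by (simp add: power_mult_distrib) (simp add: power2_eq_square)
    finally show "norm (T \<bullet>\<^sub>e b) \<le> sqrt (norm (T * T)) * norm b"
      by (rule power2_le_imp_le) simp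
  qed simp
  then show "(norm T)\<^sup>2 \<le> norm (T * T)"
    using power_mono[of "norm T" "sqrt (norm (T * T))" 2] by simp
qed

lemma norm_sym_power:
  assumes "sym T" shows "norm (T ^ 2 ^ k) = norm T ^ 2 ^ k"
proof (induction k)
  case (Suc k)
  have "norm (T ^ 2 ^ Suc k) = norm (T ^ 2 ^ k * T ^ 2 ^ k)"
    by (simp add: mult_2 power_add)
  also have "\<dots> = (norm (T ^ 2 ^ k))\<^sup>2"
    by (rule norm_sym_square[OF sym_power[OF assms]])
  finally show ?case
    unfolding Suc by (simp add: power_mult[symmetric] mult.commute)
qed simp

text \<open>This is where the two kinds of C*-algebras need different arguments: over the reals, the
  claim is the additional axiom \<open>norm (st a * a) \<le> norm (st a * a + st b * b)\<close>; over the complex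
  numbers, \<open>X\<close> is the real part of \<open>X + \<i> W\<close>, which is \<open>t\<close> times an isometry.\<close>

lemma norm_le_of_squares:
  assumes X: "sym X" and W: "sym W" and comm: "X * W = W * X" and t: "0 \<le> t"
    and eq: "X * X + W * W = (t * t) *\<^sub>R 1"
  shows "norm X \<le> t"
proof (rule norm_endo_le)
  fix b
  have sq: "st (X \<bullet>\<^sub>e b) * (X \<bullet>\<^sub>e b) + st (W \<bullet>\<^sub>e b) * (W \<bullet>\<^sub>e b) = (t * t) *\<^sub>R (st b * b)"
  proof -
    have "st (X \<bullet>\<^sub>e b) * (X \<bullet>\<^sub>e b) + st (W \<bullet>\<^sub>e b) * (W \<bullet>\<^sub>e b) = st b * ((X * X + W * W) \<bullet>\<^sub>e b)"
      using X W by (simp add: sym_def adjD algebra_simps)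
    then show ?thesis by (simp add: eq)
  qed
  have cross: "st (X \<bullet>\<^sub>e b) * (W \<bullet>\<^sub>e b) = st (W \<bullet>\<^sub>e b) * (X \<bullet>\<^sub>e b)"
    using X W arg_cong[OF comm, of "\<lambda>T. T \<bullet>\<^sub>e b"] by (simp add: sym_def adjD)
  have root: "norm c \<le> t * norm b" if "norm (st c * c) \<le> t * t * norm (st b * b)" for c
  proof (rule power2_le_imp_le)
    show "(norm c)\<^sup>2 \<le> (t * norm b)\<^sup>2"
      using that unfolding cstar_identity by (simp add: power2_eq_square algebra_simps)
  qed (use t in simp)
  show "norm (X \<bullet>\<^sub>e b) \<le> t * norm b"
  proof (cases "F = \<real>")
    case True
    then show ?thesis
      using real_cstar_inequality[OF True, of "X \<bullet>\<^sub>e b" "W \<bullet>\<^sub>e b"] t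
      by (intro root) (simp add: sq abs_mult)
  next
    case False
    then have F: "c \<in> F" for c
      using scalar_field by auto
    define U V where "U = X \<bullet>\<^sub>e b + sc \<i> (W \<bullet>\<^sub>e b)" and "V = X \<bullet>\<^sub>e b - sc \<i> (W \<bullet>\<^sub>e b)"
    note sci = sc_i[OF F]
    have "st U * U = (t * t) *\<^sub>R (st b * b)" "st V * V = (t * t) *\<^sub>R (st b * b)"
      using sq
      by (simp_all add: U_def V_def st_add st_diff st_sc[OF F] sci algebra_simps sc_mult_left[OF F]
          sc_mult_right[OF F] sc_add_right[OF F] sc_diff_right[OF F] cross)
    then have "norm U \<le> t * norm b" "norm V \<le> t * norm b"
      using t by (auto intro!: root simp: abs_mult)
    moreover have "2 *\<^sub>R (X \<bullet>\<^sub>e b) = U + V"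
      by (simp add: U_def V_def scaleR_2)
    then have "2 * norm (X \<bullet>\<^sub>e b) \<le> norm U + norm V"
      by (metis norm_scaleR norm_triangle_ineq abs_numeral)
    ultimately show ?thesis by simp
  qed
qed (fact t)

text \<open>The square root is \<open>1 - y\<close> for the fixed point \<open>y\<close> of \<open>y \<mapsto> (u + y\<^sup>2) / 2\<close>, which contracts the
  ball of radius \<open>1 - sqrt (1 - norm u)\<close>; symmetry and the commutation relations are closed
  conditions that the iteration preserves.\<close>

lemma square_root_exists:
  assumes u: "sym u" and less: "norm u < 1"
  obtains W where "sym W" "W * W = 1 - u" "\<And>T. T * u = u * T \<Longrightarrow> T * W = W * T"
proof -
  \<comment> \<open>the smaller root of \<open>c\<^sup>2 - 2 c + norm u = 0\<close>, so that the iteration maps the ball into itself\<close>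
  define c where "c = 1 - sqrt (1 - norm u)"
  have c: "0 \<le> c" "c < 1" and cc: "norm u + c * c = 2 * c"
  proof -
    have "sqrt (1 - norm u) * sqrt (1 - norm u) = 1 - norm u"
      using less by simp
    then show "norm u + c * c = 2 * c"
      unfolding c_def by (simp only: algebra_simps)
    show "0 \<le> c" "c < 1"
      using less by (simp_all add: c_def)
  qed
  define S where "S = cball 0 c \<inter> {y. sym y} \<inter> (\<Inter>T\<in>{T. T * u = u * T}. {y. T * y = y * T})"
  define f where "f = (\<lambda>y. (1/2) *\<^sub>R (u + y * y))"
  have "\<exists>!y\<in>S. f y = y"
  proof (rule Banach_fix[where c = c])
    show "complete S"
      unfolding S_def complete_eq_closed
      by (intro closed_Int closed_cball closed_sym closed_INT ballI closed_Collect_eq continuous_intros)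
    have "0 \<in> S"
      using c sym_intros(1) by (simp add: S_def)
    then show "S \<noteq> {}" by auto
    show "f ` S \<subseteq> S"
    proof (rule image_subsetI)
      fix y assume "y \<in> S"
      then have y: "norm y \<le> c" "sym y" "\<And>T. T * u = u * T \<Longrightarrow> T * y = y * T"
        by (auto simp: S_def)
      have "norm (y * y) \<le> c * c"
        using y(1) c by (intro order_trans[OF norm_mult_ineq] mult_mono) auto
      then have "norm (u + y * y) \<le> 2 * c"
        unfolding cc[symmetric] by (rule norm_triangle_mono[OF order_refl])
      moreover have "sym (f y)"
        unfolding f_def using y(2) by (intro sym_intros u) auto
      moreover have "T * f y = f y * T" if T: "T * u = u * T" for T
      proof -
        have "T * (y * y) = (y * y) * T"
          using y(3)[OF T] by (metis mult.assoc)
        then show ?thesis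
          using T by (simp add: f_def algebra_simps)
      qed
      ultimately show "f y \<in> S" by (simp add: S_def f_def)
    qed
    fix y z assume "y \<in> S" "z \<in> S"
    then have yz: "norm y \<le> c" "norm z \<le> c" by (auto simp: S_def)
    have "f y - f z = (1/2) *\<^sub>R (y * (y - z) + (y - z) * z)"
      by (simp add: f_def algebra_simps)
    then have "norm (f y - f z) = norm (y * (y - z) + (y - z) * z) / 2"
      by simp
    also have "\<dots> \<le> (c * norm (y - z) + norm (y - z) * c) / 2"
      using yz c by (intro divide_right_mono norm_triangle_mono order_trans[OF norm_mult_ineq] mult_mono) auto
    finally show "dist (f y) (f z) \<le> c * dist y z"
      by (simp add: dist_norm)
  qed (use c in auto)
  then obtain y where y: "y \<in> S" "f y = y" by auto
  have "2 *\<^sub>R f y = u + y * y"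
    unfolding f_def scaleR_scaleR by simp
  then have "2 *\<^sub>R y = u + y * y"
    unfolding y(2) .
  show thesis
  proof
    show "(1 - y) * (1 - y) = 1 - u"
      using \<open>2 *\<^sub>R y = u + y * y\<close> by (simp add: algebra_simps scaleR_2)
    show "sym (1 - y)"
      using y(1) by (intro sym_intros) (auto simp: S_def)
    show "T * (1 - y) = (1 - y) * T" if "T * u = u * T" for T
      using y(1) that by (auto simp: S_def algebra_simps)
  qed
qed

text \<open>For a symmetric operator this norm condition expresses that the spectrum is nonnegative. In this
  form, sums of positive operators are positive by the triangle inequality alone.\<close>

definition pos :: "'b endo \<Rightarrow> bool" where
  "pos P \<longleftrightarrow> sym P \<and> (\<exists>s\<ge>0. norm (s *\<^sub>R 1 - P) \<le> s)"

lemma pos_add: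
  assumes "pos P" "pos Q" shows "pos (P + Q)"
proof -
  from assms obtain s t where "0 \<le> s" "0 \<le> t" "norm (s *\<^sub>R 1 - P) \<le> s" "norm (t *\<^sub>R 1 - Q) \<le> t"
    by (auto simp: pos_def)
  moreover have "(s + t) *\<^sub>R 1 - (P + Q) = (s *\<^sub>R 1 - P) + (t *\<^sub>R 1 - Q)"
    by (simp add: algebra_simps)
  ultimately have "norm ((s + t) *\<^sub>R 1 - (P + Q)) \<le> s + t" "0 \<le> s + t"
    by (simp_all only: norm_triangle_mono add_nonneg_nonneg)
  with assms show ?thesis by (auto simp: pos_def intro: sym_intros)
qed

lemma pos_scaleR:
  assumes "pos P" "0 \<le> r" shows "pos (r *\<^sub>R P)"
proof -
  from assms obtain s where s: "0 \<le> s" "norm (s *\<^sub>R 1 - P) \<le> s"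
    by (auto simp: pos_def)
  have "(r * s) *\<^sub>R 1 - r *\<^sub>R P = r *\<^sub>R (s *\<^sub>R 1 - P)"
    by (simp add: algebra_simps)
  then have "norm ((r * s) *\<^sub>R 1 - r *\<^sub>R P) \<le> r * s"
    using s \<open>0 \<le> r\<close> by (simp add: mult_left_mono)
  with assms s show ?thesis by (auto simp: pos_def intro!: sym_intros exI[of _ "r * s"])
qed

lemma pos_zero: "pos 0"
  by (auto simp: pos_def intro: sym_intros exI[of _ 0])

lemma pos_sum: "(\<And>i. i \<in> I \<Longrightarrow> pos (f i)) \<Longrightarrow> pos (sum f I)"
  by (induction I rule: infinite_finite_induct) (auto intro: pos_zero pos_add)

lemma norm_one_endo_le: "norm (1 :: 'b endo) \<le> 1"
  by transfer (rule norm_blinfun_id_le)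

text \<open>For a scaled copy \<open>Y\<close> of \<open>X\<close> of norm less than one and the root \<open>W\<close> of \<open>1 - Y\<^sup>2\<close>, the equation
  \<open>W\<^sup>2 + Y\<^sup>2 = 1\<close> gives \<open>norm W \<le> 1\<close>, hence \<open>norm (1 - Y\<^sup>2) \<le> 1\<close>.\<close>

lemma pos_square:
  assumes X: "sym X" shows "pos (X * X)"
proof -
  define M where "M = norm X + 1"
  have M: "0 < M" "norm X < M" unfolding M_def by (simp_all add: add_nonneg_pos)
  define Y where "Y = (1 / M) *\<^sub>R X"
  have Y: "sym Y" unfolding Y_def by (intro sym_intros X)
  have "norm Y < 1" using M by (simp add: Y_def)
  then have "norm (Y * Y) < 1"
    unfolding norm_sym_square[OF Y] by (simp add: power_less_one_iff abs_square_less_1)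
  then obtain W where W: "sym W" "W * W = 1 - Y * Y" "\<And>T. T * (Y * Y) = Y * Y * T \<Longrightarrow> T * W = W * T"
    using square_root_exists[of "Y * Y"] Y by (metis sym_intros(6))
  have "norm W \<le> 1"
  proof (rule norm_le_of_squares[OF W(1) Y])
    show "W * Y = Y * W" using W(3)[of Y] by (simp add: mult.assoc)
    show "W * W + Y * Y = (1 * 1) *\<^sub>R 1" by (simp add: W)
  qed simp
  then have le: "norm (W * W) \<le> 1"
    using norm_mult_ineq[of W W] by (meson mult_le_one norm_ge_zero order_trans)
  have "(M * M) *\<^sub>R 1 - X * X = (M * M) *\<^sub>R (W * W)"
    using M by (simp add: W Y_def algebra_simps)
  with le have "norm ((M * M) *\<^sub>R 1 - X * X) \<le> M * M"
    by (simp add: mult_left_le)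
  moreover have "sym (X * X)"
    using X by (intro sym_intros) auto
  ultimately show ?thesis by (auto simp: pos_def intro!: exI[of _ "M * M"])
qed

lemma pos_one: "pos 1"
  using pos_square[OF sym_intros(2)] by simp

text \<open>The summand \<open>e\<close> makes the operator \<open>u\<close> under the root of \<open>1 - u\<close> a strict contraction.\<close>

lemma pos_square_root_exists:
  assumes P: "pos P" and e: "0 < e"
  obtains V where "sym V" "V * V = P + e *\<^sub>R 1" "\<And>T. T * P = P * T \<Longrightarrow> T * V = V * T"
proof -
  from P obtain s where s: "0 \<le> s" "norm (s *\<^sub>R 1 - P) \<le> s" and symP: "sym P"
    by (auto simp: pos_def)
  define u where "u = (1 / (s + e)) *\<^sub>R (s *\<^sub>R 1 - P)"
  have "sym u" unfolding u_def by (intro sym_intros symP)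
  moreover have "norm u < 1" using s e by (simp add: u_def)
  ultimately obtain W where W: "sym W" "W * W = 1 - u" "\<And>T. T * u = u * T \<Longrightarrow> T * W = W * T"
    using square_root_exists by blast
  show thesis
  proof
    show "sym (sqrt (s + e) *\<^sub>R W)" by (intro sym_intros W)
    have "(s + e) *\<^sub>R u = s *\<^sub>R 1 - P"
      using s e by (simp add: u_def)
    then have "(s + e) *\<^sub>R (1 - u) = P + e *\<^sub>R 1"
      by (simp add: algebra_simps)
    then show "(sqrt (s + e) *\<^sub>R W) * (sqrt (s + e) *\<^sub>R W) = P + e *\<^sub>R 1"
      using s e by (simp add: W)
    fix T assume "T * P = P * T"
    then have "T * u = u * T" by (simp add: u_def algebra_simps)
    then show "T * (sqrt (s + e) *\<^sub>R W) = (sqrt (s + e) *\<^sub>R W) * T"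
      using W(3) by simp
  qed
qed

text \<open>The product of the commuting positive operators \<open>C - X\<close> and \<open>C + X\<close> is the square of
  the product of their roots, so that \<open>X\<^sup>2\<close> and this square add up to \<open>C\<^sup>2\<close>.\<close>

lemma norm_le_of_pos:
  assumes minus: "pos (C *\<^sub>R 1 - X)" and plus: "pos (C *\<^sub>R 1 + X)" and C: "0 \<le> C"
  shows "norm X \<le> C"
proof (rule field_le_epsilon)
  fix e :: real assume e: "0 < e"
  have X: "sym X"
  proof -
    have "sym ((C *\<^sub>R 1 + X) - C *\<^sub>R 1)"
      using plus by (intro sym_intros(4) sym_intros(5)[OF sym_intros(2)]) (simp add: pos_def)
    then show ?thesis by simp
  qed
  obtain V where V: "sym V" "V * V = C *\<^sub>R 1 - X + e *\<^sub>R 1"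
      "\<And>T. T * (C *\<^sub>R 1 - X) = (C *\<^sub>R 1 - X) * T \<Longrightarrow> T * V = V * T"
    using pos_square_root_exists[OF minus e] by blast
  obtain Z where Z: "sym Z" "Z * Z = C *\<^sub>R 1 + X + e *\<^sub>R 1"
      "\<And>T. T * (C *\<^sub>R 1 + X) = (C *\<^sub>R 1 + X) * T \<Longrightarrow> T * Z = Z * T"
    using pos_square_root_exists[OF plus e] by blast
  have XV: "X * V = V * X" and XZ: "X * Z = Z * X"
    by (rule V Z; simp add: algebra_simps)+
  have VZ: "V * Z = Z * V"
    by (rule Z) (simp add: algebra_simps XV)
  show "norm X \<le> C + e"
  proof (rule norm_le_of_squares[OF X])
    show "sym (V * Z)" using V Z VZ by (intro sym_intros)
    show "X * (V * Z) = V * Z * X" by (metis XV XZ mult.assoc)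
    have binomial: "(k *\<^sub>R 1 - X) * (k *\<^sub>R 1 + X) = (k * k) *\<^sub>R 1 - X * X" for k
      by (simp add: algebra_simps)
    have "V * Z * (V * Z) = (V * V) * (Z * Z)"
      by (metis VZ mult.assoc)
    also have "\<dots> = ((C + e) *\<^sub>R 1 - X) * ((C + e) *\<^sub>R 1 + X)"
      by (simp add: V Z algebra_simps)
    also have "\<dots> = ((C + e) * (C + e)) *\<^sub>R 1 - X * X"
      by (rule binomial)
    finally show "X * X + V * Z * (V * Z) = ((C + e) * (C + e)) *\<^sub>R 1"
      by simp
  qed (use C e in simp)
qed

text \<open>On the spectrum of \<open>H\<close> this is the inequality \<open>t (1 - t) ^ m \<le> 1\<close> for \<open>t \<le> 1\<close>. With \<open>W\<^sup>2 = 1 - H\<close>, the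
  operator for \<open>m + 1\<close> is the one for \<open>m\<close> plus the square of \<open>W ^ m H\<close>.\<close>

lemma pos_one_minus_times_power:
  assumes H: "sym H" "norm H < 1" shows "pos (1 - H * (1 - H) ^ m)"
proof -
  obtain W where W: "sym W" "W * W = 1 - H" "\<And>T. T * H = H * T \<Longrightarrow> T * W = W * T"
    using square_root_exists[OF H] by blast
  have HW: "H * W = W * H" by (rule W) simp
  have HWn: "H * W ^ n = W ^ n * H" for n
    using HW by (metis power_commuting_commutes)
  have pow: "(1 - H) ^ n = W ^ n * W ^ n" for n
    by (simp only: W(2)[symmetric] power2_eq_square[symmetric] power_mult[symmetric] power_add[symmetric] mult_2 mult_2_right)
  show ?thesis
  proof (induction m)
    case 0
    show ?case using pos_square[OF W(1)] by (simp add: W(2))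
  next
    case (Suc m)
    have "1 - H * (1 - H) ^ Suc m = (1 - H * (1 - H) ^ m) + H * (1 - H) ^ m * H"
      by (simp add: power_commutes[symmetric] algebra_simps)
    also have "H * (1 - H) ^ m * H = (W ^ m * H) * (W ^ m * H)"
      unfolding pow by (metis HWn mult.assoc)
    finally have eq: "1 - H * (1 - H) ^ Suc m =
        (1 - H * (1 - H) ^ m) + (W ^ m * H) * (W ^ m * H)" .
    have "sym (W ^ m * H)"
      by (rule sym_intros(6)[OF sym_power[OF W(1)] H(1) HWn[symmetric]])
    then show ?case
      unfolding eq by (intro pos_add[OF Suc] pos_square)
  qed
qed

text \<open>Since \<open>norm (T ^ n) = norm T ^ n\<close> for powers \<open>n\<close> of two, a norm above one would make the powers
  grow exponentially.\<close>

lemma norm_le_one_of_linear_growth: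
  fixes T :: "'b endo"
  assumes T: "sym T" and le: "\<And>m. norm (T ^ m) \<le> 1 + real m * K"
  shows "norm T \<le> 1"
proof (rule ccontr)
  assume "\<not> norm T \<le> 1"
  define y where "y = 1 / norm T"
  have y: "0 < y" "y < 1"
    using \<open>\<not> norm T \<le> 1\<close> unfolding y_def zero_less_divide_1_iff divide_less_eq_1 by linarith+
  have "1 \<le> y ^ 2 ^ k + K * (real (2 ^ k) * y ^ 2 ^ k)" for k
  proof -
    have "norm T ^ 2 ^ k * y ^ 2 ^ k \<le> (1 + real (2 ^ k) * K) * y ^ 2 ^ k"
      using y le[of "2 ^ k"] by (intro mult_right_mono) (simp_all add: norm_sym_power[OF T])
    moreover have "norm T ^ 2 ^ k * y ^ 2 ^ k = 1"
      using \<open>\<not> norm T \<le> 1\<close> by (auto simp: y_def power_mult_distrib[symmetric])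
    ultimately show ?thesis by (simp add: algebra_simps)
  qed
  moreover have "(\<lambda>k. y ^ 2 ^ k + K * (real (2 ^ k) * y ^ 2 ^ k)) \<longlonglongrightarrow> 0 + K * 0"
  proof -
    have "filterlim (\<lambda>k. 2 ^ k :: nat) sequentially sequentially"
      by (rule filterlim_subseq) (simp add: strict_mono_def)
    moreover have "(\<lambda>n. y ^ n + K * (real n * y ^ n)) \<longlonglongrightarrow> 0 + K * 0"
      using y by (intro tendsto_intros LIMSEQ_power_zero powser_times_n_limit_0) auto
    ultimately show ?thesis
      by (rule filterlim_compose[rotated])
  qed
  ultimately have "(1::real) \<le> 0 + K * 0"
    by (intro LIMSEQ_le_const) auto
  then show False by simp
qed

text \<open>Up to the factor two, this is the sum of the squares of \<open>C + D\<close> and \<open>\<i> (C - D)\<close>.\<close>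

lemma complex_pos_sum_of_products:
  assumes F: "\<And>c. c \<in> F" and CD: "adj C D"
    and C: "\<And>b. C \<bullet>\<^sub>e sc \<i> b = sc \<i> (C \<bullet>\<^sub>e b)" and D: "\<And>b. D \<bullet>\<^sub>e sc \<i> b = sc \<i> (D \<bullet>\<^sub>e b)"
  shows "pos (D * C + C * D)"
proof -
  have "bounded_linear (sc \<i>)"
  proof (rule bounded_linear_intro[where K = 1])
    fix r b
    show "sc \<i> (r *\<^sub>R b) = r *\<^sub>R sc \<i> b"
      using sc_sc[OF F F, of \<i> "of_real r" b] sc_sc[OF F F, of "of_real r" \<i> b]
      by (simp add: sc_of_real mult.commute)
  qed (simp_all add: sc_add_right[OF F] norm_sc[OF F])
  then obtain J where J: "\<And>b. J \<bullet>\<^sub>e b = sc \<i> b"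
    using act.abs_eq bounded_linear_Blinfun_apply by metis
  define x y where "x = C + D" and "y = J * (C - D)"
  have "sym x"
    unfolding x_def sym_def using adj_add[OF CD adj_swap[OF CD]] by (simp add: add.commute)
  moreover have "sym y"
    unfolding sym_def adj_def y_def
    by (simp add: J st_sc[OF F] sc_i[OF F] sc_mult_left[OF F] sc_mult_right[OF F] C D st_diff
        adjD[OF CD] adjD[OF adj_swap[OF CD]] sc_diff_right[OF F] algebra_simps)
  ultimately have "pos (x * x + y * y)"
    by (intro pos_add pos_square)
  moreover have "x * x + y * y = 2 *\<^sub>R (D * C + C * D)"
    by (rule endo_eqI)
      (simp add: x_def y_def J C D sc_i[OF F] sc_diff_right[OF F] algebra_simps scaleR_2)
  moreover have "(1/2) *\<^sub>R (2 *\<^sub>R T) = T" for T :: "'b endo"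
    by simp
  ultimately show ?thesis
    using pos_scaleR[of "x * x + y * y" "1/2"] by simp
qed

text \<open>Put \<open>H = D C\<close>, \<open>N = C D\<close> and \<open>\<phi>\<^sub>n(t) = t (1 - t) ^ (2 * n)\<close>. The operator \<open>\<phi>\<^sub>n(H) + \<phi>\<^sub>n(N)\<close> is the
  sum of the two products of \<open>C (1 - H) ^ n\<close> and its adjoint, hence positive. Together with
  \<open>\<phi>\<^sub>n(H) \<le> 1\<close> and \<open>\<phi>\<^sub>n(N) \<le> 1\<close> this yields \<open>- 1 \<le> \<phi>\<^sub>n(H) \<le> 1\<close> for all \<open>n\<close>. But \<open>\<phi>\<^sub>n(t)\<close> is unbounded
  in \<open>n\<close> at every negative \<open>t\<close>; without spectra, the bound says that the powers of \<open>1 - H\<close> grow at most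
  linearly, because \<open>H (1 - H) ^ m\<close> is the difference of two consecutive powers.\<close>

lemma complex_pos_adj_mult:
  assumes F: "\<And>c. c \<in> F" and CD: "adj C D" and less: "norm C < 1" "norm D < 1"
    and C: "\<And>b. C \<bullet>\<^sub>e sc \<i> b = sc \<i> (C \<bullet>\<^sub>e b)" and D: "\<And>b. D \<bullet>\<^sub>e sc \<i> b = sc \<i> (D \<bullet>\<^sub>e b)"
  shows "pos (D * C)"
proof -
  define H N where "H = D * C" and "N = C * D"
  have less_one: "norm (S * T) < 1" if "norm S < 1" "norm T < 1" for S T :: "'b endo"
    using that norm_mult_ineq[of S T] mult_le_one[of "norm S" "norm T"]
    by (smt (verit) mult_less_cancel_right2 norm_ge_zero mult_left_le)
  have H: "sym H" "norm H < 1" and N: "sym N" "norm N < 1"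
    using adj_mult_sym[OF CD] adj_mult_sym[OF adj_swap[OF CD]] less less_one
    by (auto simp: H_def N_def)
  have CH: "C * (1 - H) ^ n = (1 - N) ^ n * C" for n
  proof (induction n)
    case (Suc n)
    have "C * (1 - H) = (1 - N) * C"
      by (simp add: H_def N_def algebra_simps)
    with Suc show ?case
      by (simp add: power_commutes[symmetric] mult.assoc) (metis mult.assoc)
  qed simp
  have symH: "sym ((1 - H) ^ n)" for n
    by (intro sym_power sym_intros H)
  have commH: "H * (1 - H) ^ n = (1 - H) ^ n * H" for n
    by (rule power_commuting_commutes[symmetric]) (simp add: algebra_simps)
  have bound: "norm (H * (1 - H) ^ (2 * n)) \<le> 1" for n
  proof (rule norm_le_of_pos)
    let ?C = "C * (1 - H) ^ n" and ?D = "(1 - H) ^ n * D"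
    have J: "(1 - H) ^ n \<bullet>\<^sub>e sc \<i> b = sc \<i> ((1 - H) ^ n \<bullet>\<^sub>e b)" for n b
      by (induction n arbitrary: b) (simp_all add: H_def C D sc_diff_right[OF F])
    have "pos (?D * ?C + ?C * ?D)"
    proof (rule complex_pos_sum_of_products[OF F])
      show "adj ?C ?D"
        using symH by (intro adj_mult CD) (simp add: sym_def)
    qed (simp_all add: C D J)
    moreover have "?D * ?C = H * (1 - H) ^ (2 * n)"
    proof -
      have "?D * ?C = (1 - H) ^ n * H * (1 - H) ^ n"
        by (simp add: H_def mult.assoc)
      then show ?thesis by (simp add: commH[symmetric] mult.assoc power_add[symmetric] mult_2)
    qed
    moreover have "?C * ?D = N * (1 - N) ^ (2 * n)"
    proof -
      have "?C * ?D = (C * (1 - H) ^ (2 * n)) * D"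
        by (simp add: mult.assoc power_add mult_2)
      also have "\<dots> = (1 - N) ^ (2 * n) * N"
        unfolding CH by (simp add: N_def mult.assoc)
      also have "\<dots> = N * (1 - N) ^ (2 * n)"
        by (rule power_commuting_commutes) (simp add: algebra_simps)
      finally show ?thesis .
    qed
    ultimately have "pos ((H * (1 - H) ^ (2 * n) + N * (1 - N) ^ (2 * n)) + (1 - N * (1 - N) ^ (2 * n)))"
      by (intro pos_add[OF _ pos_one_minus_times_power[OF N]]) (simp only:)
    then show "pos (1 *\<^sub>R 1 + H * (1 - H) ^ (2 * n))"
      by (simp add: algebra_simps)
    show "pos (1 *\<^sub>R 1 - H * (1 - H) ^ (2 * n))"
      using pos_one_minus_times_power[OF H] by simp
  qed simp
  define K where "K = max 1 (norm (1 - H))"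
  have K: "norm (H * (1 - H) ^ m) \<le> K" for m
  proof (cases "even m")
    case True
    then show ?thesis using bound[of "m div 2"] by (simp add: K_def)
  next
    case False
    then obtain n where m: "m = 2 * n + 1" by (auto elim: oddE)
    have "norm (H * (1 - H) ^ (2 * n) * (1 - H)) \<le> 1 * K"
      using bound[of n] by (rule order_trans[OF norm_mult_ineq mult_mono]) (auto simp: K_def)
    then show ?thesis by (simp add: m mult.assoc power_commutes)
  qed
  have "norm ((1 - H) ^ m) \<le> 1 + real m * K" for m
  proof (induction m)
    case 0
    then show ?case using norm_one_endo_le by simp
  next
    case (Suc m)
    have "(1 - H) ^ Suc m = (1 - H) ^ m - H * (1 - H) ^ m"
      by (simp add: algebra_simps)
    then have "norm ((1 - H) ^ Suc m) \<le> norm ((1 - H) ^ m) + norm (H * (1 - H) ^ m)"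
      by (metis norm_triangle_ineq4)
    also have "\<dots> \<le> (1 + real m * K) + K"
      by (intro add_mono Suc K)
    finally show ?case by (simp add: algebra_simps)
  qed
  then have "norm (1 - H) \<le> 1"
    by (intro norm_le_one_of_linear_growth) (auto intro: sym_intros H)
  then show ?thesis
    using H by (auto simp: pos_def H_def intro!: exI[of _ 1])
qed

text \<open>Over the reals, for \<open>norm d < 1\<close> and \<open>W\<close> the root of \<open>1 - st d * d\<close>, the additional axiom gives
  \<open>(norm (W b))\<^sup>2 \<le> norm (st (W b) * W b + st (d b) * d b) = (norm b)\<^sup>2\<close>, so that \<open>1 - st d * d = W\<^sup>2\<close> has norm
  at most one.\<close>

lemma pos_star_mult: "pos (lmult (st c * c))"
proof -
  define M where "M = norm c + 1"
  have M: "0 < M" "norm c < M" unfolding M_def by (simp_all add: add_nonneg_pos)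
  define d where "d = (1 / M) *\<^sub>R c"
  have less: "norm d < 1" using M by (simp add: d_def)
  have "pos (lmult (st d * d))"
  proof (cases "F = \<real>")
    case True
    define u where "u = lmult (st d * d)"
    have u: "sym u" unfolding u_def by (intro sym_intros) (simp add: st_mult st_st)
    have "norm u < 1"
      using norm_lmult_le[of "st d * d"] less abs_square_less_1[of "norm d"]
      by (simp add: u_def cstar_identity del: lmult_simps)
    then obtain W where W: "sym W" "W * W = 1 - u"
      using square_root_exists[OF u] by blast
    have "norm W \<le> 1"
    proof (rule norm_endo_le)
      fix b
      have "(norm (W \<bullet>\<^sub>e b))\<^sup>2 \<le> norm (st (W \<bullet>\<^sub>e b) * (W \<bullet>\<^sub>e b) + st (d * b) * (d * b))"
        unfolding cstar_identity[symmetric] by (rule real_cstar_inequality[OF True])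
      also have "st (W \<bullet>\<^sub>e b) * (W \<bullet>\<^sub>e b) + st (d * b) * (d * b) = st b * ((W * W + u) \<bullet>\<^sub>e b)"
        using W(1) by (simp add: sym_def adjD st_mult u_def algebra_simps)
      also have "\<dots> = st b * b" by (simp add: W)
      finally show "norm (W \<bullet>\<^sub>e b) \<le> 1 * norm b"
        by (simp add: cstar_identity)
    qed simp
    then have "norm (1 *\<^sub>R 1 - u) \<le> 1"
      using norm_mult_ineq[of W W] mult_le_one[of "norm W" "norm W"] by (simp add: W(2)[symmetric])
    with u show ?thesis by (auto simp: pos_def u_def intro!: exI[of _ 1])
  next
    case False
    then have F: "c \<in> F" for c using scalar_field by auto
    have "pos (lmult (st d) * lmult d)"
      using less norm_lmult_le[of d] norm_lmult_le[of "st d"]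
      by (intro complex_pos_adj_mult[OF F] adj_lmult) (simp_all add: sc_mult_right[OF F])
    then show ?thesis by simp
  qed
  then have "pos ((M * M) *\<^sub>R lmult (st d * d))"
    by (rule pos_scaleR) simp
  also have "(M * M) *\<^sub>R lmult (st d * d) = lmult (st c * c)"
    using M by (simp add: d_def st_scaleR del: lmult_simps(5) flip: lmult_simps(6))
  finally show ?thesis .
qed

text \<open>The Cauchy--Schwarz inequality for the \<open>B\<close>-valued pairing of tuples. For \<open>A = \<Sum> a\<^sub>i b\<^sub>i\<close> and
  \<open>\<alpha> = \<Sum> a\<^sub>i\<^sup>2\<close>, expanding \<open>\<Sum> st (a\<^sub>i A - \<rho> b\<^sub>i) * (a\<^sub>i A - \<rho> b\<^sub>i) \<ge> 0\<close> and adding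
  \<open>st A * (\<rho> - \<alpha>) A \<ge> 0\<close> yields \<open>\<rho> st A * A \<le> \<rho>\<^sup>2 \<Sum> st b\<^sub>i * b\<^sub>i\<close>.\<close>

lemma Cauchy_Schwarz_operators:
  assumes a: "\<And>i. i \<in> I \<Longrightarrow> sym (a i)" and rho: "0 < \<rho>" and delta: "0 \<le> \<delta>"
    and V: "sym V" "V * V = \<rho> *\<^sub>R 1 - (\<Sum>i\<in>I. a i * a i)"
    and pos_b: "pos (\<delta> *\<^sub>R 1 - lmult (\<Sum>i\<in>I. st (b i) * b i))"
  shows "(norm (\<Sum>i\<in>I. a i \<bullet>\<^sub>e b i))\<^sup>2 \<le> \<rho> * \<delta>"
proof -
  define A where "A = (\<Sum>i\<in>I. a i \<bullet>\<^sub>e b i)"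
  define c where "c i = a i \<bullet>\<^sub>e A - \<rho> *\<^sub>R b i" for i
  have "(\<Sum>i\<in>I. st (c i) * c i) =
      (\<Sum>i\<in>I. st A * ((a i * a i) \<bullet>\<^sub>e A) - \<rho> *\<^sub>R (st A * (a i \<bullet>\<^sub>e b i)) - \<rho> *\<^sub>R (st (a i \<bullet>\<^sub>e b i) * A)
        + (\<rho> * \<rho>) *\<^sub>R (st (b i) * b i))"
  proof (rule sum.cong)
    fix i assume "i \<in> I"
    then have "adj (a i) (a i)" using a by (simp add: sym_def)
    then show "st (c i) * c i = st A * ((a i * a i) \<bullet>\<^sub>e A) - \<rho> *\<^sub>R (st A * (a i \<bullet>\<^sub>e b i))
        - \<rho> *\<^sub>R (st (a i \<bullet>\<^sub>e b i) * A) + (\<rho> * \<rho>) *\<^sub>R (st (b i) * b i)"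
      by (simp add: c_def st_diff st_scaleR adjD algebra_simps)
  qed simp
  also have "\<dots> = st A * ((\<Sum>i\<in>I. a i * a i) \<bullet>\<^sub>e A) - \<rho> *\<^sub>R (st A * A) - \<rho> *\<^sub>R (st A * A)
      + (\<rho> * \<rho>) *\<^sub>R (\<Sum>i\<in>I. st (b i) * b i)"
  proof -
    have "(\<Sum>i\<in>I. st A * ((a i * a i) \<bullet>\<^sub>e A)) = st A * ((\<Sum>i\<in>I. a i * a i) \<bullet>\<^sub>e A)"
      by (simp only: act_sum_left sum_distrib_left)
    moreover have "(\<Sum>i\<in>I. st A * (a i \<bullet>\<^sub>e b i)) = st A * A"
      by (simp add: A_def sum_distrib_left)
    moreover have "(\<Sum>i\<in>I. st (a i \<bullet>\<^sub>e b i) * A) = st A * A"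
      by (simp add: st_sum A_def sum_distrib_right)
    ultimately show ?thesis
      by (simp add: sum.distrib sum_subtractf scaleR_sum_right[symmetric])
  qed
  finally have c: "(\<Sum>i\<in>I. st (c i) * c i) = \<dots>" .
  have "st (V \<bullet>\<^sub>e A) * (V \<bullet>\<^sub>e A) = st A * ((V * V) \<bullet>\<^sub>e A)"
    using V(1) by (simp add: sym_def adjD)
  also have "\<dots> = \<rho> *\<^sub>R (st A * A) - st A * ((\<Sum>i\<in>I. a i * a i) \<bullet>\<^sub>e A)"
    by (simp add: V algebra_simps)
  finally have eq: "(\<Sum>i\<in>I. st (c i) * c i) + st (V \<bullet>\<^sub>e A) * (V \<bullet>\<^sub>e A) =
      (\<rho> * \<rho>) *\<^sub>R (\<Sum>i\<in>I. st (b i) * b i) - \<rho> *\<^sub>R (st A * A)"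
    unfolding c by simp
  have "pos ((\<rho> * \<rho>) *\<^sub>R (\<delta> *\<^sub>R 1 - lmult (\<Sum>i\<in>I. st (b i) * b i)) +
      ((\<Sum>i\<in>I. lmult (st (c i) * c i)) + lmult (st (V \<bullet>\<^sub>e A) * (V \<bullet>\<^sub>e A))))"
    by (intro pos_add pos_scaleR pos_sum pos_star_mult pos_b) simp
  also have "(\<Sum>i\<in>I. lmult (st (c i) * c i)) + lmult (st (V \<bullet>\<^sub>e A) * (V \<bullet>\<^sub>e A)) =
      (\<rho> * \<rho>) *\<^sub>R lmult (\<Sum>i\<in>I. st (b i) * b i) - \<rho> *\<^sub>R lmult (st A * A)"
    using arg_cong[OF eq, of lmult] by (simp add: lmult_sum del: lmult_simps(5))
  finally have "pos ((1 / \<rho>) *\<^sub>R ((\<rho> * \<rho> * \<delta>) *\<^sub>R 1 - \<rho> *\<^sub>R lmult (st A * A)))"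
    using rho by (intro pos_scaleR) (simp_all add: algebra_simps)
  then have "pos ((\<rho> * \<delta>) *\<^sub>R 1 - lmult (st A * A))"
    using rho by (simp add: scaleR_diff_right)
  moreover have "pos ((\<rho> * \<delta>) *\<^sub>R 1 + lmult (st A * A))"
    using rho delta by (intro pos_add pos_scaleR pos_one pos_star_mult) simp
  ultimately have le: "norm (lmult (st A * A)) \<le> \<rho> * \<delta>"
    using rho delta by (intro norm_le_of_pos) auto
  define h where "h = st A * A"
  have "norm h * norm h = norm (lmult h \<bullet>\<^sub>e h)"
    using cstar_identity[of h] by (simp add: h_def st_mult st_st power2_eq_square mult.assoc)
  also have "\<dots> \<le> \<rho> * \<delta> * norm h"
    using norm_act_le[of "lmult h" h] le mult_right_mono[of "norm (lmult h)" "\<rho> * \<delta>" "norm h"]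
    unfolding h_def[symmetric] by simp
  finally have "norm h \<le> \<rho> * \<delta>"
    using rho delta by (cases "h = 0") simp_all
  then show ?thesis by (simp add: h_def cstar_identity A_def)
qed

end

section \<open>Bisections of an etale groupoid\<close>

lemma continuous_map_locally:
  assumes "\<And>x. x \<in> topspace X \<Longrightarrow> \<exists>N. openin X N \<and> x \<in> N \<and> continuous_map (subtopology X N) Y f"
  shows "continuous_map X Y f"
  by (rule pasting_lemma[where I = "{N. openin X N \<and> continuous_map (subtopology X N) Y f}"
        and T = "\<lambda>N. N" and f = "\<lambda>_. f"]) (use assms in auto)

lemma continuous_map_euclidean_mult:
  fixes f g :: "'a \<Rightarrow> 'b :: real_normed_algebra"
  assumes "continuous_map X euclidean f" "continuous_map X euclidean g"
  shows "continuous_map X euclidean (\<lambda>x. f x * g x)"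
proof -
  have "continuous_map X euclidean (\<lambda>x. (f x, g x))"
    using continuous_map_pairedI[OF assms] by simp
  moreover have "continuous_map euclidean euclidean (\<lambda>p :: 'b \<times> 'b. fst p * snd p)"
    by (simp add: continuous_on_mult continuous_on_fst continuous_on_snd)
  ultimately have "continuous_map X euclidean ((\<lambda>p :: 'b \<times> 'b. fst p * snd p) \<circ> (\<lambda>x. (f x, g x)))"
    by (rule continuous_map_compose)
  then show ?thesis by (simp add: o_def)
qed

lemma local_homeomorphism_imp_continuous_map:
  assumes "local_homeomorphism S T f" shows "continuous_map S T f"
proof (rule continuous_map_locally)
  fix x assume "x \<in> topspace S"
  then obtain U where "x \<in> U" and U: "homeomorphic_onto_open_on S T U f"
    using assms by (auto simp: local_homeomorphism_def)
  moreover have "continuous_map (subtopology S U) T f"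
    using U homeomorphic_imp_continuous_map continuous_map_into_fulltopology
    unfolding homeomorphic_onto_open_on_def by blast
  ultimately show "\<exists>N. openin S N \<and> x \<in> N \<and> continuous_map (subtopology S N) T f"
    by (auto simp: homeomorphic_onto_open_on_def)
qed

lemma homeomorphic_onto_open_on_subset:
  assumes U: "homeomorphic_onto_open_on S T U f" and W: "openin S W" "W \<subseteq> U"
  shows "homeomorphic_onto_open_on S T W f"
proof -
  have op: "openin S U" "openin T (f ` U)"
    and hom: "homeomorphic_map (subtopology S U) (subtopology T (f ` U)) f"
    using U by (auto simp: homeomorphic_onto_open_on_def)
  have "openin (subtopology S U) W"
    using W by (metis inf.absorb2 openin_subtopology_Int2)
  then have "openin (subtopology T (f ` U)) (f ` W)"
    using homeomorphic_imp_open_map[OF hom] by (simp add: open_map_def)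
  then have "openin T (f ` W)"
    using op(2) by (rule openin_trans_full)
  moreover have "homeomorphic_map (subtopology (subtopology S U) W) (subtopology (subtopology T (f ` U)) (f ` W)) f"
    using W op openin_subset[OF op(1)] openin_subset[OF op(2)]
    by (intro homeomorphic_map_subtopologies[OF hom]) (auto simp: image_iff)
  moreover have "U \<inter> W = W" "f ` U \<inter> f ` W = f ` W"
    using W by auto
  ultimately show ?thesis
    using W by (simp add: homeomorphic_onto_open_on_def subtopology_subtopology)
qed

context topological_groupoid
begin

lemma inv_inv: 
  assumes g: "\<gamma> \<in> arrows G" shows "ginv G (ginv G \<gamma>) = \<gamma>"
proof -
  let ?i = "ginv G \<gamma>"
  have i: "?i \<in> arrows G" by (rule inv_closed[OF g])
  have ii: "ginv G ?i \<in> arrows G" by (rule inv_closed[OF i])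
  have "gmul G (ginv G ?i) (gmul G ?i \<gamma>) = ginv G ?i"
    using mul_dom_self[OF ii] inv_mul[OF g] dom_inv[OF i] ran_inv[OF g] by simp
  moreover have "gmul G (gmul G (ginv G ?i) ?i) \<gamma> = gmul G (ginv G ?i) (gmul G ?i \<gamma>)"
    using dom_inv[OF i] dom_inv[OF g] by (intro mul_assoc ii i g) auto
  moreover have "gmul G (gmul G (ginv G ?i) ?i) \<gamma> = \<gamma>"
    using inv_mul[OF i] dom_inv[OF g] ran_mul_self[OF g] by simp
  ultimately show ?thesis by simp
qed

lemma mul_inv_cancel: 
  assumes "\<gamma> \<in> arrows G" "\<eta> \<in> arrows G" "gran G \<eta> = gran G \<gamma>"
  shows "gmul G \<eta> (gmul G (ginv G \<eta>) \<gamma>) = \<gamma>"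
  using assms by (metis dom_inv inv_closed mul_assoc mul_inv ran_inv ran_mul_self)

lemma inv_image_eq: "U \<subseteq> arrows G \<Longrightarrow> ginv G ` U = {\<gamma> \<in> arrows G. ginv G \<gamma> \<in> U}"
  by (auto simp: inv_closed inv_inv image_iff subset_iff) (metis inv_inv)

lemma homeomorphic_map_inv:
  assumes "U \<subseteq> arrows G"
  shows "homeomorphic_map (subtopology (garr G) (ginv G ` U)) (subtopology (garr G) U) (ginv G)"
proof -
  have "homeomorphic_maps (garr G) (garr G) (ginv G) (ginv G)"
    by (simp add: homeomorphic_maps_def continuous_inv inv_inv)
  then have "homeomorphic_map (garr G) (garr G) (ginv G)"
    by (rule homeomorphic_maps_imp_map)
  then show ?thesis
  proof (rule homeomorphic_map_subtopologies)
    have "ginv G ` U \<subseteq> arrows G" "ginv G ` ginv G ` U = U"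
      using assms inv_closed inv_inv by (force simp: image_image subset_iff)+
    then show "ginv G ` (arrows G \<inter> ginv G ` U) = arrows G \<inter> U"
      using assms by (simp add: Int_absorb1)
  qed
qed

end

context etale_groupoid
begin

text \<open>The range and the domain map play symmetric roles in most of what follows.\<close>

abbreviation legs where
  "legs \<equiv> {gran G, gdom G}"

lemma topspace_unit_space [simp]: "topspace (unit_space G) = gunits G"
  using units_subset by (auto simp: unit_space_def)

lemma leg_unit: "s \<in> legs \<Longrightarrow> x \<in> gunits G \<Longrightarrow> s x = x"
  using ran_unit dom_unit by auto

lemma leg_continuous: "s \<in> legs \<Longrightarrow> continuous_map (garr G) (unit_space G) s"
  using ran_local_homeomorphism dom_local_homeomorphism local_homeomorphism_imp_continuous_map by auto

text \<open>On an open set on which the range map is injective, an arrow whose range lies in the same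
  set must equal its range.\<close>

lemma openin_units: "openin (garr G) (gunits G)"
proof (subst openin_subopen, intro ballI)
  fix x assume x: "x \<in> gunits G"
  then obtain U where "x \<in> U" and U: "homeomorphic_onto_open_on (garr G) (unit_space G) U (gran G)"
    using units_subset ran_local_homeomorphism unfolding local_homeomorphism_def by blast
  then have op: "openin (garr G) U" and inj: "inj_on (gran G) U"
    using openin_subset[of "garr G" U] homeomorphic_imp_injective_map
    by (fastforce simp: homeomorphic_onto_open_on_def Int_absorb1)+
  have "continuous_map (garr G) (garr G) (gran G)"
    using leg_continuous[of "gran G"] continuous_map_into_fulltopology unfolding unit_space_def by auto
  then have "openin (garr G) {\<gamma> \<in> arrows G. gran G \<gamma> \<in> U}"
    using op by (rule openin_continuous_map_preimage)
  then have "openin (garr G) (U \<inter> {\<gamma> \<in> arrows G. gran G \<gamma> \<in> U})"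
    using op by (rule openin_Int[rotated])
  moreover have "U \<inter> {\<gamma> \<in> arrows G. gran G \<gamma> \<in> U} \<subseteq> gunits G"
    using inj by (auto simp: inj_on_def) (metis ran_unit ran_units)
  ultimately show "\<exists>T. openin (garr G) T \<and> x \<in> T \<and> T \<subseteq> gunits G"
    using \<open>x \<in> U\<close> x units_subset ran_unit by (intro exI[of _ "U \<inter> {\<gamma> \<in> arrows G. gran G \<gamma> \<in> U}"]) auto
qed

lemma bisections_iff:
  "U \<in> bisections G \<longleftrightarrow> (\<forall>s\<in>legs. homeomorphic_onto_open_on (garr G) (unit_space G) U s)"
  by (auto simp: bisections_def)

lemma bisection_subset: "U \<in> bisections G \<Longrightarrow> openin (garr G) W \<Longrightarrow> W \<subseteq> U \<Longrightarrow> W \<in> bisections G"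
  unfolding bisections_iff using homeomorphic_onto_open_on_subset by blast

lemma bisection_open: "U \<in> bisections G \<Longrightarrow> openin (garr G) U"
  by (auto simp: bisections_def homeomorphic_onto_open_on_def)

lemma bisection_arrows: "U \<in> bisections G \<Longrightarrow> U \<subseteq> arrows G"
  using bisection_open openin_subset by blast

lemma bisection_leg:
  assumes "U \<in> bisections G" "s \<in> legs"
  shows "inj_on s U" "openin (unit_space G) (s ` U)"
    "continuous_map (subtopology (unit_space G) (s ` U)) (subtopology (garr G) U) (inv_into U s)"
proof -
  have U: "U \<subseteq> arrows G" by (rule bisection_arrows[OF assms(1)])
  then have top: "topspace (subtopology (garr G) U) = U" by auto
  have hom: "homeomorphic_map (subtopology (garr G) U) (subtopology (unit_space G) (s ` U)) s"
    and op: "openin (unit_space G) (s ` U)"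
    using assms by (auto simp: bisections_iff homeomorphic_onto_open_on_def)
  show inj: "inj_on s U"
    using homeomorphic_imp_injective_map[OF hom] unfolding top .
  show "openin (unit_space G) (s ` U)" by (rule op)
  from hom obtain g where g: "homeomorphic_maps (subtopology (garr G) U) (subtopology (unit_space G) (s ` U)) s g"
    using homeomorphic_map_maps by blast
  then have "continuous_map (subtopology (unit_space G) (s ` U)) (subtopology (garr G) U) g"
    by (simp add: homeomorphic_maps_def)
  then show "continuous_map (subtopology (unit_space G) (s ` U)) (subtopology (garr G) U) (inv_into U s)"
  proof (rule continuous_map_eq)
    fix x assume "x \<in> topspace (subtopology (unit_space G) (s ` U))"
    then obtain \<gamma> where "\<gamma> \<in> U" "x = s \<gamma>" by auto
    then show "g x = inv_into U s x"
      using g inj top by (auto simp: homeomorphic_maps_def)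
  qed
qed

lemma units_bisection: "gunits G \<in> bisections G"
proof -
  have "homeomorphic_onto_open_on (garr G) (unit_space G) (gunits G) s" if s: "s \<in> legs" for s
  proof -
    have im: "s ` gunits G = gunits G"
      using leg_unit[OF s] by force
    have "homeomorphic_map (unit_space G) (unit_space G) (\<lambda>x. x)"
      using homeomorphic_map_id[of "unit_space G" "unit_space G"] by (simp add: id_def)
    then have "homeomorphic_map (unit_space G) (unit_space G) s"
      by (rule homeomorphic_map_eq) (simp add: leg_unit[OF s])
    moreover have "openin (unit_space G) (gunits G)"
      using openin_topspace[of "unit_space G"] by (simp only: topspace_unit_space)
    ultimately show ?thesis
      using openin_units by (simp add: homeomorphic_onto_open_on_def im unit_space_def subtopology_subtopology)
  qed
  then show ?thesis unfolding bisections_iff by blast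
qed

lemma bisection_inv:
  assumes U: "U \<in> bisections G" shows "ginv G ` U \<in> bisections G"
proof -
  have sub: "U \<subseteq> arrows G" by (rule bisection_arrows[OF U])
  have op: "openin (garr G) (ginv G ` U)"
    unfolding inv_image_eq[OF sub]
    by (rule openin_continuous_map_preimage[OF continuous_inv bisection_open[OF U]])
  have "homeomorphic_onto_open_on (garr G) (unit_space G) (ginv G ` U) s"
    if st: "s \<in> legs" "t \<in> legs" and eq: "\<And>\<gamma>. \<gamma> \<in> arrows G \<Longrightarrow> t (ginv G \<gamma>) = s \<gamma>" for s t
  proof -
    have "s (ginv G \<gamma>) = t \<gamma>" if "\<gamma> \<in> U" for \<gamma>
      using that sub eq[of "ginv G \<gamma>"] inv_closed inv_inv by (metis subsetD)
    then have im: "s ` ginv G ` U = t ` U"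
      by (simp add: image_image)
    have t: "openin (unit_space G) (t ` U)"
        "homeomorphic_map (subtopology (garr G) U) (subtopology (unit_space G) (t ` U)) t"
      using U st by (auto simp: bisections_iff homeomorphic_onto_open_on_def)
    have "homeomorphic_map (subtopology (garr G) (ginv G ` U)) (subtopology (unit_space G) (t ` U)) (t \<circ> ginv G)"
      by (rule homeomorphic_map_compose[OF homeomorphic_map_inv[OF sub] t(2)])
    then have "homeomorphic_map (subtopology (garr G) (ginv G ` U)) (subtopology (unit_space G) (t ` U)) s"
      by (rule homeomorphic_map_eq) (simp add: eq)
    then show ?thesis
      using op t(1) by (simp add: homeomorphic_onto_open_on_def im)
  qed
  from this[of "gran G" "gdom G"] this[of "gdom G" "gran G"] show ?thesis
    unfolding bisections_iff using dom_inv ran_inv by auto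
qed

lemma bisection_Hausdorff:
  assumes "U \<in> bisections G" shows "Hausdorff_space (subtopology (garr G) U)"
proof (rule Hausdorff_space_injective_preimage[OF Hausdorff_units])
  show "continuous_map (subtopology (garr G) U) (unit_space G) (gran G)"
    by (rule continuous_map_from_subtopology[OF leg_continuous]) simp
  show "inj_on (gran G) (topspace (subtopology (garr G) U))"
    using bisection_leg(1)[OF assms, of "gran G"] by (auto intro: inj_on_subset)
qed

end

section \<open>Sections of the line bundle\<close>

context twisted_etale_groupoid
begin

lemma scalars_in_F: "complex_of_real t \<in> F" "0 \<in> F" "1 \<in> F"
    "c \<in> F \<Longrightarrow> d \<in> F \<Longrightarrow> c * d \<in> F"
  using scalars by auto

lemma fibre_abelian_group: "\<gamma> \<in> arrows G \<Longrightarrow> abelian_group (lfib L \<gamma>)"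
  by (rule module.axioms(2)[OF fibre_vector_space])

lemma fibre_add: "\<gamma> \<in> arrows G \<Longrightarrow> z \<in> fibre L \<gamma> \<Longrightarrow> w \<in> fibre L \<gamma> \<Longrightarrow> z \<oplus>\<^bsub>lfib L \<gamma>\<^esub> w \<in> fibre L \<gamma>"
  by (rule abelian_monoid.a_closed[OF abelian_group.axioms(1)[OF fibre_abelian_group]])

lemma fibre_zero: "\<gamma> \<in> arrows G \<Longrightarrow> \<zero>\<^bsub>lfib L \<gamma>\<^esub> \<in> fibre L \<gamma>"
  by (rule abelian_monoid.zero_closed[OF abelian_group.axioms(1)[OF fibre_abelian_group]])

lemma fibre_scale: "\<gamma> \<in> arrows G \<Longrightarrow> c \<in> F \<Longrightarrow> z \<in> fibre L \<gamma> \<Longrightarrow> c \<odot>\<^bsub>lfib L \<gamma>\<^esub> z \<in> fibre L \<gamma>"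
  using module.smult_closed[OF fibre_vector_space, of \<gamma> c z] by (simp add: scalar_ring_def)

lemma lproj_fibre: "\<gamma> \<in> arrows G \<Longrightarrow> z \<in> fibre L \<gamma> \<Longrightarrow> lproj L z = \<gamma> \<and> z \<in> topspace (ltop L)"
  using fibre_carrier by auto

lemma trivialization_bij:
  assumes U: "openin (garr G) U" and triv: "local_trivialization F G L U \<phi>" and g: "\<gamma> \<in> U"
  shows "bij_betw (\<lambda>z. snd (\<phi> z)) (fibre L \<gamma>) F"
proof -
  have arr: "\<gamma> \<in> arrows G" and sub: "U \<subseteq> arrows G"
    using U g openin_subset by auto
  have hom: "homeomorphic_map (subtopology (ltop L) {z. lproj L z \<in> U})
      (prod_topology (subtopology (garr G) U) (top_of_set F)) \<phi>"
    and fst: "\<And>\<gamma> z. \<gamma> \<in> U \<Longrightarrow> z \<in> fibre L \<gamma> \<Longrightarrow> fst (\<phi> z) = \<gamma>"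
    using triv by (auto simp: local_trivialization_def)
  have inj: "inj_on \<phi> (topspace (ltop L) \<inter> {z. lproj L z \<in> U})"
    using homeomorphic_imp_injective_map[OF hom] by simp
  have im: "\<phi> ` (topspace (ltop L) \<inter> {z. lproj L z \<in> U}) = U \<times> F"
    using homeomorphic_imp_surjective_map[OF hom] sub by (simp add: Int_absorb1)
  have fib: "fibre L \<gamma> \<subseteq> topspace (ltop L) \<inter> {z. lproj L z \<in> U}"
    using fibre_carrier[OF arr] g by auto
  show ?thesis
    unfolding bij_betw_def
  proof
    show "inj_on (\<lambda>z. snd (\<phi> z)) (fibre L \<gamma>)"
    proof (rule inj_onI)
      fix z w assume zw: "z \<in> fibre L \<gamma>" "w \<in> fibre L \<gamma>" "snd (\<phi> z) = snd (\<phi> w)"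
      then have "\<phi> z = \<phi> w"
        using fst[OF g] by (simp add: prod_eq_iff)
      then show "z = w" using inj fib zw by (auto simp: inj_on_def)
    qed
    show "(\<lambda>z. snd (\<phi> z)) ` fibre L \<gamma> = F"
    proof (intro equalityI subsetI)
      fix c assume "c \<in> (\<lambda>z. snd (\<phi> z)) ` fibre L \<gamma>"
      then obtain z where "z \<in> fibre L \<gamma>" "c = snd (\<phi> z)" by auto
      then have "\<phi> z \<in> U \<times> F" using im fib by blast
      then show "c \<in> F" using \<open>c = snd (\<phi> z)\<close> by auto
    next
      fix c assume "c \<in> F"
      then have "(\<gamma>, c) \<in> \<phi> ` (topspace (ltop L) \<inter> {z. lproj L z \<in> U})"
        unfolding im using g by simp
      then obtain z where z: "z \<in> topspace (ltop L)" "lproj L z \<in> U" "\<phi> z = (\<gamma>, c)"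
        by auto
      then have "z \<in> fibre L (lproj L z)"
        using fibre_carrier sub by auto
      then have "fst (\<phi> z) = lproj L z" using fst z(2) by blast
      then have "lproj L z = \<gamma>" using z(3) by simp
      then show "c \<in> (\<lambda>z. snd (\<phi> z)) ` fibre L \<gamma>"
        using z \<open>z \<in> fibre L (lproj L z)\<close> by force
    qed
  qed
qed

text \<open>An isometric linear identification of each fibre with the scalars, chosen without any
  continuity. It turns identities and estimates in the fibres into ones between numbers.\<close>

definition is_coord :: "'g \<Rightarrow> ('l \<Rightarrow> complex) \<Rightarrow> bool" where
  "is_coord \<gamma> t \<longleftrightarrow> inj_on t (fibre L \<gamma>) \<and> t ` fibre L \<gamma> = F \<and>
     (\<forall>z\<in>fibre L \<gamma>. cmod (t z) = lmod L z \<and>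
        (\<forall>w\<in>fibre L \<gamma>. t (z \<oplus>\<^bsub>lfib L \<gamma>\<^esub> w) = t z + t w) \<and>
        (\<forall>c\<in>F. t (c \<odot>\<^bsub>lfib L \<gamma>\<^esub> z) = c * t z))"

definition coord :: "'g \<Rightarrow> 'l \<Rightarrow> complex" where
  "coord \<gamma> = (SOME t. is_coord \<gamma> t)"

text \<open>The coordinate of a local trivialization is linear on each fibre. As the fibre is spanned by one
  vector, a positive factor makes the coordinate isometric.\<close>

lemma is_coord_coord:
  assumes g: "\<gamma> \<in> arrows G" shows "is_coord \<gamma> (coord \<gamma>)"
proof -
  obtain U \<phi> where U: "openin (garr G) U" "\<gamma> \<in> U" and triv: "local_trivialization F G L U \<phi>"
    using locally_trivial[OF g] by blast
  define u where "u = (\<lambda>z. snd (\<phi> z))"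
  have bij: "bij_betw u (fibre L \<gamma>) F"
    using trivialization_bij[OF U(1) triv U(2)] by (simp add: u_def)
  have add: "u (z \<oplus>\<^bsub>lfib L \<gamma>\<^esub> w) = u z + u w" if "z \<in> fibre L \<gamma>" "w \<in> fibre L \<gamma>" for z w
    using that U triv by (auto simp: local_trivialization_def u_def)
  have scale: "u (c \<odot>\<^bsub>lfib L \<gamma>\<^esub> z) = c * u z" if "z \<in> fibre L \<gamma>" "c \<in> F" for z c
    using that U triv by (auto simp: local_trivialization_def u_def)
  obtain e where e: "e \<in> fibre L \<gamma>" "e \<noteq> \<zero>\<^bsub>lfib L \<gamma>\<^esub>"
    and span: "fibre L \<gamma> = {c \<odot>\<^bsub>lfib L \<gamma>\<^esub> e |c. c \<in> F}"
    using fibre_one_dimensional[OF g] by blast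
  have zero: "u \<zero>\<^bsub>lfib L \<gamma>\<^esub> = 0"
  proof -
    have "\<zero>\<^bsub>lfib L \<gamma>\<^esub> \<oplus>\<^bsub>lfib L \<gamma>\<^esub> \<zero>\<^bsub>lfib L \<gamma>\<^esub> = \<zero>\<^bsub>lfib L \<gamma>\<^esub>"
      by (rule abelian_monoid.l_zero[OF abelian_group.axioms(1)[OF fibre_abelian_group[OF g]] fibre_zero[OF g]])
    then show ?thesis using add[OF fibre_zero[OF g] fibre_zero[OF g]] by simp
  qed
  have ue: "u e \<noteq> 0"
    using inj_on_eq_iff[OF bij_betw_imp_inj_on[OF bij] e(1) fibre_zero[OF g]] e(2) zero by simp
  have le: "lmod L e \<noteq> 0" "0 \<le> lmod L e"
    using e mod_eq_0[OF g e(1)] mod_nonneg lproj_fibre[OF g e(1)] by auto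
  define k where "k = complex_of_real (lmod L e / cmod (u e))"
  have "inverse k = complex_of_real (inverse (lmod L e / cmod (u e)))"
    by (simp add: k_def)
  then have k: "k \<in> F" "k \<noteq> 0" "inverse k \<in> F"
    using ue le unfolding k_def by (simp_all only: scalars_in_F of_real_eq_0_iff divide_eq_0_iff norm_eq_zero) simp
  define t where "t z = k * u z" for z
  have "is_coord \<gamma> t"
    unfolding is_coord_def
  proof (intro conjI ballI)
    show "inj_on t (fibre L \<gamma>)"
      using bij k by (auto simp: inj_on_def t_def bij_betw_def)
    have "(\<lambda>c. k * c) ` F = F"
    proof (intro equalityI subsetI)
      fix c assume "c \<in> F"
      then have "inverse k * c \<in> F" "c = k * (inverse k * c)"
        using k by (auto simp: scalars_in_F)
      then show "c \<in> (\<lambda>c. k * c) ` F" by blast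
    qed (use k scalars_in_F in auto)
    then show "t ` fibre L \<gamma> = F"
      using bij by (simp add: t_def bij_betw_def flip: image_image[of "\<lambda>c. k * c" u])
    fix z assume z: "z \<in> fibre L \<gamma>"
    then obtain c where c: "c \<in> F" "z = c \<odot>\<^bsub>lfib L \<gamma>\<^esub> e" using span by auto
    then show "cmod (t z) = lmod L z"
      using ue le by (simp add: t_def scale[OF e(1)] mod_scale[OF g e(1)] k_def norm_mult norm_divide)
    show "t (z \<oplus>\<^bsub>lfib L \<gamma>\<^esub> w) = t z + t w" if "w \<in> fibre L \<gamma>" for w
      using z that by (simp add: t_def add algebra_simps)
    show "t (c \<odot>\<^bsub>lfib L \<gamma>\<^esub> z) = c * t z" if "c \<in> F" for c
      using z that by (simp add: t_def scale algebra_simps)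
  qed
  then show ?thesis
    using someI[of "is_coord \<gamma>" t] by (simp add: coord_def)
qed

lemma coord_simps:
  assumes "\<gamma> \<in> arrows G" "z \<in> fibre L \<gamma>"
  shows coord_norm: "cmod (coord \<gamma> z) = lmod L z"
    and coord_add: "w \<in> fibre L \<gamma> \<Longrightarrow> coord \<gamma> (z \<oplus>\<^bsub>lfib L \<gamma>\<^esub> w) = coord \<gamma> z + coord \<gamma> w"
    and coord_scale: "c \<in> F \<Longrightarrow> coord \<gamma> (c \<odot>\<^bsub>lfib L \<gamma>\<^esub> z) = c * coord \<gamma> z"
    and coord_inj: "w \<in> fibre L \<gamma> \<Longrightarrow> coord \<gamma> z = coord \<gamma> w \<longleftrightarrow> z = w"
proof -
  note * = is_coord_coord[OF assms(1), unfolded is_coord_def]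
  show "cmod (coord \<gamma> z) = lmod L z"
    and "w \<in> fibre L \<gamma> \<Longrightarrow> coord \<gamma> (z \<oplus>\<^bsub>lfib L \<gamma>\<^esub> w) = coord \<gamma> z + coord \<gamma> w"
    and "c \<in> F \<Longrightarrow> coord \<gamma> (c \<odot>\<^bsub>lfib L \<gamma>\<^esub> z) = c * coord \<gamma> z"
    using * assms(2) by simp_all
  show "w \<in> fibre L \<gamma> \<Longrightarrow> coord \<gamma> z = coord \<gamma> w \<longleftrightarrow> z = w"
    using * assms(2) inj_on_eq_iff[of "coord \<gamma>" "fibre L \<gamma>" z w] by blast
qed

lemma lmod_zero: "\<gamma> \<in> arrows G \<Longrightarrow> lmod L \<zero>\<^bsub>lfib L \<gamma>\<^esub> = 0"
  using mod_eq_0[of \<gamma> "\<zero>\<^bsub>lfib L \<gamma>\<^esub>"] fibre_zero[of \<gamma>] by simp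

lemma coord_zero: "\<gamma> \<in> arrows G \<Longrightarrow> coord \<gamma> \<zero>\<^bsub>lfib L \<gamma>\<^esub> = 0"
  using coord_norm[of \<gamma> "\<zero>\<^bsub>lfib L \<gamma>\<^esub>"] by (simp add: lmod_zero fibre_zero)

lemma coord_eq_0_iff: "\<gamma> \<in> arrows G \<Longrightarrow> z \<in> fibre L \<gamma> \<Longrightarrow> coord \<gamma> z = 0 \<longleftrightarrow> z = \<zero>\<^bsub>lfib L \<gamma>\<^esub>"
  using coord_inj[of \<gamma> z "\<zero>\<^bsub>lfib L \<gamma>\<^esub>"] by (simp add: coord_zero fibre_zero)

lemma scale_zero_left: "\<gamma> \<in> arrows G \<Longrightarrow> z \<in> fibre L \<gamma> \<Longrightarrow> 0 \<odot>\<^bsub>lfib L \<gamma>\<^esub> z = \<zero>\<^bsub>lfib L \<gamma>\<^esub>"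
  by (rule coord_eq_0_iff[THEN iffD1]) (simp_all add: fibre_scale scalars_in_F coord_scale)

lemma scale_zero_right: "\<gamma> \<in> arrows G \<Longrightarrow> c \<in> F \<Longrightarrow> c \<odot>\<^bsub>lfib L \<gamma>\<^esub> \<zero>\<^bsub>lfib L \<gamma>\<^esub> = \<zero>\<^bsub>lfib L \<gamma>\<^esub>"
  by (rule coord_eq_0_iff[THEN iffD1]) (simp_all add: fibre_scale fibre_zero coord_scale coord_zero)

lemma add_zero_zero: "\<gamma> \<in> arrows G \<Longrightarrow> \<zero>\<^bsub>lfib L \<gamma>\<^esub> \<oplus>\<^bsub>lfib L \<gamma>\<^esub> \<zero>\<^bsub>lfib L \<gamma>\<^esub> = \<zero>\<^bsub>lfib L \<gamma>\<^esub>"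
  by (rule coord_eq_0_iff[THEN iffD1]) (simp_all add: fibre_add fibre_zero coord_add coord_zero)

text \<open>Over a trivializing set, a section is continuous if and only if its scalar coordinate is.\<close>

lemma continuous_trivialized:
  assumes U: "openin (garr G) U" and triv: "local_trivialization F G L U \<phi>"
    and N: "N \<subseteq> U" and s: "\<And>\<gamma>. \<gamma> \<in> N \<Longrightarrow> s \<gamma> \<in> fibre L \<gamma>"
  shows "continuous_map (subtopology (garr G) N) (ltop L) s \<longleftrightarrow>
    continuous_map (subtopology (garr G) N) euclidean (\<lambda>\<gamma>. snd (\<phi> (s \<gamma>)))"
proof -
  let ?N = "subtopology (garr G) N"
  let ?L = "subtopology (ltop L) {z. lproj L z \<in> U}"
  let ?P = "prod_topology (subtopology (garr G) U) (top_of_set F)"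
  have sub: "U \<subseteq> arrows G" using U openin_subset by auto
  have hom: "homeomorphic_map ?L ?P \<phi>"
    and fst: "\<And>\<gamma> z. \<gamma> \<in> U \<Longrightarrow> z \<in> fibre L \<gamma> \<Longrightarrow> fst (\<phi> z) = \<gamma>"
    using triv by (auto simp: local_trivialization_def)
  then obtain \<kappa> where \<kappa>: "homeomorphic_maps ?L ?P \<phi> \<kappa>"
    using homeomorphic_map_maps by blast
  have sL: "s \<gamma> \<in> topspace ?L" if "\<gamma> \<in> N" for \<gamma>
  proof -
    have "\<gamma> \<in> U" "\<gamma> \<in> arrows G" using that N sub by auto
    then show ?thesis using lproj_fibre[OF _ s[OF that]] by simp
  qed
  show ?thesis
  proof
    assume c: "continuous_map ?N (ltop L) s"
    then have "continuous_map ?N ?L s"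
      using sL by (auto simp: continuous_map_in_subtopology)
    then have "continuous_map ?N (top_of_set F) (snd \<circ> (\<phi> \<circ> s))"
      by (rule continuous_map_compose[OF continuous_map_compose continuous_map_snd])
        (rule homeomorphic_imp_continuous_map[OF hom])
    then show "continuous_map ?N euclidean (\<lambda>\<gamma>. snd (\<phi> (s \<gamma>)))"
      using continuous_map_into_fulltopology by (auto simp: o_def)
  next
    assume c: "continuous_map ?N euclidean (\<lambda>\<gamma>. snd (\<phi> (s \<gamma>)))"
    have "snd (\<phi> (s \<gamma>)) \<in> F" if "\<gamma> \<in> N" for \<gamma>
      using trivialization_bij[OF U triv] that N s[OF that] by (auto simp: bij_betw_def)
    then have "continuous_map ?N ?P (\<lambda>\<gamma>. (\<gamma>, snd (\<phi> (s \<gamma>))))"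
      using c N continuous_map_from_subtopology[OF continuous_map_id[of "garr G"], of N]
      by (intro continuous_map_pairedI) (auto simp: continuous_map_in_subtopology id_def)
    moreover have "continuous_map ?P (ltop L) \<kappa>"
      using \<kappa> continuous_map_into_fulltopology by (auto simp: homeomorphic_maps_def)
    ultimately have "continuous_map ?N (ltop L) (\<kappa> \<circ> (\<lambda>\<gamma>. (\<gamma>, snd (\<phi> (s \<gamma>)))))"
      by (rule continuous_map_compose)
    then show "continuous_map ?N (ltop L) s"
    proof (rule continuous_map_eq)
      fix \<gamma> assume "\<gamma> \<in> topspace ?N"
      then have g: "\<gamma> \<in> N" by auto
      then have "(\<gamma>, snd (\<phi> (s \<gamma>))) = \<phi> (s \<gamma>)"
        using fst[of \<gamma>] s N by (auto simp: prod_eq_iff)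
      then show "(\<kappa> \<circ> (\<lambda>\<gamma>. (\<gamma>, snd (\<phi> (s \<gamma>))))) \<gamma> = s \<gamma>"
        using \<kappa> sL[OF g] by (simp add: homeomorphic_maps_def)
    qed
  qed
qed

lemma continuous_section_combination:
  assumes W: "openin (garr G) W"
    and s: "continuous_map (subtopology (garr G) W) (ltop L) s" "\<And>\<gamma>. \<gamma> \<in> W \<Longrightarrow> s \<gamma> \<in> fibre L \<gamma>"
    and s': "continuous_map (subtopology (garr G) W) (ltop L) s'" "\<And>\<gamma>. \<gamma> \<in> W \<Longrightarrow> s' \<gamma> \<in> fibre L \<gamma>"
    and c: "continuous_map (subtopology (garr G) W) euclidean c" "\<And>\<gamma>. \<gamma> \<in> W \<Longrightarrow> c \<gamma> \<in> F"
  shows "continuous_map (subtopology (garr G) W) (ltop L)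
           (\<lambda>\<gamma>. c \<gamma> \<odot>\<^bsub>lfib L \<gamma>\<^esub> s \<gamma>)" (is ?scale)
    and "continuous_map (subtopology (garr G) W) (ltop L)
           (\<lambda>\<gamma>. s \<gamma> \<oplus>\<^bsub>lfib L \<gamma>\<^esub> s' \<gamma>)" (is ?add)
proof -
  have sub: "W \<subseteq> arrows G" using W openin_subset by auto
  have *: "\<exists>N. openin (subtopology (garr G) W) N \<and> \<gamma> \<in> N \<and>
      continuous_map (subtopology (subtopology (garr G) W) N) (ltop L) (\<lambda>\<gamma>. c \<gamma> \<odot>\<^bsub>lfib L \<gamma>\<^esub> s \<gamma>) \<and>
      continuous_map (subtopology (subtopology (garr G) W) N) (ltop L) (\<lambda>\<gamma>. s \<gamma> \<oplus>\<^bsub>lfib L \<gamma>\<^esub> s' \<gamma>)"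
    if "\<gamma> \<in> topspace (subtopology (garr G) W)" for \<gamma>
  proof -
    from that have "\<gamma> \<in> arrows G" by simp
    then obtain U \<phi> where U: "openin (garr G) U" "\<gamma> \<in> U" and triv: "local_trivialization F G L U \<phi>"
      using locally_trivial[of \<gamma>] by blast
    let ?N = "subtopology (garr G) (W \<inter> U)"
    have cont: "continuous_map ?N (ltop L) s" "continuous_map ?N (ltop L) s'" "continuous_map ?N euclidean c"
      using s(1) s'(1) c(1) continuous_map_from_subtopology_mono by blast+
    note triv_iff = continuous_trivialized[OF U(1) triv, of "W \<inter> U"]
    have coords: "continuous_map ?N euclidean (\<lambda>\<gamma>. snd (\<phi> (s \<gamma>)))"
      "continuous_map ?N euclidean (\<lambda>\<gamma>. snd (\<phi> (s' \<gamma>)))"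
      using cont s s' by (subst triv_iff[symmetric]; auto)+
    have lin: "snd (\<phi> (c \<gamma> \<odot>\<^bsub>lfib L \<gamma>\<^esub> s \<gamma>)) = c \<gamma> * snd (\<phi> (s \<gamma>))"
      "snd (\<phi> (s \<gamma> \<oplus>\<^bsub>lfib L \<gamma>\<^esub> s' \<gamma>)) = snd (\<phi> (s \<gamma>)) + snd (\<phi> (s' \<gamma>))" if "\<gamma> \<in> W \<inter> U" for \<gamma>
      using that triv s s' c by (auto simp: local_trivialization_def)
    have "continuous_map ?N euclidean (\<lambda>\<gamma>. c \<gamma> * snd (\<phi> (s \<gamma>)))"
      by (intro continuous_map_euclidean_mult coords cont)
    then have "continuous_map ?N euclidean (\<lambda>\<gamma>. snd (\<phi> (c \<gamma> \<odot>\<^bsub>lfib L \<gamma>\<^esub> s \<gamma>)))"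
      by (rule continuous_map_eq) (use lin in auto)
    then have 1: "continuous_map ?N (ltop L) (\<lambda>\<gamma>. c \<gamma> \<odot>\<^bsub>lfib L \<gamma>\<^esub> s \<gamma>)"
      using s c sub by (subst triv_iff) (auto intro: fibre_scale)
    have "continuous_map ?N euclidean (\<lambda>\<gamma>. snd (\<phi> (s \<gamma>)) + snd (\<phi> (s' \<gamma>)))"
      by (intro continuous_map_add coords)
    then have "continuous_map ?N euclidean (\<lambda>\<gamma>. snd (\<phi> (s \<gamma> \<oplus>\<^bsub>lfib L \<gamma>\<^esub> s' \<gamma>)))"
      by (rule continuous_map_eq) (use lin in auto)
    then have 2: "continuous_map ?N (ltop L) (\<lambda>\<gamma>. s \<gamma> \<oplus>\<^bsub>lfib L \<gamma>\<^esub> s' \<gamma>)"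
      using s s' sub by (subst triv_iff) (auto intro: fibre_add)
    have "openin (subtopology (garr G) W) (W \<inter> U)"
      using U(1) by (simp add: openin_subtopology_Int2)
    moreover have "subtopology (subtopology (garr G) W) (W \<inter> U) = ?N"
      by (simp add: subtopology_subtopology)
    moreover have "\<gamma> \<in> W \<inter> U"
      using U(2) that by simp
    ultimately show ?thesis
      using 1 2 by (intro exI[of _ "W \<inter> U"] conjI) (simp_all only:)
  qed
  show ?scale
    by (rule continuous_map_locally) (use * in blast)
  show ?add
    by (rule continuous_map_locally) (use * in blast)
qed


lemma section_fibre: "f \<in> sections G L \<Longrightarrow> \<gamma> \<in> arrows G \<Longrightarrow> f \<gamma> \<in> fibre L \<gamma>"
  by (auto simp: sections_def)

lemma section_eqI:
  assumes f: "f \<in> sections G L" and g: "g \<in> sections G L"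
    and eq: "\<And>\<gamma>. \<gamma> \<in> arrows G \<Longrightarrow> coord \<gamma> (f \<gamma>) = coord \<gamma> (g \<gamma>)"
  shows "f = g"
proof (rule PiE_ext)
  show "f \<in> (\<Pi>\<^sub>E \<gamma>\<in>arrows G. fibre L \<gamma>)" "g \<in> (\<Pi>\<^sub>E \<gamma>\<in>arrows G. fibre L \<gamma>)"
    using f g by (auto simp: sections_def)
  fix \<gamma> assume \<gamma>: "\<gamma> \<in> arrows G"
  show "f \<gamma> = g \<gamma>"
    using eq[OF \<gamma>] coord_inj[OF \<gamma> section_fibre[OF f \<gamma>] section_fibre[OF g \<gamma>]] by simp
qed

lemma sections_closed:
  "sec_zero G L \<in> sections G L"
  "f \<in> sections G L \<Longrightarrow> g \<in> sections G L \<Longrightarrow> sec_add G L f g \<in> sections G L"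
  "c \<in> F \<Longrightarrow> f \<in> sections G L \<Longrightarrow> sec_scale G L c f \<in> sections G L"
proof -
  show "sec_zero G L \<in> sections G L"
    by (auto simp: sections_def sec_zero_def fibre_zero)
  show "sec_add G L f g \<in> sections G L" if "f \<in> sections G L" "g \<in> sections G L"
    using section_fibre[OF that(1)] section_fibre[OF that(2)]
    by (auto simp: sections_def sec_add_def intro!: fibre_add)
  show "sec_scale G L c f \<in> sections G L" if "c \<in> F" "f \<in> sections G L"
    using section_fibre[OF that(2)] that(1)
    by (auto simp: sections_def sec_scale_def intro!: fibre_scale)
qed

text \<open>Although the arrow space need not be Hausdorff, each bisection is, so that its compact subsets
  are relatively closed.\<close>

lemma Cc_iff:
  assumes U: "U \<in> bisections G"
  shows "f \<in> Cc G L U \<longleftrightarrow> f \<in> sections G L \<and> continuous_map (subtopology (garr G) U) (ltop L) f \<and>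
    (\<exists>K. compactin (garr G) K \<and> K \<subseteq> U \<and> (\<forall>\<gamma>\<in>arrows G - K. f \<gamma> = \<zero>\<^bsub>lfib L \<gamma>\<^esub>))"
    (is "_ \<longleftrightarrow> ?R")
proof
  let ?S = "{\<gamma> \<in> U. f \<gamma> \<noteq> \<zero>\<^bsub>lfib L \<gamma>\<^esub>}" and ?U = "subtopology (garr G) U"
  have top: "topspace ?U = U" using bisection_arrows[OF U] by auto
  {
    assume f: "f \<in> Cc G L U"
    define K where "K = ?U closure_of ?S"
    have "compactin (garr G) K" "K \<subseteq> U"
      using f by (simp_all add: Cc_def compactin_subtopology K_def)
    moreover have "?S \<subseteq> K"
      unfolding K_def by (rule closure_of_subset) (unfold top, blast)
    ultimately show ?R
      using f by (intro conjI exI[of _ K]) (auto simp: Cc_def)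
  }
  {
    assume ?R
    then obtain K where f: "f \<in> sections G L" "continuous_map ?U (ltop L) f"
      and K: "compactin (garr G) K" "K \<subseteq> U" and zero: "\<forall>\<gamma>\<in>arrows G - K. f \<gamma> = \<zero>\<^bsub>lfib L \<gamma>\<^esub>"
      by blast
    have cK: "compactin ?U K" using K by (simp add: compactin_subtopology)
    have clK: "closedin ?U K"
      by (rule compactin_imp_closedin[OF bisection_Hausdorff[OF U] cK])
    have "?S \<subseteq> K" using zero bisection_arrows[OF U] by auto
    then have "?U closure_of ?S \<subseteq> K" by (rule closure_of_minimal[OF _ clK])
    then have "compactin ?U (?U closure_of ?S)"
      by (rule closed_compactin[OF cK _ closedin_closure_of])
    moreover have "\<forall>\<gamma>\<in>arrows G - U. f \<gamma> = \<zero>\<^bsub>lfib L \<gamma>\<^esub>"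
      using zero K by auto
    ultimately show "f \<in> Cc G L U"
      using f by (simp add: Cc_def)
  }
qed

lemma CcE:
  assumes "U \<in> bisections G" "f \<in> Cc G L U"
  obtains K where "compactin (garr G) K" "K \<subseteq> U" "\<And>\<gamma>. \<gamma> \<in> arrows G \<Longrightarrow> \<gamma> \<notin> K \<Longrightarrow> f \<gamma> = \<zero>\<^bsub>lfib L \<gamma>\<^esub>"
  using assms Cc_iff by auto

lemma Cc_section: "f \<in> Cc G L U \<Longrightarrow> f \<in> sections G L"
  by (simp add: Cc_def)

lemma Cc_zero_off: "f \<in> Cc G L U \<Longrightarrow> \<gamma> \<in> arrows G \<Longrightarrow> \<gamma> \<notin> U \<Longrightarrow> f \<gamma> = \<zero>\<^bsub>lfib L \<gamma>\<^esub>"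
  by (simp add: Cc_def)

lemma Cc_continuous: "f \<in> Cc G L U \<Longrightarrow> continuous_map (subtopology (garr G) U) (ltop L) f"
  by (simp add: Cc_def)

lemma Cc_lmod_continuous: "f \<in> Cc G L U \<Longrightarrow> continuous_map (subtopology (garr G) U) euclideanreal (\<lambda>\<gamma>. lmod L (f \<gamma>))"
  using continuous_map_compose[OF Cc_continuous mod_continuous] by (simp add: o_def)

text \<open>All sections constructed from a given one arise in this way: multiplication by a continuous scalar
  function and restriction to a smaller bisection that still contains the support.\<close>

lemma Cc_rescale:
  assumes U: "U \<in> bisections G" and f: "f \<in> Cc G L U" and W: "openin (garr G) W" "W \<subseteq> U"
    and w: "continuous_map (subtopology (garr G) W) euclidean w" "\<And>\<gamma>. \<gamma> \<in> W \<Longrightarrow> w \<gamma> \<in> F"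
    and g: "g \<in> sections G L" "\<And>\<gamma>. \<gamma> \<in> W \<Longrightarrow> g \<gamma> = w \<gamma> \<odot>\<^bsub>lfib L \<gamma>\<^esub> f \<gamma>"
    and K: "compactin (garr G) K" "K \<subseteq> W" "\<And>\<gamma>. \<gamma> \<in> arrows G \<Longrightarrow> \<gamma> \<notin> K \<Longrightarrow> g \<gamma> = \<zero>\<^bsub>lfib L \<gamma>\<^esub>"
  shows "g \<in> Cc G L W"
proof -
  have Wb: "W \<in> bisections G" by (rule bisection_subset[OF U W])
  have cont: "continuous_map (subtopology (garr G) W) (ltop L) f"
    by (rule continuous_map_from_subtopology_mono[OF Cc_continuous[OF f] W(2)])
  have fib: "\<gamma> \<in> W \<Longrightarrow> f \<gamma> \<in> fibre L \<gamma>" for \<gamma>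
    using section_fibre[OF Cc_section[OF f]] openin_subset[OF W(1)] by blast
  have "continuous_map (subtopology (garr G) W) (ltop L) (\<lambda>\<gamma>. w \<gamma> \<odot>\<^bsub>lfib L \<gamma>\<^esub> f \<gamma>)"
    by (rule continuous_section_combination(1)[OF W(1) cont fib cont fib w])
  then have "continuous_map (subtopology (garr G) W) (ltop L) g"
    by (rule continuous_map_eq) (simp add: g)
  then show ?thesis
    unfolding Cc_iff[OF Wb] using g(1) K by (intro conjI exI[of _ K]) auto
qed

lemma Cc_add:
  assumes W: "W \<in> bisections G" and f: "f \<in> Cc G L W" and g: "g \<in> Cc G L W"
  shows "sec_add G L f g \<in> Cc G L W"
proof -
  obtain K K' where K: "compactin (garr G) K" "K \<subseteq> W" "\<And>\<gamma>. \<gamma> \<in> arrows G \<Longrightarrow> \<gamma> \<notin> K \<Longrightarrow> f \<gamma> = \<zero>\<^bsub>lfib L \<gamma>\<^esub>"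
    and K': "compactin (garr G) K'" "K' \<subseteq> W" "\<And>\<gamma>. \<gamma> \<in> arrows G \<Longrightarrow> \<gamma> \<notin> K' \<Longrightarrow> g \<gamma> = \<zero>\<^bsub>lfib L \<gamma>\<^esub>"
    using CcE[OF W f] CcE[OF W g] by metis
  have fib: "\<gamma> \<in> W \<Longrightarrow> f \<gamma> \<in> fibre L \<gamma>" "\<gamma> \<in> W \<Longrightarrow> g \<gamma> \<in> fibre L \<gamma>" for \<gamma>
    using section_fibre[OF Cc_section[OF f]] section_fibre[OF Cc_section[OF g]] bisection_arrows[OF W] by blast+
  have "continuous_map (subtopology (garr G) W) (ltop L) (\<lambda>\<gamma>. f \<gamma> \<oplus>\<^bsub>lfib L \<gamma>\<^esub> g \<gamma>)"
    by (rule continuous_section_combination(2)[OF bisection_open[OF W] Cc_continuous[OF f] fib(1) Cc_continuous[OF g] fib(2),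
        where c = "\<lambda>_. 0"]) (simp_all add: scalars_in_F)
  then have "continuous_map (subtopology (garr G) W) (ltop L) (sec_add G L f g)"
    by (rule continuous_map_eq) (simp add: sec_add_def)
  moreover have "sec_add G L f g \<gamma> = \<zero>\<^bsub>lfib L \<gamma>\<^esub>" if "\<gamma> \<in> arrows G - (K \<union> K')" for \<gamma>
    using that K(3) K'(3) add_zero_zero by (simp add: sec_add_def)
  ultimately show ?thesis
    unfolding Cc_iff[OF W]
    using sections_closed(2)[OF Cc_section[OF f] Cc_section[OF g]] compactin_Un[OF K(1) K'(1)] K(2) K'(2)
    by (intro conjI exI[of _ "K \<union> K'"]) auto
qed

lemma Cc_zero:
  assumes W: "W \<in> bisections G" shows "sec_zero G L \<in> Cc G L W"
proof -
  have sub: "W \<subseteq> arrows G" by (rule bisection_arrows[OF W])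
  have "continuous_map (subtopology (garr G) W) (ltop L) (sec_zero G L)"
  proof (rule continuous_map_locally)
    fix \<gamma> assume "\<gamma> \<in> topspace (subtopology (garr G) W)"
    then have \<gamma>: "\<gamma> \<in> arrows G" "\<gamma> \<in> W" by auto
    obtain U \<phi> where U: "openin (garr G) U" "\<gamma> \<in> U" and triv: "local_trivialization F G L U \<phi>"
      using locally_trivial[OF \<gamma>(1)] by blast
    have zero: "snd (\<phi> (sec_zero G L \<eta>)) = 0" if "\<eta> \<in> W \<inter> U" for \<eta>
    proof -
      have \<eta>: "\<eta> \<in> arrows G" "\<eta> \<in> U" using that sub by auto
      have "snd (\<phi> (\<zero>\<^bsub>lfib L \<eta>\<^esub> \<oplus>\<^bsub>lfib L \<eta>\<^esub> \<zero>\<^bsub>lfib L \<eta>\<^esub>)) = snd (\<phi> \<zero>\<^bsub>lfib L \<eta>\<^esub>) + snd (\<phi> \<zero>\<^bsub>lfib L \<eta>\<^esub>)"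
        using triv \<eta> fibre_zero[OF \<eta>(1)] by (simp add: local_trivialization_def)
      then show ?thesis using \<eta> by (simp add: add_zero_zero sec_zero_def)
    qed
    have "continuous_map (subtopology (garr G) (W \<inter> U)) euclidean (\<lambda>\<eta>. snd (\<phi> (sec_zero G L \<eta>)))"
      by (rule continuous_map_eq[where f = "\<lambda>_. 0"]) (simp_all add: zero)
    then have "continuous_map (subtopology (garr G) (W \<inter> U)) (ltop L) (sec_zero G L)"
      using section_fibre[OF sections_closed(1)] sub
      by (subst continuous_trivialized[OF U(1) triv]) auto
    moreover have "openin (subtopology (garr G) W) (W \<inter> U)"
      using U(1) by (simp add: openin_subtopology_Int2)
    moreover have "subtopology (subtopology (garr G) W) (W \<inter> U) = subtopology (garr G) (W \<inter> U)"
      by (simp add: subtopology_subtopology)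
    ultimately show "\<exists>N. openin (subtopology (garr G) W) N \<and> \<gamma> \<in> N \<and>
        continuous_map (subtopology (subtopology (garr G) W) N) (ltop L) (sec_zero G L)"
      using \<gamma> U(2) by (intro exI[of _ "W \<inter> U"]) simp
  qed
  then show ?thesis
    unfolding Cc_iff[OF W] using sections_closed(1)
    by (intro conjI exI[of _ "{}"]) (auto simp: sec_zero_def)
qed

primrec secsum :: "('g \<Rightarrow> 'l) list \<Rightarrow> 'g \<Rightarrow> 'l" where
  "secsum [] = sec_zero G L"
| "secsum (f # fs) = sec_add G L f (secsum fs)"

lemma secsum_section: "set fs \<subseteq> sections G L \<Longrightarrow> secsum fs \<in> sections G L"
  by (induction fs) (auto intro: sections_closed)

lemma coord_secsum:
  assumes "set fs \<subseteq> sections G L" "\<gamma> \<in> arrows G"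
  shows "coord \<gamma> (secsum fs \<gamma>) = (\<Sum>f\<leftarrow>fs. coord \<gamma> (f \<gamma>))"
  using assms
proof (induction fs)
  case Nil
  then show ?case by (simp add: sec_zero_def coord_zero)
next
  case (Cons f fs)
  then have "f \<gamma> \<in> fibre L \<gamma>" "secsum fs \<gamma> \<in> fibre L \<gamma>"
    using section_fibre secsum_section by auto
  with Cons show ?case by (simp add: sec_add_def coord_add)
qed

lemma Cc_secsum: "W \<in> bisections G \<Longrightarrow> set fs \<subseteq> Cc G L W \<Longrightarrow> secsum fs \<in> Cc G L W"
  by (induction fs) (auto intro: Cc_zero Cc_add)

text \<open>The transport of \<open>u\<close> to the unit space along a leg that is injective on \<open>U\<close>, extended by zero.\<close>

definition push :: "('g \<Rightarrow> 'g) \<Rightarrow> 'g set \<Rightarrow> ('g \<Rightarrow> real) \<Rightarrow> 'g \<Rightarrow> real" where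
  "push s U u x = (if x \<in> s ` U then u (inv_into U s x) else 0)"

definition Cc_units :: "('g \<Rightarrow> real) set" where
  "Cc_units = {g. continuous_map (unit_space G) euclideanreal g \<and>
     (\<exists>K. compactin (unit_space G) K \<and> (\<forall>x\<in>gunits G - K. g x = 0))}"

lemma push_leg: "U \<in> bisections G \<Longrightarrow> s \<in> legs \<Longrightarrow> \<gamma> \<in> U \<Longrightarrow> push s U u (s \<gamma>) = u \<gamma>"
  using bisection_leg(1)[of U s] by (simp add: push_def)

text \<open>Continuity is checked on two open sets covering the unit space: the image of the bisection, and
  the complement of the compact, hence closed, image of the support.\<close>

lemma push_in_Cc_units:
  assumes U: "U \<in> bisections G" and s: "s \<in> legs"
    and u: "continuous_map (subtopology (garr G) U) euclideanreal u"
    and K: "compactin (garr G) K" "K \<subseteq> U" "\<And>\<gamma>. \<gamma> \<in> U \<Longrightarrow> \<gamma> \<notin> K \<Longrightarrow> u \<gamma> = 0"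
  shows "push s U u \<in> Cc_units"
proof -
  have cK: "compactin (unit_space G) (s ` K)"
    by (rule image_compactin[OF K(1) leg_continuous[OF s]])
  have zero: "push s U u x = 0" if "x \<notin> s ` K" for x
  proof (cases "x \<in> s ` U")
    case True
    then obtain \<gamma> where "\<gamma> \<in> U" "x = s \<gamma>" by auto
    with that K(3)[of \<gamma>] show ?thesis by (auto simp: push_leg[OF U s])
  qed (simp add: push_def)
  have "continuous_map (unit_space G) euclideanreal (push s U u)"
  proof (rule continuous_map_locally)
    fix x assume x: "x \<in> topspace (unit_space G)"
    show "\<exists>N. openin (unit_space G) N \<and> x \<in> N \<and> continuous_map (subtopology (unit_space G) N) euclideanreal (push s U u)"
    proof (cases "x \<in> s ` U")
      case True
      have "continuous_map (subtopology (unit_space G) (s ` U)) euclideanreal (u \<circ> inv_into U s)"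
        by (rule continuous_map_compose[OF bisection_leg(3)[OF U s] u])
      then have "continuous_map (subtopology (unit_space G) (s ` U)) euclideanreal (push s U u)"
        by (rule continuous_map_eq) (simp add: push_def)
      then show ?thesis using bisection_leg(2)[OF U s] True by blast
    next
      case False
      have "closedin (unit_space G) (s ` K)"
        by (rule compactin_imp_closedin[OF Hausdorff_units cK])
      then have "openin (unit_space G) (topspace (unit_space G) - s ` K)"
        by (rule openin_diff[OF openin_topspace])
      moreover have "continuous_map (subtopology (unit_space G) (topspace (unit_space G) - s ` K)) euclideanreal (push s U u)"
        by (rule continuous_map_eq[where f = "\<lambda>_. 0"]) (auto simp: zero)
      moreover have "x \<in> topspace (unit_space G) - s ` K" using x False K(2) by auto
      ultimately show ?thesis by blast
    qed
  qed
  then show ?thesis unfolding Cc_units_def using cK zero by auto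
qed

lemma Cc_units_compose:
  assumes g: "g \<in> Cc_units" and h: "continuous_on UNIV h" "h 0 = 0"
  shows "(\<lambda>x. h (g x)) \<in> Cc_units"
proof -
  have "continuous_map (unit_space G) euclideanreal (h \<circ> g)"
    using g h by (intro continuous_map_compose[where X' = euclidean]) (auto simp: Cc_units_def)
  then show ?thesis using g h by (auto simp: Cc_units_def o_def)
qed

lemma Cc_units_add:
  assumes "g \<in> Cc_units" "h \<in> Cc_units" shows "(\<lambda>x. g x + h x) \<in> Cc_units"
proof -
  from assms obtain K K' where "compactin (unit_space G) K" "\<forall>x\<in>gunits G - K. g x = 0"
    "compactin (unit_space G) K'" "\<forall>x\<in>gunits G - K'. h x = 0"
    by (auto simp: Cc_units_def)
  then have "compactin (unit_space G) (K \<union> K')" "\<forall>x\<in>gunits G - (K \<union> K'). g x + h x = 0"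
    by (auto intro: compactin_Un)
  moreover have "continuous_map (unit_space G) euclideanreal (\<lambda>x. g x + h x)"
    using assms by (intro continuous_map_add) (auto simp: Cc_units_def)
  ultimately show ?thesis unfolding Cc_units_def by blast
qed

lemma Cc_units_mult:
  assumes "g \<in> Cc_units" "h \<in> Cc_units" shows "(\<lambda>x. g x * h x) \<in> Cc_units"
proof -
  from assms obtain K where "compactin (unit_space G) K" "\<forall>x\<in>gunits G - K. g x = 0"
    by (auto simp: Cc_units_def)
  moreover have "continuous_map (unit_space G) euclideanreal (\<lambda>x. g x * h x)"
    using assms by (intro continuous_map_real_mult) (auto simp: Cc_units_def)
  ultimately show ?thesis unfolding Cc_units_def by auto
qed

lemma Cc_units_zero: "(\<lambda>x. 0) \<in> Cc_units"
  by (auto simp: Cc_units_def intro: exI[of _ "{}"])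

lemma Cc_units_sum: "(\<And>i. i \<in> I \<Longrightarrow> g i \<in> Cc_units) \<Longrightarrow> (\<lambda>x. \<Sum>i\<in>I. g i x) \<in> Cc_units"
  by (induction I rule: infinite_finite_induct) (auto intro: Cc_units_zero Cc_units_add)

text \<open>A function on the unit space as a section, by means of \<open>ltriv\<close>.\<close>

definition fn :: "('g \<Rightarrow> real) \<Rightarrow> 'g \<Rightarrow> 'l" where
  "fn g = (\<lambda>\<gamma>\<in>arrows G. if \<gamma> \<in> gunits G then ltriv L \<gamma> (complex_of_real (g \<gamma>)) else \<zero>\<^bsub>lfib L \<gamma>\<^esub>)"

lemma unit_arrow: "x \<in> gunits G \<Longrightarrow> x \<in> arrows G"
  using units_subset by blast

lemma fn_section: "fn g \<in> sections G L"
  by (auto simp: sections_def fn_def fibre_zero scalars_in_F intro!: triv_fibre)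

lemma fn_in_Cc:
  assumes g: "g \<in> Cc_units" shows "fn g \<in> Cc G L (gunits G)"
proof -
  obtain K where K: "compactin (unit_space G) K" "\<forall>x\<in>gunits G - K. g x = 0"
    and cont: "continuous_map (unit_space G) euclideanreal g"
    using g by (auto simp: Cc_units_def)
  have "continuous_map (unit_space G) (top_of_set F) (\<lambda>x. complex_of_real (g x))"
  proof -
    have "continuous_map (unit_space G) euclidean (complex_of_real \<circ> g)"
      by (rule continuous_map_compose[OF cont]) (simp add: continuous_on_of_real)
    then show ?thesis by (simp add: continuous_map_in_subtopology o_def scalars_in_F)
  qed
  then have "continuous_map (unit_space G) (prod_topology (unit_space G) (top_of_set F)) (\<lambda>x. (x, complex_of_real (g x)))"
    using continuous_map_id[of "unit_space G"] by (intro continuous_map_pairedI) (simp_all add: id_def)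
  then have "continuous_map (unit_space G) (ltop L) ((\<lambda>(x, s). ltriv L x s) \<circ> (\<lambda>x. (x, complex_of_real (g x))))"
    using homeomorphic_imp_continuous_map[OF triv_homeomorphism] continuous_map_into_fulltopology
    by (intro continuous_map_compose) auto
  then have "continuous_map (unit_space G) (ltop L) (fn g)"
    by (rule continuous_map_eq) (simp add: fn_def unit_arrow)
  moreover have "compactin (garr G) K" "K \<subseteq> gunits G"
    using K(1) by (simp_all add: unit_space_def compactin_subtopology)
  moreover have "fn g \<gamma> = \<zero>\<^bsub>lfib L \<gamma>\<^esub>" if "\<gamma> \<in> arrows G - K" for \<gamma>
  proof (cases "\<gamma> \<in> gunits G")
    case True
    then have "lmod L (ltriv L \<gamma> 0) = 0" "ltriv L \<gamma> 0 \<in> fibre L \<gamma>"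
      using triv_mod[of \<gamma> 0] triv_fibre[of \<gamma> 0] scalars_in_F(2) by auto
    then have "ltriv L \<gamma> 0 = \<zero>\<^bsub>lfib L \<gamma>\<^esub>"
      using mod_eq_0[OF unit_arrow[OF True]] by blast
    then show ?thesis using True that K(2) by (simp add: fn_def)
  qed (use that in \<open>simp add: fn_def\<close>)
  ultimately show ?thesis
    unfolding Cc_iff[OF units_bisection] using fn_section
    by (intro conjI exI[of _ K]) (auto simp: unit_space_def)
qed

lemma lmul_eq_zero:
  assumes "\<gamma> \<in> arrows G" "\<eta> \<in> arrows G" "gdom G \<gamma> = gran G \<eta>" "z \<in> fibre L \<gamma>" "w \<in> fibre L \<eta>"
    and "z = \<zero>\<^bsub>lfib L \<gamma>\<^esub> \<or> w = \<zero>\<^bsub>lfib L \<eta>\<^esub>"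
  shows "lmul L z w = \<zero>\<^bsub>lfib L (gmul G \<gamma> \<eta>)\<^esub>"
proof -
  have "lmod L (lmul L z w) = 0"
    using assms(6) lmod_zero[OF assms(1)] lmod_zero[OF assms(2)] by (auto simp: mod_lmul[OF assms(1-5)])
  then show ?thesis
    using mod_eq_0[OF mul_closed[OF assms(1-3)] lmul_fibre[OF assms(1-5)]] by simp
qed

text \<open>The element \<open>e\<close> of modulus one over a unit is idempotent, so that \<open>e (e z - z) = 0\<close>, and the modulus
  of this product is that of \<open>e z - z\<close>.\<close>

lemma ltriv_one_lmul:
  assumes g: "\<gamma> \<in> arrows G" and z: "z \<in> fibre L \<gamma>"
  shows "lmul L (ltriv L (gran G \<gamma>) 1) z = z"
proof -
  let ?x = "gran G \<gamma>"
  let ?e = "ltriv L ?x 1"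
  have x: "?x \<in> gunits G" "?x \<in> arrows G" "gdom G ?x = gran G \<gamma>" "gdom G ?x = gran G ?x"
    using ran_units[OF g] unit_arrow ran_unit dom_unit by auto
  have e: "?e \<in> fibre L ?x" by (rule triv_fibre[OF x(1) scalars_in_F(3)])
  have gx: "gmul G ?x \<gamma> = \<gamma>" by (rule ran_mul_self[OF g])
  have ez: "lmul L ?e v \<in> fibre L \<gamma>" if "v \<in> fibre L \<gamma>" for v
    using lmul_fibre[OF x(2) g x(3) e that] by (simp add: gx)
  have idem: "lmul L ?e ?e = ?e"
    using triv_mul[OF x(1) scalars_in_F(3) scalars_in_F(3)] by simp
  have m1: "- 1 \<in> F" using scalars_in_F(1)[of "- 1"] by simp
  let ?z = "(- 1) \<odot>\<^bsub>lfib L \<gamma>\<^esub> z"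
  define v where "v = lmul L ?e z \<oplus>\<^bsub>lfib L \<gamma>\<^esub> ?z"
  have z': "?z \<in> fibre L \<gamma>" by (rule fibre_scale[OF g m1 z])
  have v: "v \<in> fibre L \<gamma>" unfolding v_def by (rule fibre_add[OF g ez[OF z] z'])
  have "lmul L ?e v = lmul L ?e (lmul L ?e z) \<oplus>\<^bsub>lfib L \<gamma>\<^esub> lmul L ?e ?z"
    using lmul_add_right[OF x(2) g x(3) e ez[OF z] z'] by (simp add: v_def gx)
  also have "lmul L ?e (lmul L ?e z) = lmul L ?e z"
    using lmul_assoc[OF x(2) x(2) g x(4) x(3) e e z] idem by simp
  also have "lmul L ?e ?z = (- 1) \<odot>\<^bsub>lfib L \<gamma>\<^esub> lmul L ?e z"
    using lmul_scale_right[OF x(2) g x(3) e z m1] by (simp add: gx)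
  finally have "coord \<gamma> (lmul L ?e v) = 0"
    using ez[OF z] by (simp add: coord_add[OF g] coord_scale[OF g _ m1] fibre_scale[OF g m1])
  then have "lmod L (lmul L ?e v) = 0"
    using coord_norm[OF g ez[OF v]] by simp
  then have "lmod L v = 0"
    using mod_lmul[OF x(2) g x(3) e v] triv_mod[OF x(1) scalars_in_F(3)] by simp
  then have "coord \<gamma> v = 0"
    using coord_norm[OF g v] by simp
  then have "coord \<gamma> (lmul L ?e z) = coord \<gamma> z"
    using ez[OF z] z' by (simp add: v_def coord_add[OF g] coord_scale[OF g z m1])
  then show ?thesis using coord_inj[OF g ez[OF z] z] by simp
qed

lemma ltriv_lmul:
  assumes g: "\<gamma> \<in> arrows G" and z: "z \<in> fibre L \<gamma>" and c: "c \<in> F"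
  shows "lmul L (ltriv L (gran G \<gamma>) c) z = c \<odot>\<^bsub>lfib L \<gamma>\<^esub> z"
proof -
  let ?x = "gran G \<gamma>"
  have x: "?x \<in> gunits G" "?x \<in> arrows G" "gdom G ?x = gran G \<gamma>"
    using ran_units[OF g] unit_arrow dom_unit by auto
  have "ltriv L ?x c = c \<odot>\<^bsub>lfib L ?x\<^esub> ltriv L ?x 1"
    using triv_scale[OF x(1) c scalars_in_F(3)] by simp
  then have "lmul L (ltriv L ?x c) z = c \<odot>\<^bsub>lfib L \<gamma>\<^esub> lmul L (ltriv L ?x 1) z"
    using lmul_scale_left[OF x(2) g x(3) triv_fibre[OF x(1) scalars_in_F(3)] z c] by (simp add: ran_mul_self[OF g])
  then show ?thesis by (simp add: ltriv_one_lmul[OF g z])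
qed

lemma conv_eq_single:
  assumes f: "f \<in> sections G L" and g: "g \<in> sections G L"
    and \<gamma>: "\<gamma> \<in> arrows G" and \<eta>: "\<eta> \<in> arrows G" "gran G \<eta> = gran G \<gamma>"
    and off: "\<And>\<zeta>. \<zeta> \<in> arrows G \<Longrightarrow> gran G \<zeta> = gran G \<gamma> \<Longrightarrow> \<zeta> \<noteq> \<eta> \<Longrightarrow>
      f \<zeta> = \<zero>\<^bsub>lfib L \<zeta>\<^esub> \<or> g (gmul G (ginv G \<zeta>) \<gamma>) = \<zero>\<^bsub>lfib L (gmul G (ginv G \<zeta>) \<gamma>)\<^esub>"
  shows "conv G L f g \<gamma> = lmul L (f \<eta>) (g (gmul G (ginv G \<eta>) \<gamma>))"
proof -
  let ?A = "{\<zeta> \<in> arrows G. gran G \<zeta> = gran G \<gamma>}" and ?M = "add_monoid (lfib L \<gamma>)"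
  let ?t = "\<lambda>\<zeta>. lmul L (f \<zeta>) (g (gmul G (ginv G \<zeta>) \<gamma>))"
  interpret M: comm_monoid ?M
    by (rule abelian_monoid.a_comm_monoid[OF abelian_group.axioms(1)[OF fibre_abelian_group[OF \<gamma>]]])
  have prem: "gmul G (ginv G \<zeta>) \<gamma> \<in> arrows G" "gdom G \<zeta> = gran G (gmul G (ginv G \<zeta>) \<gamma>)"
      "gmul G \<zeta> (gmul G (ginv G \<zeta>) \<gamma>) = \<gamma>"
    if "\<zeta> \<in> arrows G" "gran G \<zeta> = gran G \<gamma>" for \<zeta>
    using that \<gamma> mul_closed[OF inv_closed[OF that(1)] \<gamma>] dom_inv[OF that(1)] ran_inv[OF that(1)]
      ran_mul[OF inv_closed[OF that(1)] \<gamma>] mul_inv_cancel[OF \<gamma> that] by simp_all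
  have "?t \<zeta> = \<zero>\<^bsub>lfib L \<gamma>\<^esub>" if "\<zeta> \<in> ?A" "\<zeta> \<noteq> \<eta>" for \<zeta>
  proof -
    from that have \<zeta>: "\<zeta> \<in> arrows G" "gran G \<zeta> = gran G \<gamma>" by auto
    show ?thesis
      using lmul_eq_zero[OF \<zeta>(1) prem(1,2)[OF \<zeta>] section_fibre[OF f \<zeta>(1)] section_fibre[OF g prem(1)[OF \<zeta>]] off[OF \<zeta> that(2)]]
      by (simp add: prem(3)[OF \<zeta>])
  qed
  then have supp: "{\<zeta> \<in> ?A. ?t \<zeta> \<noteq> \<zero>\<^bsub>lfib L \<gamma>\<^esub>} = (if ?t \<eta> = \<zero>\<^bsub>lfib L \<gamma>\<^esub> then {} else {\<eta>})"
    using \<eta> by auto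
  have mem: "?t \<eta> \<in> carrier ?M"
    using lmul_fibre[OF \<eta>(1) prem(1,2)[OF \<eta>] section_fibre[OF f \<eta>(1)] section_fibre[OF g prem(1)[OF \<eta>]]]
    by (simp add: prem(3)[OF \<eta>])
  define S where "S = {\<zeta> \<in> ?A. ?t \<zeta> \<noteq> \<zero>\<^bsub>lfib L \<gamma>\<^esub>}"
  have "gfinprod ?M ?t ?A = (if finite S then finprod ?M ?t S else \<zero>\<^bsub>lfib L \<gamma>\<^esub>)"
    by (simp add: gfinprod_def S_def)
  also have "\<dots> = ?t \<eta>"
    using M.finprod_insert[of "{}" \<eta> ?t] M.r_one[OF mem] mem by (simp add: S_def[unfolded supp])
  finally have "gfinprod ?M ?t ?A = ?t \<eta>" .
  then show ?thesis using \<gamma> by (simp add: conv_def)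
qed

lemma unit_inv: "x \<in> gunits G \<Longrightarrow> ginv G x = x"
  using inv_mul[OF unit_arrow] mul_dom_self[OF inv_closed[OF unit_arrow]] dom_inv[OF unit_arrow]
  by (metis dom_unit ran_unit)

lemma conv_fn:
  assumes f: "f \<in> sections G L"
  shows "conv G L (fn g) f = (\<lambda>\<gamma>\<in>arrows G. complex_of_real (g (gran G \<gamma>)) \<odot>\<^bsub>lfib L \<gamma>\<^esub> f \<gamma>)"
proof (rule extensionalityI)
  show "conv G L (fn g) f \<in> extensional (arrows G)" by (simp add: conv_def)
  fix \<gamma> assume \<gamma>: "\<gamma> \<in> arrows G"
  let ?x = "gran G \<gamma>"
  have x: "?x \<in> gunits G" "?x \<in> arrows G" "gran G ?x = gran G \<gamma>"
    using ran_units[OF \<gamma>] unit_arrow ran_unit by auto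
  have "conv G L (fn g) f \<gamma> = lmul L (fn g ?x) (f (gmul G (ginv G ?x) \<gamma>))"
  proof (rule conv_eq_single[OF fn_section f \<gamma> x(2,3)])
    fix \<zeta> assume "\<zeta> \<in> arrows G" "gran G \<zeta> = ?x" "\<zeta> \<noteq> ?x"
    then show "fn g \<zeta> = \<zero>\<^bsub>lfib L \<zeta>\<^esub> \<or> f (gmul G (ginv G \<zeta>) \<gamma>) = \<zero>\<^bsub>lfib L (gmul G (ginv G \<zeta>) \<gamma>)\<^esub>"
      using ran_unit by (auto simp: fn_def)
  qed
  also have "gmul G (ginv G ?x) \<gamma> = \<gamma>"
    using unit_inv[OF x(1)] ran_mul_self[OF \<gamma>] by simp
  also have "lmul L (fn g ?x) (f \<gamma>) = complex_of_real (g ?x) \<odot>\<^bsub>lfib L \<gamma>\<^esub> f \<gamma>"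
    using x ltriv_lmul[OF \<gamma> section_fibre[OF f \<gamma>] scalars_in_F(1)] by (simp add: fn_def)
  finally show "conv G L (fn g) f \<gamma> = (\<lambda>\<gamma>\<in>arrows G. complex_of_real (g (gran G \<gamma>)) \<odot>\<^bsub>lfib L \<gamma>\<^esub> f \<gamma>) \<gamma>"
    using \<gamma> by simp
qed simp

lemma coord_fn:
  assumes "\<gamma> \<in> arrows G"
  shows "coord \<gamma> (fn g \<gamma>) = (if \<gamma> \<in> gunits G then complex_of_real (g \<gamma>) * coord \<gamma> (ltriv L \<gamma> 1) else 0)"
proof (cases "\<gamma> \<in> gunits G")
  case True
  have "ltriv L \<gamma> (complex_of_real (g \<gamma>)) = complex_of_real (g \<gamma>) \<odot>\<^bsub>lfib L \<gamma>\<^esub> ltriv L \<gamma> 1"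
    using triv_scale[OF True scalars_in_F(1) scalars_in_F(3), of "g \<gamma>"] by simp
  then show ?thesis
    using True assms coord_scale[OF assms triv_fibre[OF True scalars_in_F(3)] scalars_in_F(1)] by (simp add: fn_def)
qed (use assms in \<open>simp add: fn_def coord_zero\<close>)

lemma fn_add: "fn (\<lambda>x. g x + h x) = sec_add G L (fn g) (fn h)"
proof (rule section_eqI[OF fn_section sections_closed(2)[OF fn_section fn_section]])
  fix \<gamma> assume \<gamma>: "\<gamma> \<in> arrows G"
  show "coord \<gamma> (fn (\<lambda>x. g x + h x) \<gamma>) = coord \<gamma> (sec_add G L (fn g) (fn h) \<gamma>)"
    using \<gamma> coord_add[OF \<gamma> section_fibre[OF fn_section \<gamma>] section_fibre[OF fn_section \<gamma>]]
    by (simp add: sec_add_def coord_fn algebra_simps)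
qed

lemma fn_scale: "fn (\<lambda>x. r * g x) = sec_scale G L (complex_of_real r) (fn g)"
proof (rule section_eqI[OF fn_section sections_closed(3)[OF scalars_in_F(1) fn_section]])
  fix \<gamma> assume \<gamma>: "\<gamma> \<in> arrows G"
  show "coord \<gamma> (fn (\<lambda>x. r * g x) \<gamma>) = coord \<gamma> (sec_scale G L (complex_of_real r) (fn g) \<gamma>)"
    using \<gamma> coord_scale[OF \<gamma> section_fibre[OF fn_section \<gamma>] scalars_in_F(1)]
    by (simp add: sec_scale_def coord_fn)
qed

lemma conv_fn_fn: "conv G L (fn g) (fn h) = fn (\<lambda>x. g x * h x)"
  unfolding conv_fn[OF fn_section]
proof (rule section_eqI[OF _ fn_section])
  show "(\<lambda>\<gamma>\<in>arrows G. complex_of_real (g (gran G \<gamma>)) \<odot>\<^bsub>lfib L \<gamma>\<^esub> fn h \<gamma>) \<in> sections G L"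
    using section_fibre[OF fn_section] by (auto simp: sections_def intro!: fibre_scale scalars_in_F)
  fix \<gamma> assume \<gamma>: "\<gamma> \<in> arrows G"
  show "coord \<gamma> ((\<lambda>\<gamma>\<in>arrows G. complex_of_real (g (gran G \<gamma>)) \<odot>\<^bsub>lfib L \<gamma>\<^esub> fn h \<gamma>) \<gamma>) =
      coord \<gamma> (fn (\<lambda>x. g x * h x) \<gamma>)"
    using \<gamma> coord_scale[OF \<gamma> section_fibre[OF fn_section \<gamma>] scalars_in_F(1)]
    by (simp add: coord_fn ran_unit)
qed

lemma lstar_zero:
  assumes "\<gamma> \<in> arrows G" shows "lstar L \<zero>\<^bsub>lfib L \<gamma>\<^esub> = \<zero>\<^bsub>lfib L (ginv G \<gamma>)\<^esub>"
  using mod_eq_0[OF inv_closed[OF assms] lstar_fibre[OF assms fibre_zero[OF assms]]]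
    mod_lstar[OF assms fibre_zero[OF assms]] lmod_zero[OF assms] by simp

lemma sec_star_section: "f \<in> sections G L \<Longrightarrow> sec_star G L f \<in> sections G L"
  using lstar_fibre[OF inv_closed section_fibre[OF _ inv_closed]]
  by (auto simp: sections_def sec_star_def inv_inv PiE_iff)

lemma sec_star_fn: "sec_star G L (fn g) = fn g"
proof (rule extensionalityI)
  show "sec_star G L (fn g) \<in> extensional (arrows G)" "fn g \<in> extensional (arrows G)"
    by (simp_all add: sec_star_def fn_def)
  fix \<gamma> assume \<gamma>: "\<gamma> \<in> arrows G"
  show "sec_star G L (fn g) \<gamma> = fn g \<gamma>"
  proof (cases "\<gamma> \<in> gunits G")
    case True
    then show ?thesis
      using triv_star[OF True scalars_in_F(1), of "g \<gamma>"] \<gamma> by (simp add: sec_star_def fn_def unit_inv)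
  next
    case False
    then have "ginv G \<gamma> \<notin> gunits G"
      using unit_inv inv_inv[OF \<gamma>] by metis
    then show ?thesis
      using False \<gamma> lstar_zero[OF inv_closed[OF \<gamma>]] inv_closed[OF \<gamma>] inv_inv[OF \<gamma>]
      by (simp add: sec_star_def fn_def)
  qed
qed

lemma sec_star_Cc:
  assumes U: "U \<in> bisections G" and f: "f \<in> Cc G L U"
  shows "sec_star G L f \<in> Cc G L (ginv G ` U)"
proof -
  obtain K where K: "compactin (garr G) K" "K \<subseteq> U" "\<And>\<gamma>. \<gamma> \<in> arrows G \<Longrightarrow> \<gamma> \<notin> K \<Longrightarrow> f \<gamma> = \<zero>\<^bsub>lfib L \<gamma>\<^esub>"
    using CcE[OF U f] by blast
  have sub: "U \<subseteq> arrows G" by (rule bisection_arrows[OF U])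
  have "continuous_map (subtopology (garr G) (ginv G ` U)) (ltop L) (lstar L \<circ> (f \<circ> ginv G))"
    by (intro continuous_map_compose[OF _ lstar_continuous]
        continuous_map_compose[OF homeomorphic_imp_continuous_map[OF homeomorphic_map_inv[OF sub]] Cc_continuous[OF f]])
  then have "continuous_map (subtopology (garr G) (ginv G ` U)) (ltop L) (sec_star G L f)"
    by (rule continuous_map_eq) (simp add: sec_star_def)
  moreover have "compactin (garr G) (ginv G ` K)"
    by (rule image_compactin[OF K(1) continuous_inv])
  moreover have "sec_star G L f \<gamma> = \<zero>\<^bsub>lfib L \<gamma>\<^esub>" if "\<gamma> \<in> arrows G" "\<gamma> \<notin> ginv G ` K" for \<gamma>
  proof -
    have "ginv G \<gamma> \<notin> K"
      using that inv_inv[OF that(1)] by (metis imageI)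
    then show ?thesis
      using that K(3)[OF inv_closed[OF that(1)]] lstar_zero[OF inv_closed[OF that(1)]] inv_inv[OF that(1)]
      by (simp add: sec_star_def)
  qed
  ultimately show ?thesis
    unfolding Cc_iff[OF bisection_inv[OF U]] using sec_star_section[OF Cc_section[OF f]] K(2)
    by (intro conjI exI[of _ "ginv G ` K"]) auto
qed

text \<open>If \<open>\<eta>\<inverse>\<close> and \<open>\<eta>\<inverse> \<gamma>\<close> both lie in \<open>U\<close>, they agree because their ranges do, so \<open>\<gamma>\<close> is a unit. At a unit
  only the arrow of \<open>U\<close> with this domain contributes.\<close>

lemma conv_star_self:
  assumes U: "U \<in> bisections G" and f: "f \<in> Cc G L U"
  shows "conv G L (sec_star G L f) f = fn (push (gdom G) U (\<lambda>\<gamma>. (lmod L (f \<gamma>))\<^sup>2))" (is "?l = fn ?g")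
proof (rule extensionalityI)
  show "?l \<in> extensional (arrows G)" "fn ?g \<in> extensional (arrows G)"
    by (simp_all add: conv_def fn_def)
  fix \<gamma> assume \<gamma>: "\<gamma> \<in> arrows G"
  note fs = Cc_section[OF f]
  have inj: "inj_on (gran G) U" "inj_on (gdom G) U"
    using bisection_leg(1)[OF U] by auto
  have star: "sec_star G L f \<eta> = \<zero>\<^bsub>lfib L \<eta>\<^esub>" if "\<eta> \<in> arrows G" "ginv G \<eta> \<notin> U" for \<eta>
    using that Cc_zero_off[OF f inv_closed[OF that(1)]] lstar_zero[OF inv_closed[OF that(1)]] inv_inv[OF that(1)]
    by (simp add: sec_star_def)
  have prem: "gmul G (ginv G \<eta>) \<gamma> \<in> arrows G" "gran G (gmul G (ginv G \<eta>) \<gamma>) = gdom G \<eta>"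
    if "\<eta> \<in> arrows G" "gran G \<eta> = gran G \<gamma>" for \<eta>
    using that mul_closed[OF inv_closed[OF that(1)] \<gamma>] ran_mul[OF inv_closed[OF that(1)] \<gamma>]
      dom_inv[OF that(1)] ran_inv[OF that(1)] by simp_all
  show "?l \<gamma> = fn ?g \<gamma>"
  proof (cases "\<gamma> \<in> gunits G \<and> \<gamma> \<in> gdom G ` U")
    case True
    then obtain \<zeta> where \<zeta>: "\<zeta> \<in> U" "\<gamma> = gdom G \<zeta>" by auto
    then have \<zeta>a: "\<zeta> \<in> arrows G" using bisection_arrows[OF U] by blast
    have unit: "gran G \<gamma> = \<gamma>" using True ran_unit by blast
    let ?\<eta> = "ginv G \<zeta>"
    have \<eta>: "?\<eta> \<in> arrows G" "gran G ?\<eta> = gran G \<gamma>"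
      using inv_closed[OF \<zeta>a] ran_inv[OF \<zeta>a] \<zeta>(2) unit by auto
    have "?l \<gamma> = lmul L (sec_star G L f ?\<eta>) (f (gmul G (ginv G ?\<eta>) \<gamma>))"
    proof (rule conv_eq_single[OF sec_star_section[OF fs] fs \<gamma> \<eta>])
      fix \<xi> assume \<xi>: "\<xi> \<in> arrows G" "gran G \<xi> = gran G \<gamma>" "\<xi> \<noteq> ?\<eta>"
      have "ginv G \<xi> \<notin> U"
      proof
        assume "ginv G \<xi> \<in> U"
        moreover have "gdom G (ginv G \<xi>) = gdom G \<zeta>"
          using dom_inv[OF \<xi>(1)] \<xi>(2) unit \<zeta>(2) by simp
        ultimately have "ginv G \<xi> = \<zeta>"
          using inj(2) \<zeta>(1) by (simp add: inj_on_def)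
        then show False using \<xi>(3) inv_inv[OF \<xi>(1)] by simp
      qed
      then show "sec_star G L f \<xi> = \<zero>\<^bsub>lfib L \<xi>\<^esub> \<or> f (gmul G (ginv G \<xi>) \<gamma>) = \<zero>\<^bsub>lfib L (gmul G (ginv G \<xi>) \<gamma>)\<^esub>"
        using star[OF \<xi>(1)] by blast
    qed
    also have "gmul G (ginv G ?\<eta>) \<gamma> = \<zeta>"
      using inv_inv[OF \<zeta>a] mul_dom_self[OF \<zeta>a] \<zeta>(2) by simp
    also have "lmul L (sec_star G L f ?\<eta>) (f \<zeta>) = lmul L (lstar L (f \<zeta>)) (lstar L (lstar L (f \<zeta>)))"
      using \<eta>(1) inv_inv[OF \<zeta>a] lstar_lstar[OF \<zeta>a section_fibre[OF fs \<zeta>a]] by (simp add: sec_star_def)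
    also have "\<dots> = ltriv L \<gamma> (complex_of_real ((lmod L (f \<zeta>))\<^sup>2))"
      using lmul_lstar[OF \<eta>(1) lstar_fibre[OF \<zeta>a section_fibre[OF fs \<zeta>a]]]
        mod_lstar[OF \<zeta>a section_fibre[OF fs \<zeta>a]] \<eta>(2) unit by simp
    also have "\<dots> = fn ?g \<gamma>"
      using \<gamma> True push_leg[OF U _ \<zeta>(1), of "gdom G"] \<zeta>(2) by (simp add: fn_def)
    finally show ?thesis .
  next
    case False
    have "?l \<gamma> = lmul L (sec_star G L f \<gamma>) (f (gmul G (ginv G \<gamma>) \<gamma>))"
      and "sec_star G L f \<gamma> = \<zero>\<^bsub>lfib L \<gamma>\<^esub> \<or> f (gmul G (ginv G \<gamma>) \<gamma>) = \<zero>\<^bsub>lfib L (gmul G (ginv G \<gamma>) \<gamma>)\<^esub>"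
    proof -
      have *: "sec_star G L f \<xi> = \<zero>\<^bsub>lfib L \<xi>\<^esub> \<or> f (gmul G (ginv G \<xi>) \<gamma>) = \<zero>\<^bsub>lfib L (gmul G (ginv G \<xi>) \<gamma>)\<^esub>"
        if \<xi>: "\<xi> \<in> arrows G" "gran G \<xi> = gran G \<gamma>" for \<xi>
      proof (rule ccontr)
        assume "\<not> ?thesis"
        then have in_U: "ginv G \<xi> \<in> U" "gmul G (ginv G \<xi>) \<gamma> \<in> U"
          using star[OF \<xi>(1)] Cc_zero_off[OF f prem(1)[OF \<xi>]] by blast+
        then have eq: "gmul G (ginv G \<xi>) \<gamma> = ginv G \<xi>"
          using inj(1) prem(2)[OF \<xi>] ran_inv[OF \<xi>(1)] by (simp add: inj_on_def)
        then have "\<gamma> = gran G \<xi>"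
          using mul_inv_cancel[OF \<gamma> \<xi>] mul_inv[OF \<xi>(1)] by simp
        moreover have "gran G \<xi> = gdom G (ginv G \<xi>)" using dom_inv[OF \<xi>(1)] by simp
        ultimately show False
          using False in_U(1) ran_units[OF \<xi>(1)] by auto
      qed
      show "?l \<gamma> = lmul L (sec_star G L f \<gamma>) (f (gmul G (ginv G \<gamma>) \<gamma>))"
        by (rule conv_eq_single[OF sec_star_section[OF fs] fs \<gamma> \<gamma> refl *])
      show "sec_star G L f \<gamma> = \<zero>\<^bsub>lfib L \<gamma>\<^esub> \<or> f (gmul G (ginv G \<gamma>) \<gamma>) = \<zero>\<^bsub>lfib L (gmul G (ginv G \<gamma>) \<gamma>)\<^esub>"
        by (rule *[OF \<gamma> refl])
    qed
    then have "?l \<gamma> = \<zero>\<^bsub>lfib L (gmul G \<gamma> (gmul G (ginv G \<gamma>) \<gamma>))\<^esub>"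
      using lmul_eq_zero[OF \<gamma> prem(1)[OF \<gamma> refl] _ section_fibre[OF sec_star_section[OF fs] \<gamma>]
          section_fibre[OF fs prem(1)[OF \<gamma> refl]]] prem(2)[OF \<gamma> refl] by simp
    then have "?l \<gamma> = \<zero>\<^bsub>lfib L \<gamma>\<^esub>"
      using mul_inv_cancel[OF \<gamma> \<gamma> refl] by simp
    also have "\<dots> = fn ?g \<gamma>"
    proof (cases "\<gamma> \<in> gunits G")
      case True
      then have "?g \<gamma> = 0" using False by (simp add: push_def)
      then have "coord \<gamma> (fn ?g \<gamma>) = 0" using coord_fn[OF \<gamma>, of ?g] by simp
      then show ?thesis using coord_eq_0_iff[OF \<gamma> section_fibre[OF fn_section \<gamma>]] by metis
    qed (use \<gamma> in \<open>simp add: fn_def\<close>)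
    finally show ?thesis .
  qed
qed

lemma fn_in_alg: "g \<in> Cc_units \<Longrightarrow> fn g \<in> Cc_alg F G L"
  by (rule Cc_alg.base[OF units_bisection fn_in_Cc])

lemma secsum_in_alg: "set fs \<subseteq> Cc_alg F G L \<Longrightarrow> secsum fs \<in> Cc_alg F G L"
  by (induction fs) (auto intro: Cc_alg.zero Cc_alg.add)

lemma Cc_scale:
  assumes U: "U \<in> bisections G" and f: "f \<in> Cc G L U" and c: "c \<in> F"
  shows "sec_scale G L c f \<in> Cc G L U"
proof -
  obtain K where K: "compactin (garr G) K" "K \<subseteq> U" "\<And>\<gamma>. \<gamma> \<in> arrows G \<Longrightarrow> \<gamma> \<notin> K \<Longrightarrow> f \<gamma> = \<zero>\<^bsub>lfib L \<gamma>\<^esub>"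
    using CcE[OF U f] by blast
  show ?thesis
  proof (rule Cc_rescale[OF U f bisection_open[OF U] order_refl, where w = "\<lambda>_. c"])
    show "sec_scale G L c f \<gamma> = c \<odot>\<^bsub>lfib L \<gamma>\<^esub> f \<gamma>" if "\<gamma> \<in> U" for \<gamma>
      using that bisection_arrows[OF U] by (auto simp: sec_scale_def)
    show "sec_scale G L c f \<gamma> = \<zero>\<^bsub>lfib L \<gamma>\<^esub>" if "\<gamma> \<in> arrows G" "\<gamma> \<notin> K" for \<gamma>
      using that K(3) scale_zero_right[OF _ c] by (simp add: sec_scale_def)
  qed (use K c sections_closed(3)[OF c Cc_section[OF f]] in auto)
qed


lemma Cc_alg_decomposition:
  assumes "f \<in> Cc_alg F G L"
  obtains ps where "f = secsum (map snd ps)" "\<And>U h. (U, h) \<in> set ps \<Longrightarrow> U \<in> bisections G \<and> h \<in> Cc G L U"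
  using assms
proof (induction arbitrary: thesis)
  case zero
  show ?case by (rule zero[of "[]"]) auto
next
  case (base U f)
  have "f = secsum (map snd [(U, f)])"
  proof (rule section_eqI)
    show "f \<in> sections G L" using base by (simp add: Cc_section)
    then show "secsum (map snd [(U, f)]) \<in> sections G L" by (intro secsum_section) simp
    show "coord \<gamma> (f \<gamma>) = coord \<gamma> (secsum (map snd [(U, f)]) \<gamma>)" if "\<gamma> \<in> arrows G" for \<gamma>
      using that coord_secsum[of "map snd [(U, f)]" \<gamma>] \<open>f \<in> sections G L\<close> by simp
  qed
  then show ?case using base by (intro base(3)[of "[(U, f)]"]) auto
next
  case (add f g)
  obtain ps where ps: "f = secsum (map snd ps)" "\<And>U h. (U, h) \<in> set ps \<Longrightarrow> U \<in> bisections G \<and> h \<in> Cc G L U"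
    using add.IH(1) by blast
  obtain qs where qs: "g = secsum (map snd qs)" "\<And>U h. (U, h) \<in> set qs \<Longrightarrow> U \<in> bisections G \<and> h \<in> Cc G L U"
    using add.IH(2) by blast
  have sec: "set (map snd ps) \<subseteq> sections G L" "set (map snd qs) \<subseteq> sections G L"
    using ps(2) qs(2) Cc_section by fastforce+
  have "sec_add G L f g = secsum (map snd (ps @ qs))"
  proof (rule section_eqI)
    show "sec_add G L f g \<in> sections G L"
      unfolding ps(1) qs(1) by (intro sections_closed secsum_section sec)
    show "secsum (map snd (ps @ qs)) \<in> sections G L"
      using sec by (intro secsum_section) auto
    show "coord \<gamma> (sec_add G L f g \<gamma>) = coord \<gamma> (secsum (map snd (ps @ qs)) \<gamma>)" if \<gamma>: "\<gamma> \<in> arrows G" for \<gamma>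
      using \<gamma> sec coord_secsum[OF sec(1) \<gamma>] coord_secsum[OF sec(2) \<gamma>] coord_secsum[of "map snd (ps @ qs)" \<gamma>]
        coord_add[OF \<gamma> section_fibre[OF secsum_section[OF sec(1)] \<gamma>] section_fibre[OF secsum_section[OF sec(2)] \<gamma>]]
      by (simp add: ps(1) qs(1) sec_add_def)
  qed
  then show ?case using ps(2) qs(2) by (intro add.prems[of "ps @ qs"]) auto
next
  case (scale c f)
  obtain ps where ps: "f = secsum (map snd ps)" "\<And>U h. (U, h) \<in> set ps \<Longrightarrow> U \<in> bisections G \<and> h \<in> Cc G L U"
    using scale.IH by blast
  let ?qs = "map (\<lambda>(U, h). (U, sec_scale G L c h)) ps"
  have sec: "set (map snd ps) \<subseteq> sections G L"
    using ps(2) Cc_section by fastforce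
  then have sec': "set (map snd ?qs) \<subseteq> sections G L"
    using sections_closed(3)[OF scale(1)] by (fastforce simp: image_iff)
  have "sec_scale G L c f = secsum (map snd ?qs)"
  proof (rule section_eqI)
    show "sec_scale G L c f \<in> sections G L"
      unfolding ps(1) by (intro sections_closed(3) scale(1) secsum_section sec)
    show "secsum (map snd ?qs) \<in> sections G L"
      by (rule secsum_section[OF sec'])
    fix \<gamma> assume \<gamma>: "\<gamma> \<in> arrows G"
    have "coord \<gamma> (secsum (map snd ?qs) \<gamma>) = (\<Sum>p\<leftarrow>ps. coord \<gamma> (sec_scale G L c (snd p) \<gamma>))"
      unfolding coord_secsum[OF sec' \<gamma>] by (simp add: o_def case_prod_unfold)
    also have "\<dots> = (\<Sum>p\<leftarrow>ps. c * coord \<gamma> (snd p \<gamma>))"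
    proof (intro arg_cong[where f = sum_list] map_cong refl)
      fix p assume "p \<in> set ps"
      then have "snd p \<in> sections G L" using sec by auto
      then show "coord \<gamma> (sec_scale G L c (snd p) \<gamma>) = c * coord \<gamma> (snd p \<gamma>)"
        using \<gamma> coord_scale[OF \<gamma> section_fibre[OF _ \<gamma>] scale(1)] by (simp add: sec_scale_def)
    qed
    also have "\<dots> = c * coord \<gamma> (f \<gamma>)"
      unfolding ps(1) coord_secsum[OF sec \<gamma>] by (simp add: sum_list_const_mult o_def)
    also have "\<dots> = coord \<gamma> (sec_scale G L c f \<gamma>)"
      using \<gamma> coord_scale[OF \<gamma> section_fibre[OF secsum_section[OF sec] \<gamma>] scale(1)]
      by (simp add: ps(1) sec_scale_def)
    finally show "coord \<gamma> (sec_scale G L c f \<gamma>) = coord \<gamma> (secsum (map snd ?qs) \<gamma>)" by simp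
  qed
  moreover have "U \<in> bisections G \<and> h \<in> Cc G L U" if "(U, h) \<in> set ?qs" for U h
    using that ps(2) Cc_scale[OF _ _ scale(1)] by auto
  ultimately show ?case by (intro scale.prems[of ?qs])
qed

end

section \<open>Splitting a section into pieces without cancellation\<close>

text \<open>The key of an index stands for the arrow, or for the bisection, at which the value \<open>a i\<close> is taken.
  Values with the same key may cancel and are therefore added before taking norms.\<close>

definition class_sum :: "'i set \<Rightarrow> ('i \<Rightarrow> 'k) \<Rightarrow> ('i \<Rightarrow> 'a :: real_normed_vector) \<Rightarrow> real" where
  "class_sum I \<kappa> a = (\<Sum>v\<in>\<kappa> ` I. norm (\<Sum>i\<in>{i \<in> I. \<kappa> i = v}. a i))"

lemma class_sum_coarser:
  assumes fin: "finite I" and finer: "\<And>i j. i \<in> I \<Longrightarrow> j \<in> I \<Longrightarrow> \<kappa> i = \<kappa> j \<Longrightarrow> \<kappa>' i = \<kappa>' j"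
  shows "class_sum I \<kappa>' a \<le> class_sum I \<kappa> a"
proof -
  define N where "N v = norm (\<Sum>i\<in>{i \<in> I. \<kappa> i = v}. a i)" for v
  define g where "g v = \<kappa>' (inv_into I \<kappa> v)" for v
  have g: "g (\<kappa> i) = \<kappa>' i" if "i \<in> I" for i
  proof -
    have "\<kappa> i \<in> \<kappa> ` I" using that by blast
    then have "inv_into I \<kappa> (\<kappa> i) \<in> I" "\<kappa> (inv_into I \<kappa> (\<kappa> i)) = \<kappa> i"
      by (rule inv_into_into, rule f_inv_into_f)
    then show ?thesis unfolding g_def using that by (intro finer)
  qed
  have "norm (\<Sum>i\<in>{i \<in> I. \<kappa>' i = v'}. a i) \<le> (\<Sum>v\<in>{v \<in> \<kappa> ` I. g v = v'}. N v)" for v'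
  proof -
    let ?I = "{i \<in> I. \<kappa>' i = v'}"
    have im: "\<kappa> ` ?I = {v \<in> \<kappa> ` I. g v = v'}"
      using g by auto
    have "(\<Sum>i\<in>?I. a i) = (\<Sum>v\<in>\<kappa> ` ?I. \<Sum>i\<in>{i \<in> ?I. \<kappa> i = v}. a i)"
      by (rule sum.image_gen) (simp add: fin)
    also have "norm \<dots> \<le> (\<Sum>v\<in>\<kappa> ` ?I. norm (\<Sum>i\<in>{i \<in> ?I. \<kappa> i = v}. a i))"
      by (rule norm_sum)
    also have "\<dots> = (\<Sum>v\<in>\<kappa> ` ?I. N v)"
    proof (rule sum.cong)
      fix v assume "v \<in> \<kappa> ` ?I"
      then have "{i \<in> ?I. \<kappa> i = v} = {i \<in> I. \<kappa> i = v}"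
        by (auto simp flip: g)
      then show "norm (\<Sum>i\<in>{i \<in> ?I. \<kappa> i = v}. a i) = N v" by (simp add: N_def)
    qed simp
    finally show ?thesis unfolding im .
  qed
  then have "class_sum I \<kappa>' a \<le> (\<Sum>v'\<in>\<kappa>' ` I. \<Sum>v\<in>{v \<in> \<kappa> ` I. g v = v'}. N v)"
    unfolding class_sum_def by (rule sum_mono)
  also have "\<kappa>' ` I = g ` (\<kappa> ` I)"
    using g by (auto simp: image_image)
  also have "(\<Sum>v'\<in>g ` (\<kappa> ` I). \<Sum>v\<in>{v \<in> \<kappa> ` I. g v = v'}. N v) = (\<Sum>v\<in>\<kappa> ` I. N v)"
    by (rule sum.image_gen[symmetric]) (simp add: fin)
  finally show ?thesis by (simp add: class_sum_def N_def)
qed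

text \<open>This telescoping identity turns functions \<open>b j\<close> with values in the unit interval into a subpartition
  of unity that adds up to one where some \<open>b j\<close> is one.\<close>

lemma sum_mult_prod_one_minus:
  fixes b :: "nat \<Rightarrow> real"
  shows "(\<Sum>j<m. b j * (\<Prod>l<j. 1 - b l)) = 1 - (\<Prod>l<m. 1 - b l)"
  by (induction m) (auto simp: algebra_simps)

context etale_groupoid
begin

lemma partition_of_unity:
  assumes K: "compactin (unit_space G) K"
    and V: "\<And>x. x \<in> gunits G \<Longrightarrow> openin (unit_space G) (V x)" "\<And>x. x \<in> gunits G \<Longrightarrow> x \<in> V x"
  obtains m :: nat and p :: "nat \<Rightarrow> 'a" and \<rho> :: "nat \<Rightarrow> 'a \<Rightarrow> real" and C :: "nat \<Rightarrow> 'a set"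
  where "\<And>j. j < m \<Longrightarrow> p j \<in> gunits G"
    and "\<And>j. j < m \<Longrightarrow> continuous_map (unit_space G) euclideanreal (\<rho> j)"
    and "\<And>j. j < m \<Longrightarrow> closedin (unit_space G) (C j)"
    and "\<And>j. j < m \<Longrightarrow> C j \<subseteq> V (p j)"
    and "\<And>j x. j < m \<Longrightarrow> x \<in> gunits G \<Longrightarrow> x \<notin> C j \<Longrightarrow> \<rho> j x = 0"
    and "\<And>j x. j < m \<Longrightarrow> 0 \<le> \<rho> j x"
    and "\<And>x. (\<Sum>j<m. \<rho> j x) \<le> 1"
    and "\<And>x. x \<in> K \<Longrightarrow> (\<Sum>j<m. \<rho> j x) = 1"
proof -
  have "completely_regular_space (unit_space G)"
    using locally_compact_regular_imp_completely_regular_space locally_compact_units Hausdorff_units by blast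
  then have "\<forall>x\<in>gunits G. \<exists>g. continuous_map (unit_space G) euclideanreal g \<and> g x = 0 \<and> g ` (topspace (unit_space G) - V x) \<subseteq> {1}"
  proof (intro ballI)
    fix x assume that: "x \<in> gunits G"
    have "closedin (unit_space G) (topspace (unit_space G) - V x)"
      by (rule closedin_diff[OF closedin_topspace V(1)[OF that]])
    moreover have "x \<in> topspace (unit_space G) - (topspace (unit_space G) - V x)"
      using V(2)[OF that] that by simp
    ultimately show "\<exists>g. continuous_map (unit_space G) euclideanreal g \<and> g x = 0 \<and> g ` (topspace (unit_space G) - V x) \<subseteq> {1}"
      using \<open>completely_regular_space (unit_space G)\<close> unfolding completely_regular_space_alt by blast
  qed
  from bchoice[OF this] obtain g where
    "\<forall>x\<in>gunits G. continuous_map (unit_space G) euclideanreal (g x) \<and> g x x = 0 \<and>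
       g x ` (topspace (unit_space G) - V x) \<subseteq> {1}"
    by (elim exE)
  then have g: "\<And>x. x \<in> gunits G \<Longrightarrow> continuous_map (unit_space G) euclideanreal (g x)"
      "\<And>x. x \<in> gunits G \<Longrightarrow> g x x = 0" "\<And>x y. x \<in> gunits G \<Longrightarrow> y \<in> gunits G \<Longrightarrow> y \<notin> V x \<Longrightarrow> g x y = (1::real)"
    by auto
  define B where "B x = {y \<in> topspace (unit_space G). g x y \<in> {..<1/4}}" for x
  have B: "openin (unit_space G) (B x)" "x \<in> B x" if "x \<in> gunits G" for x
  proof -
    show "openin (unit_space G) (B x)"
      unfolding B_def by (rule openin_continuous_map_preimage[OF g(1)[OF that]]) simp
    show "x \<in> B x" using that g(2) by (simp add: B_def)
  qed
  have sub: "K \<subseteq> gunits G" using compactin_subset_topspace[OF K] by simp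
  have "\<exists>\<F>. finite \<F> \<and> \<F> \<subseteq> B ` gunits G \<and> K \<subseteq> \<Union>\<F>"
  proof -
    have "\<forall>S\<in>B ` gunits G. openin (unit_space G) S" "K \<subseteq> \<Union>(B ` gunits G)"
      using B sub by auto
    then show ?thesis using K unfolding compactin_def by meson
  qed
  then obtain F where F: "finite F" "F \<subseteq> gunits G" "K \<subseteq> \<Union>(B ` F)"
    by (metis finite_subset_image)
  obtain xs where xs: "set xs = F" using finite_list[OF F(1)] by blast
  define m where "m = length xs"
  define p where "p j = xs ! j" for j
  have p: "p j \<in> gunits G" if "j < m" for j
    using that F(2) xs by (auto simp: p_def m_def)
  \<comment> \<open>one where \<open>g (p j) \<le> 1/4\<close>, in particular on \<open>B (p j)\<close>, and zero off the closed set \<open>C j\<close>\<close>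
  define b where "b j y = max 0 (min 1 (2 - 4 * g (p j) y))" for j y
  have b01: "0 \<le> b j y" "b j y \<le> 1" for j y by (auto simp: b_def)
  define C where "C j = {y \<in> topspace (unit_space G). g (p j) y \<in> {..1/2}}" for j
  define \<rho> where "\<rho> j y = b j y * (\<Prod>l<j. 1 - b l y)" for j y
  have sum: "(\<Sum>j<m. \<rho> j y) = 1 - (\<Prod>l<m. 1 - b l y)" for y
    unfolding \<rho>_def by (rule sum_mult_prod_one_minus)
  show thesis
  proof (rule that[of m p \<rho> C])
    fix j assume j: "j < m"
    show "p j \<in> gunits G" by (rule p[OF j])
    have cb: "continuous_map (unit_space G) euclideanreal (b l)" if "l < m" for l
      unfolding b_def using g(1)[OF p[OF that]]
      by (intro continuous_map_real_max continuous_map_real_min continuous_map_diff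
          continuous_map_real_mult) auto
    show "continuous_map (unit_space G) euclideanreal (\<rho> j)"
      unfolding \<rho>_def using j cb
      by (intro continuous_map_real_mult continuous_map_prod continuous_map_diff) auto
    show "closedin (unit_space G) (C j)"
      unfolding C_def by (rule closedin_continuous_map_preimage[OF g(1)[OF p[OF j]]]) simp
    show "C j \<subseteq> V (p j)"
      using g(3)[OF p[OF j]] by (force simp: C_def)
    show "\<rho> j x = 0" if "x \<in> gunits G" "x \<notin> C j" for x
      using that by (auto simp: C_def \<rho>_def b_def)
    show "0 \<le> \<rho> j x" for x
      unfolding \<rho>_def using b01 by (intro mult_nonneg_nonneg prod_nonneg) auto
  next
    fix x
    show "(\<Sum>j<m. \<rho> j x) \<le> 1"
      unfolding sum using b01 by (auto intro!: prod_nonneg)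
    assume "x \<in> K"
    then obtain y where "y \<in> F" "x \<in> B y" using F(3) by auto
    then obtain l where "l < m" "y = p l"
      unfolding xs[symmetric] by (auto simp: in_set_conv_nth m_def p_def)
    then have "b l x = 1"
      using \<open>x \<in> B y\<close> by (simp add: B_def b_def)
    then have "(\<Prod>l<m. 1 - b l x) = 0"
      using \<open>l < m\<close> by (intro prod_zero) auto
    then show "(\<Sum>j<m. \<rho> j x) = 1" by (simp add: sum)
  qed
qed

end

context twisted_etale_groupoid
begin

lemma secsum_continuous:
  assumes W: "W \<in> bisections G" and fs: "set fs \<subseteq> sections G L"
    and cont: "\<And>f. f \<in> set fs \<Longrightarrow> continuous_map (subtopology (garr G) W) (ltop L) f"
  shows "continuous_map (subtopology (garr G) W) (ltop L) (secsum fs)"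
  using fs cont
proof (induction fs)
  case Nil
  then show ?case using Cc_continuous[OF Cc_zero[OF W]] by simp
next
  case (Cons f fs)
  have sec: "f \<in> sections G L" "secsum fs \<in> sections G L"
    using Cons secsum_section by auto
  have fib: "\<gamma> \<in> W \<Longrightarrow> f \<gamma> \<in> fibre L \<gamma>" "\<gamma> \<in> W \<Longrightarrow> secsum fs \<gamma> \<in> fibre L \<gamma>" for \<gamma>
    using section_fibre[OF sec(1)] section_fibre[OF sec(2)] bisection_arrows[OF W] by blast+
  have c1: "continuous_map (subtopology (garr G) W) (ltop L) f"
    and c2: "continuous_map (subtopology (garr G) W) (ltop L) (secsum fs)"
    using Cons by simp_all
  have "continuous_map (subtopology (garr G) W) (ltop L) (\<lambda>\<gamma>. f \<gamma> \<oplus>\<^bsub>lfib L \<gamma>\<^esub> secsum fs \<gamma>)"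
    by (rule continuous_section_combination(2)[OF bisection_open[OF W] c1 fib(1) c2 fib(2), where c = "\<lambda>_. 0"])
      (simp_all add: scalars_in_F)
  then show ?case
    by (rule continuous_map_eq) (simp add: sec_add_def)
qed

definition cut :: "('g \<Rightarrow> real) \<Rightarrow> ('g \<Rightarrow> 'l) \<Rightarrow> 'g \<Rightarrow> 'l" where
  "cut w f = (\<lambda>\<gamma>\<in>arrows G. complex_of_real (w \<gamma>) \<odot>\<^bsub>lfib L \<gamma>\<^esub> f \<gamma>)"

lemma cut_section: "f \<in> sections G L \<Longrightarrow> cut w f \<in> sections G L"
  using section_fibre by (auto simp: sections_def cut_def intro!: fibre_scale scalars_in_F)

lemma coord_cut: "f \<in> sections G L \<Longrightarrow> \<gamma> \<in> arrows G \<Longrightarrow> coord \<gamma> (cut w f \<gamma>) = complex_of_real (w \<gamma>) * coord \<gamma> (f \<gamma>)"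
  by (simp add: cut_def coord_scale[OF _ section_fibre scalars_in_F(1)])

lemma cut_Cc:
  assumes B: "B \<in> bisections G" and f: "f \<in> Cc G L B" and R: "openin (garr G) R"
    and D: "closedin (garr G) D" "D \<subseteq> R"
    and w: "continuous_map (garr G) euclideanreal w" "\<And>\<gamma>. \<gamma> \<in> arrows G \<Longrightarrow> \<gamma> \<notin> D \<Longrightarrow> w \<gamma> = 0"
  shows "cut w f \<in> Cc G L (B \<inter> R)"
proof -
  obtain K where K: "compactin (garr G) K" "K \<subseteq> B" "\<And>\<gamma>. \<gamma> \<in> arrows G \<Longrightarrow> \<gamma> \<notin> K \<Longrightarrow> f \<gamma> = \<zero>\<^bsub>lfib L \<gamma>\<^esub>"
    using CcE[OF B f] by blast
  have fs: "f \<in> sections G L" by (rule Cc_section[OF f])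
  show ?thesis
  proof (rule Cc_rescale[OF B f, where w = "\<lambda>\<gamma>. complex_of_real (w \<gamma>)" and K = "D \<inter> K"])
    show op: "openin (garr G) (B \<inter> R)" by (rule openin_Int[OF bisection_open[OF B] R])
    have "continuous_map (garr G) euclidean (complex_of_real \<circ> w)"
      by (rule continuous_map_compose[OF w(1)]) (simp add: continuous_on_of_real)
    then show "continuous_map (subtopology (garr G) (B \<inter> R)) euclidean (\<lambda>\<gamma>. complex_of_real (w \<gamma>))"
      by (intro continuous_map_from_subtopology) (simp add: o_def)
    show "cut w f \<in> sections G L" by (rule cut_section[OF fs])
    show "cut w f \<gamma> = complex_of_real (w \<gamma>) \<odot>\<^bsub>lfib L \<gamma>\<^esub> f \<gamma>" if "\<gamma> \<in> B \<inter> R" for \<gamma>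
      using that openin_subset[OF op] by (auto simp: cut_def)
    show "compactin (garr G) (D \<inter> K)" by (rule closed_Int_compactin[OF D(1) K(1)])
    show "D \<inter> K \<subseteq> B \<inter> R" using D K by blast
    show "cut w f \<gamma> = \<zero>\<^bsub>lfib L \<gamma>\<^esub>" if \<gamma>: "\<gamma> \<in> arrows G" "\<gamma> \<notin> D \<inter> K" for \<gamma>
    proof (cases "\<gamma> \<in> D")
      case True
      then have "f \<gamma> = \<zero>\<^bsub>lfib L \<gamma>\<^esub>" using \<gamma> K(3) by blast
      then show ?thesis using \<gamma> scale_zero_right[OF _ scalars_in_F(1)] by (simp add: cut_def)
    next
      case False
      then show ?thesis using \<gamma> w(2) scale_zero_left[OF _ section_fibre[OF fs]] by (simp add: cut_def)
    qed
  qed (auto simp: scalars_in_F)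
qed

context
  fixes n :: nat and U :: "nat \<Rightarrow> 'g set" and fs :: "nat \<Rightarrow> 'g \<Rightarrow> 'l"
  assumes U: "\<And>i. i < n \<Longrightarrow> U i \<in> bisections G"
    and fs: "\<And>i. i < n \<Longrightarrow> fs i \<in> Cc G L (U i)"
begin

text \<open>The coordinate of the \<open>i\<close>-th section at the arrow of its bisection over \<open>x\<close>. Values for different \<open>i\<close>
  are only added when these arrows coincide.\<close>

definition val :: "('g \<Rightarrow> 'g) \<Rightarrow> nat \<Rightarrow> 'g \<Rightarrow> complex" where
  "val s i x = (if x \<in> s ` U i then coord (inv_into (U i) s x) (fs i (inv_into (U i) s x)) else 0)"

definition key :: "('g \<Rightarrow> 'g) \<Rightarrow> 'g set \<Rightarrow> nat \<Rightarrow> 'g set" where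
  "key s V i = {\<gamma> \<in> U i. s \<gamma> \<in> V}"

lemma val_leg: "i < n \<Longrightarrow> s \<in> legs \<Longrightarrow> \<gamma> \<in> U i \<Longrightarrow> val s i (s \<gamma>) = coord \<gamma> (fs i \<gamma>)"
  using bisection_leg(1)[OF U] by (simp add: val_def)

text \<open>The bisections containing \<open>\<gamma>\<^sub>0\<close> have a common open part \<open>W\<close> around \<open>\<gamma>\<^sub>0\<close>, and on \<open>W\<close> the modulus of the
  sum of the sections is continuous.\<close>

lemma local_class_estimate:
  assumes s: "s \<in> legs" and c: "c \<subseteq> {..<n}" "c \<noteq> {}" and g: "\<And>i. i \<in> c \<Longrightarrow> \<gamma>\<^sub>0 \<in> U i" and e: "0 < e"
  obtains V where "openin (unit_space G) V" "s \<gamma>\<^sub>0 \<in> V"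
    "\<And>i j. i \<in> c \<Longrightarrow> j \<in> c \<Longrightarrow> key s V i = key s V j"
    "\<And>x. x \<in> V \<Longrightarrow> cmod (\<Sum>i\<in>c. val s i x) \<le> cmod (\<Sum>i\<in>c. val s i (s \<gamma>\<^sub>0)) + e"
proof -
  have fin: "finite c" using c(1) finite_subset by blast
  obtain i\<^sub>0 where i0: "i\<^sub>0 \<in> c" using c(2) by blast
  define W where "W = (\<Inter>i\<in>c. U i)"
  have "openin (garr G) W"
    unfolding W_def using fin c U bisection_open by (intro openin_INT2) auto
  then have W: "W \<in> bisections G"
    using i0 c(1) by (intro bisection_subset[OF U]) (auto simp: W_def)
  define h where "h = secsum (map fs (sorted_list_of_set c))"
  have sec: "set (map fs (sorted_list_of_set c)) \<subseteq> sections G L"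
    using fin c(1) fs Cc_section by auto
  have hsec: "h \<in> sections G L" unfolding h_def by (rule secsum_section[OF sec])
  have "continuous_map (subtopology (garr G) W) (ltop L) h"
    unfolding h_def
  proof (rule secsum_continuous[OF W sec])
    fix f assume "f \<in> set (map fs (sorted_list_of_set c))"
    then obtain i where "i \<in> c" "f = fs i" using fin by auto
    moreover have "W \<subseteq> U i" using \<open>i \<in> c\<close> by (auto simp: W_def)
    ultimately show "continuous_map (subtopology (garr G) W) (ltop L) f"
      using c(1) continuous_map_from_subtopology_mono[OF Cc_continuous[OF fs]] by auto
  qed
  then have hcont: "continuous_map (subtopology (garr G) W) euclideanreal (\<lambda>\<gamma>. lmod L (h \<gamma>))"
    using continuous_map_compose[OF _ mod_continuous] by (auto simp: o_def)
  define N where "N = {\<gamma> \<in> topspace (subtopology (garr G) W). lmod L (h \<gamma>) \<in> {..<lmod L (h \<gamma>\<^sub>0) + e}}"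
  have "openin (subtopology (garr G) W) N"
    unfolding N_def by (rule openin_continuous_map_preimage[OF hcont]) simp
  then have "openin (garr G) N"
    by (rule openin_trans_full[OF _ bisection_open[OF W]])
  moreover have NW: "N \<subseteq> W" by (auto simp: N_def)
  ultimately have N: "N \<in> bisections G" by (rule bisection_subset[OF W])
  have W0: "\<gamma>\<^sub>0 \<in> W" using g by (auto simp: W_def)
  then have N0: "\<gamma>\<^sub>0 \<in> N" using bisection_arrows[OF W] e by (auto simp: N_def)
  have val: "cmod (\<Sum>i\<in>c. val s i (s \<gamma>)) = lmod L (h \<gamma>)" if "\<gamma> \<in> W" for \<gamma>
  proof -
    have \<gamma>: "\<gamma> \<in> arrows G" using that bisection_arrows[OF W] by blast
    have "(\<Sum>i\<in>c. val s i (s \<gamma>)) = (\<Sum>i\<in>c. coord \<gamma> (fs i \<gamma>))"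
      using that c(1) by (intro sum.cong) (auto simp: W_def val_leg[OF _ s])
    also have "\<dots> = coord \<gamma> (h \<gamma>)"
      unfolding h_def coord_secsum[OF sec \<gamma>] using fin
      by (simp add: o_def sum_list_distinct_conv_sum_set)
    finally show ?thesis using coord_norm[OF \<gamma> section_fibre[OF hsec \<gamma>]] by simp
  qed
  show thesis
  proof
    show "openin (unit_space G) (s ` N)" by (rule bisection_leg(2)[OF N s])
    show "s \<gamma>\<^sub>0 \<in> s ` N" using N0 by blast
    have "key s (s ` N) i = N" if "i \<in> c" for i
    proof -
      have i: "i < n" using that c(1) by auto
      have "N \<subseteq> U i" using NW that by (auto simp: W_def)
      then show ?thesis
        using bisection_leg(1)[OF U[OF i] s] by (auto simp: key_def inj_on_def)
    qed
    then show "key s (s ` N) i = key s (s ` N) j" if "i \<in> c" "j \<in> c" for i j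
      using that by simp
    fix x assume "x \<in> s ` N"
    then obtain \<gamma> where \<gamma>: "\<gamma> \<in> N" "x = s \<gamma>" by auto
    then have "lmod L (h \<gamma>) \<le> lmod L (h \<gamma>\<^sub>0) + e" by (auto simp: N_def)
    then show "cmod (\<Sum>i\<in>c. val s i x) \<le> cmod (\<Sum>i\<in>c. val s i (s \<gamma>\<^sub>0)) + e"
      using \<gamma> NW W0 val by auto
  qed
qed

text \<open>Near a unit \<open>x\<^sub>0\<close>, bisections through the same arrow over \<open>x\<^sub>0\<close> agree, and adding up the
  sections with the same bisection leaves, at \<open>x\<^sub>0\<close>, one term for each arrow over \<open>x\<^sub>0\<close>. By continuity
  the sum of the moduli of these terms is almost as small on a neighbourhood.\<close>

lemma local_estimate:
  assumes s: "s \<in> legs" and x0: "x\<^sub>0 \<in> gunits G" and e: "0 < e"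
    and M: "\<And>S. finite S \<Longrightarrow> S \<subseteq> {\<gamma> \<in> arrows G. s \<gamma> = x\<^sub>0} \<Longrightarrow> (\<Sum>\<gamma>\<in>S. cmod (\<Sum>i<n. coord \<gamma> (fs i \<gamma>))) \<le> M"
  obtains V where "openin (unit_space G) V" "x\<^sub>0 \<in> V"
    "\<And>x. x \<in> V \<Longrightarrow> class_sum {..<n} (key s V) (\<lambda>i. val s i x) \<le> M + e"
proof -
  \<comment> \<open>the arrow over \<open>x\<^sub>0\<close>, or an own class for each bisection that has none\<close>
  define key0 :: "nat \<Rightarrow> 'g + nat" where
    "key0 i = (if x\<^sub>0 \<in> s ` U i then Inl (inv_into (U i) s x\<^sub>0) else Inr i)" for i
  define cls where "cls v = {i \<in> {..<n}. key0 i = v}" for v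
  have "\<exists>V. openin (unit_space G) V \<and> x\<^sub>0 \<in> V \<and> (\<forall>j\<in>cls (key0 i). key s V j = key s V i) \<and>
      (\<forall>x\<in>V. cmod (\<Sum>j\<in>cls (key0 i). val s j x) \<le> cmod (\<Sum>j\<in>cls (key0 i). val s j x\<^sub>0) + e / n)"
    if i: "i < n" for i
  proof (cases "x\<^sub>0 \<in> s ` U i")
    case True
    let ?\<gamma> = "inv_into (U i) s x\<^sub>0"
    have s\<gamma>: "s ?\<gamma> = x\<^sub>0" using True by (rule f_inv_into_f)
    have k: "key0 i = Inl ?\<gamma>" using True by (simp add: key0_def)
    have mem: "?\<gamma> \<in> U j" if "j \<in> cls (key0 i)" for j
      using that True inv_into_into[of x\<^sub>0 s "U j"] by (auto simp: cls_def key0_def split: if_splits)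
    have en: "0 < e / n" using e i by simp
    have "cls (key0 i) \<subseteq> {..<n}" "cls (key0 i) \<noteq> {}" "i \<in> cls (key0 i)"
      using i by (auto simp: cls_def)
    then show ?thesis
      using local_class_estimate[OF s _ _ mem en, of "cls (key0 i)"] unfolding s\<gamma> by metis
  next
    case False
    then have cls: "cls (key0 i) = {i}"
      using i by (auto simp: cls_def key0_def split: if_splits)
    obtain K where K: "compactin (garr G) K" "K \<subseteq> U i" "\<And>\<gamma>. \<gamma> \<in> arrows G \<Longrightarrow> \<gamma> \<notin> K \<Longrightarrow> fs i \<gamma> = \<zero>\<^bsub>lfib L \<gamma>\<^esub>"
      using CcE[OF U[OF i] fs[OF i]] by blast
    define V where "V = topspace (unit_space G) - s ` K"
    have "closedin (unit_space G) (s ` K)"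
      by (rule compactin_imp_closedin[OF Hausdorff_units image_compactin[OF K(1) leg_continuous[OF s]]])
    then have "openin (unit_space G) V"
      unfolding V_def by (rule openin_diff[OF openin_topspace])
    moreover have "x\<^sub>0 \<in> V" using x0 False K(2) by (auto simp: V_def)
    moreover have "val s i x = 0" if "x \<in> V" for x
    proof (cases "x \<in> s ` U i")
      case True
      then obtain \<gamma> where \<gamma>: "\<gamma> \<in> U i" "x = s \<gamma>" by auto
      then have "\<gamma> \<notin> K" "\<gamma> \<in> arrows G" using that bisection_arrows[OF U[OF i]] by (auto simp: V_def)
      then show ?thesis using \<gamma> K(3) by (simp add: val_leg[OF i s] coord_zero)
    qed (simp add: val_def)
    ultimately show ?thesis
      using e unfolding cls by (intro exI[of _ V]) auto
  qed
  then obtain V where V: "\<And>i. i < n \<Longrightarrow> openin (unit_space G) (V i)" "\<And>i. i < n \<Longrightarrow> x\<^sub>0 \<in> V i"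
    "\<And>i j. i < n \<Longrightarrow> j \<in> cls (key0 i) \<Longrightarrow> key s (V i) j = key s (V i) i"
    "\<And>i x. i < n \<Longrightarrow> x \<in> V i \<Longrightarrow>
        cmod (\<Sum>j\<in>cls (key0 i). val s j x) \<le> cmod (\<Sum>j\<in>cls (key0 i). val s j x\<^sub>0) + e / n"
    by metis
  define V' where "V' = topspace (unit_space G) \<inter> (\<Inter>i\<in>{..<n}. V i)"
  have key_V': "key s V' i = key s V' j" if "i < n" "j < n" "key0 i = key0 j" for i j
  proof -
    have "V' \<subseteq> V i" using that by (auto simp: V'_def)
    moreover have "key s (V i) j = key s (V i) i"
      using that by (intro V(3)) (simp_all add: cls_def)
    ultimately show ?thesis by (auto simp: key_def)
  qed
  have zero_class: "(\<Sum>i\<in>cls (Inr j). val s i x\<^sub>0) = 0" for j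
    by (intro sum.neutral) (auto simp: cls_def key0_def val_def split: if_splits)
  have arrow_class: "(\<Sum>i\<in>cls (Inl \<gamma>). val s i x\<^sub>0) = (\<Sum>i<n. coord \<gamma> (fs i \<gamma>))"
    if "\<gamma> \<in> arrows G" "s \<gamma> = x\<^sub>0" for \<gamma>
  proof -
    have "(\<Sum>i<n. coord \<gamma> (fs i \<gamma>)) = (\<Sum>i\<in>cls (Inl \<gamma>). coord \<gamma> (fs i \<gamma>))"
    proof (rule sum.mono_neutral_right)
      show "\<forall>i\<in>{..<n} - cls (Inl \<gamma>). coord \<gamma> (fs i \<gamma>) = 0"
      proof
        fix i assume i: "i \<in> {..<n} - cls (Inl \<gamma>)"
        then have "\<gamma> \<notin> U i"
          using that(2) bisection_leg(1)[OF U s, of i] by (auto simp: cls_def key0_def)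
        then show "coord \<gamma> (fs i \<gamma>) = 0"
          using i that(1) Cc_zero_off[OF fs] by (simp add: coord_zero)
      qed
    qed (auto simp: cls_def)
    also have "\<dots> = (\<Sum>i\<in>cls (Inl \<gamma>). val s i x\<^sub>0)"
      by (intro sum.cong) (auto simp: cls_def key0_def val_def split: if_splits)
    finally show ?thesis by simp
  qed
  have at_x0: "class_sum {..<n} key0 (\<lambda>i. val s i x\<^sub>0) \<le> M"
  proof -
    define S where "S = {\<gamma>. Inl \<gamma> \<in> key0 ` {..<n}}"
    have S: "S \<subseteq> {\<gamma> \<in> arrows G. s \<gamma> = x\<^sub>0}"
    proof
      fix \<gamma> assume "\<gamma> \<in> S"
      then obtain i where "i < n" "key0 i = Inl \<gamma>" by (auto simp: S_def)
      then have "x\<^sub>0 \<in> s ` U i" "\<gamma> = inv_into (U i) s x\<^sub>0"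
        by (auto simp: key0_def split: if_splits)
      then have "\<gamma> \<in> U i" "s \<gamma> = x\<^sub>0"
        using inv_into_into f_inv_into_f by metis+
      then show "\<gamma> \<in> {\<gamma> \<in> arrows G. s \<gamma> = x\<^sub>0}"
        using bisection_arrows[OF U[OF \<open>i < n\<close>]] by auto
    qed
    have "finite (Inl ` S :: ('g + nat) set)"
      by (rule finite_subset[of _ "key0 ` {..<n}"]) (auto simp: S_def)
    then have finS: "finite S" by (rule finite_imageD) simp
    have "class_sum {..<n} key0 (\<lambda>i. val s i x\<^sub>0) = (\<Sum>v\<in>key0 ` {..<n}. cmod (\<Sum>i\<in>cls v. val s i x\<^sub>0))"
      by (simp add: class_sum_def cls_def)
    also have "\<dots> = (\<Sum>v\<in>Inl ` S. cmod (\<Sum>i\<in>cls v. val s i x\<^sub>0))"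
    proof (rule sum.mono_neutral_right)
      show "\<forall>v\<in>key0 ` {..<n} - Inl ` S. cmod (\<Sum>i\<in>cls v. val s i x\<^sub>0) = 0"
      proof
        fix v assume v: "v \<in> key0 ` {..<n} - Inl ` S"
        then obtain j where "v = Inr j" by (cases v) (auto simp: S_def)
        then show "cmod (\<Sum>i\<in>cls v. val s i x\<^sub>0) = 0" by (simp add: zero_class)
      qed
    qed (auto simp: S_def)
    also have "\<dots> = (\<Sum>\<gamma>\<in>S. cmod (\<Sum>i\<in>cls (Inl \<gamma>). val s i x\<^sub>0))"
      by (subst sum.reindex) (auto simp: o_def)
    also have "\<dots> = (\<Sum>\<gamma>\<in>S. cmod (\<Sum>i<n. coord \<gamma> (fs i \<gamma>)))"
      using S by (intro sum.cong arg_cong[where f = cmod] arrow_class) auto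
    also have "\<dots> \<le> M" by (rule M[OF finS S])
    finally show ?thesis .
  qed
  show thesis
  proof
    show "openin (unit_space G) V'"
    proof (cases "n = 0")
      case False
      then show ?thesis
        unfolding V'_def using V(1) by (intro openin_Int openin_topspace openin_INT2) auto
    qed (use openin_topspace[of "unit_space G", unfolded topspace_unit_space] in \<open>simp add: V'_def\<close>)
    show "x\<^sub>0 \<in> V'" using V(2) x0 by (auto simp: V'_def)
    fix x assume x: "x \<in> V'"
    have "class_sum {..<n} (key s V') (\<lambda>i. val s i x) \<le> class_sum {..<n} key0 (\<lambda>i. val s i x)"
      by (rule class_sum_coarser[OF finite_lessThan]) (rule key_V', simp_all)
    also have "\<dots> \<le> (\<Sum>v\<in>key0 ` {..<n}. cmod (\<Sum>i\<in>cls v. val s i x\<^sub>0) + e / n)"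
      unfolding class_sum_def cls_def[symmetric]
    proof (rule sum_mono)
      fix v assume "v \<in> key0 ` {..<n}"
      then obtain i where "i < n" "v = key0 i" by auto
      then show "cmod (\<Sum>i\<in>cls v. val s i x) \<le> cmod (\<Sum>i\<in>cls v. val s i x\<^sub>0) + e / n"
        using V(4)[of i x] x by (auto simp: V'_def)
    qed
    also have "\<dots> = class_sum {..<n} key0 (\<lambda>i. val s i x\<^sub>0) + real (card (key0 ` {..<n})) * (e / n)"
      by (simp add: sum.distrib class_sum_def cls_def)
    also have "real (card (key0 ` {..<n})) * (e / n) \<le> e"
    proof (cases "n = 0")
      case False
      have "real (card (key0 ` {..<n})) \<le> real n"
        using card_image_le[of "{..<n}" key0] by simp
      then have "real (card (key0 ` {..<n})) * (e / n) \<le> real n * (e / n)"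
        using e by (intro mult_right_mono) auto
      then show ?thesis using False by simp
    qed (use e in simp)
    finally show "class_sum {..<n} (key s V') (\<lambda>i. val s i x) \<le> M + e"
      using at_x0 by simp
  qed
qed

lemma local_estimate_both_legs:
  assumes x0: "x\<^sub>0 \<in> gunits G" and e: "0 < e"
    and M: "\<And>s x S. s \<in> legs \<Longrightarrow> x \<in> gunits G \<Longrightarrow> finite S \<Longrightarrow> S \<subseteq> {\<gamma> \<in> arrows G. s \<gamma> = x} \<Longrightarrow>
      (\<Sum>\<gamma>\<in>S. cmod (\<Sum>i<n. coord \<gamma> (fs i \<gamma>))) \<le> M s"
  shows "\<exists>V. openin (unit_space G) V \<and> x\<^sub>0 \<in> V \<and>
    (\<forall>s\<in>legs. \<forall>x\<in>V. class_sum {..<n} (key s V) (\<lambda>i. val s i x) \<le> M s + e)"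
proof -
  obtain V1 where V1: "openin (unit_space G) V1" "x\<^sub>0 \<in> V1"
    "\<And>x. x \<in> V1 \<Longrightarrow> class_sum {..<n} (key (gran G) V1) (\<lambda>i. val (gran G) i x) \<le> M (gran G) + e"
    by (rule local_estimate[of "gran G" x\<^sub>0 e "M (gran G)"]) (use x0 e M in auto)
  obtain V2 where V2: "openin (unit_space G) V2" "x\<^sub>0 \<in> V2"
    "\<And>x. x \<in> V2 \<Longrightarrow> class_sum {..<n} (key (gdom G) V2) (\<lambda>i. val (gdom G) i x) \<le> M (gdom G) + e"
    by (rule local_estimate[of "gdom G" x\<^sub>0 e "M (gdom G)"]) (use x0 e M in auto)
  have mono: "class_sum {..<n} (key s V) a \<le> class_sum {..<n} (key s V') a" if "V \<subseteq> V'" for s V V' and a :: "nat \<Rightarrow> complex"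
    by (rule class_sum_coarser) (use that in \<open>auto simp: key_def\<close>)
  have "class_sum {..<n} (key (gran G) (V1 \<inter> V2)) (\<lambda>i. val (gran G) i x) \<le> M (gran G) + e"
    "class_sum {..<n} (key (gdom G) (V1 \<inter> V2)) (\<lambda>i. val (gdom G) i x) \<le> M (gdom G) + e"
    if "x \<in> V1 \<inter> V2" for x
    using that V1(3)[of x] V2(3)[of x] mono[of "V1 \<inter> V2" V1 "gran G"] mono[of "V1 \<inter> V2" V2 "gdom G"]
    by (auto intro: order_trans)
  then show ?thesis
    using V1 V2 by (intro exI[of _ "V1 \<inter> V2"]) auto
qed

definition rect :: "('g \<Rightarrow> 'g) \<Rightarrow> ('g \<Rightarrow> 'g) \<Rightarrow> 'g set \<Rightarrow> 'g set \<Rightarrow> 'g set" where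
  "rect s t A B = {\<gamma> \<in> arrows G. s \<gamma> \<in> A \<and> t \<gamma> \<in> B}"

text \<open>The piece for a subset \<open>W\<close> of the rectangle \<open>R\<close>: the sections whose bisections meet \<open>R\<close> exactly
  in \<open>W\<close>, added up and cut off by \<open>w\<close>.\<close>

definition piece :: "('g \<Rightarrow> real) \<Rightarrow> 'g set \<Rightarrow> 'g set \<Rightarrow> 'g \<Rightarrow> 'l" where
  "piece w R W = secsum (map (\<lambda>i. cut w (fs i)) (filter (\<lambda>i. U i \<inter> R = W) [0..<n]))"

lemma coord_piece:
  assumes "\<gamma> \<in> arrows G"
  shows "coord \<gamma> (piece w R W \<gamma>) = (\<Sum>i\<in>{i \<in> {..<n}. U i \<inter> R = W}. complex_of_real (w \<gamma>) * coord \<gamma> (fs i \<gamma>))"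
proof -
  have sec: "set (map (\<lambda>i. cut w (fs i)) (filter (\<lambda>i. U i \<inter> R = W) [0..<n])) \<subseteq> sections G L"
    using cut_section[OF Cc_section[OF fs]] by auto
  have "coord \<gamma> (piece w R W \<gamma>) = (\<Sum>i\<leftarrow>filter (\<lambda>i. U i \<inter> R = W) [0..<n]. coord \<gamma> (cut w (fs i) \<gamma>))"
    unfolding piece_def coord_secsum[OF sec assms] by (simp add: o_def)
  also have "\<dots> = (\<Sum>i\<in>{i \<in> {..<n}. U i \<inter> R = W}. coord \<gamma> (cut w (fs i) \<gamma>))"
    by (subst sum_list_distinct_conv_sum_set) (auto intro!: sum.cong)
  also have "\<dots> = (\<Sum>i\<in>{i \<in> {..<n}. U i \<inter> R = W}. complex_of_real (w \<gamma>) * coord \<gamma> (fs i \<gamma>))"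
    using coord_cut[OF Cc_section[OF fs] assms] by (intro sum.cong) auto
  finally show ?thesis .
qed

text \<open>On a rectangle over \<open>A \<times> B\<close>, two bisections that agree over \<open>A\<close> agree. Hence the pieces add up
  sections over coarser classes than those of the local estimate over \<open>A\<close>, and the weights
  \<open>\<rho> b\<close> evaluated at the other leg add up to at most one.\<close>

lemma rectangle_estimate:
  assumes s: "s \<in> legs" and t: "t \<in> legs" and x: "x \<in> gunits G" and B: "0 \<le> B"
    and op: "\<And>j. j < m \<Longrightarrow> openin (unit_space G) (A j)"
    and \<rho>0: "\<And>j y. j < m \<Longrightarrow> 0 \<le> \<rho> j y" and \<rho>1: "\<And>y. (\<Sum>j<m. \<rho> j y) \<le> 1"
    and off: "\<And>j. j < m \<Longrightarrow> x \<notin> A j \<Longrightarrow> \<rho> j x = 0"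
    and est: "\<And>j. j < m \<Longrightarrow> x \<in> A j \<Longrightarrow> class_sum {..<n} (key s (A j)) (\<lambda>i. val s i x) \<le> B"
  shows "(\<Sum>a<m. \<Sum>b<m. \<Sum>W\<in>(\<lambda>i. U i \<inter> rect s t (A a) (A b)) ` {..<n}.
      push s W (\<lambda>\<gamma>. lmod L (piece (\<lambda>\<gamma>. \<rho> a (s \<gamma>) * \<rho> b (t \<gamma>)) (rect s t (A a) (A b)) W \<gamma>)) x) \<le> B"
proof -
  let ?R = "\<lambda>a b. rect s t (A a) (A b)"
  let ?P = "\<lambda>a b W. push s W (\<lambda>\<gamma>. lmod L (piece (\<lambda>\<gamma>. \<rho> a (s \<gamma>) * \<rho> b (t \<gamma>)) (?R a b) W \<gamma>)) x"
  have W_bis: "U i \<inter> ?R a b \<in> bisections G" if "i < n" "a < m" "b < m" for i a b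
  proof -
    have "openin (garr G) {\<gamma> \<in> arrows G. r \<gamma> \<in> A j}" if "r \<in> legs" "j < m" for r j
      using openin_continuous_map_preimage[OF leg_continuous[OF that(1)] op[OF that(2)]] .
    then have "openin (garr G) ({\<gamma> \<in> arrows G. s \<gamma> \<in> A a} \<inter> {\<gamma> \<in> arrows G. t \<gamma> \<in> A b})"
      using that s t by (intro openin_Int) blast+
    also have "{\<gamma> \<in> arrows G. s \<gamma> \<in> A a} \<inter> {\<gamma> \<in> arrows G. t \<gamma> \<in> A b} = ?R a b"
      by (auto simp: rect_def)
    finally show ?thesis
      using that(1) by (intro bisection_subset[OF U[OF that(1)]] openin_Int bisection_open[OF U]) auto
  qed
  have row: "(\<Sum>b<m. \<Sum>W\<in>(\<lambda>i. U i \<inter> ?R a b) ` {..<n}. ?P a b W) \<le> \<rho> a x * B" if a: "a < m" for a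
  proof (cases "x \<in> A a")
    case False
    have "x \<notin> s ` (U i \<inter> ?R a b)" for i b
      using False by (auto simp: rect_def)
    then have "(\<Sum>b<m. \<Sum>W\<in>(\<lambda>i. U i \<inter> ?R a b) ` {..<n}. ?P a b W) = 0"
      by (intro sum.neutral ballI) (auto simp: push_def)
    then show ?thesis using off[OF a False] by simp
  next
    case True
    let ?k = "key s (A a)"
    \<comment> \<open>the other leg of the arrow over \<open>x\<close>, which all bisections with key \<open>v\<close> share\<close>
    define \<tau> where "\<tau> v = t (SOME \<gamma>. \<gamma> \<in> v \<and> s \<gamma> = x)" for v
    define N where "N v = cmod (\<Sum>i\<in>{i \<in> {..<n}. ?k i = v}. val s i x)" for v
    define \<beta> where "\<beta> b i = complex_of_real (\<rho> a x * \<rho> b (\<tau> (?k i))) * val s i x" for b i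
    have \<tau>: "\<tau> (?k i) = t \<gamma>" if "i < n" "\<gamma> \<in> U i" "s \<gamma> = x" for i \<gamma>
    proof -
      have "\<gamma> \<in> ?k i \<and> s \<gamma> = x" using that True by (simp add: key_def)
      moreover have "\<gamma>' = \<gamma>" if "\<gamma>' \<in> ?k i \<and> s \<gamma>' = x" for \<gamma>'
        using that \<open>i < n\<close> \<open>\<gamma> \<in> U i\<close> \<open>s \<gamma> = x\<close> bisection_leg(1)[OF U[OF \<open>i < n\<close>] s]
        by (auto simp: key_def inj_on_def)
      ultimately have "(SOME \<gamma>. \<gamma> \<in> ?k i \<and> s \<gamma> = x) = \<gamma>"
        by (rule some_equality)
      then show ?thesis by (simp add: \<tau>_def)
    qed
    have col: "(\<Sum>W\<in>(\<lambda>i. U i \<inter> ?R a b) ` {..<n}. ?P a b W) \<le> (\<Sum>v\<in>?k ` {..<n}. \<rho> a x * \<rho> b (\<tau> v) * N v)"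
      if b: "b < m" for b
    proof -
      have "?P a b W \<le> cmod (\<Sum>i\<in>{i \<in> {..<n}. U i \<inter> ?R a b = W}. \<beta> b i)"
        if W: "W \<in> (\<lambda>i. U i \<inter> ?R a b) ` {..<n}" for W
      proof (cases "x \<in> s ` W")
        case True
        then obtain \<gamma> where \<gamma>: "\<gamma> \<in> W" "x = s \<gamma>" by auto
        from W obtain i\<^sub>0 where i0: "i\<^sub>0 < n" "W = U i\<^sub>0 \<inter> ?R a b" by auto
        have Wb: "W \<in> bisections G" unfolding i0(2) by (rule W_bis[OF i0(1) a b])
        have arr: "\<gamma> \<in> arrows G" using \<gamma> bisection_arrows[OF Wb] by blast
        let ?piece = "piece (\<lambda>\<gamma>. \<rho> a (s \<gamma>) * \<rho> b (t \<gamma>)) (?R a b) W"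
        have "?piece \<in> sections G L"
          unfolding piece_def using cut_section[OF Cc_section[OF fs]] by (intro secsum_section) auto
        then have "?P a b W = cmod (coord \<gamma> (?piece \<gamma>))"
          using push_leg[OF Wb s \<gamma>(1)] \<gamma>(2) coord_norm[OF arr section_fibre[OF _ arr]] by simp
        also have "coord \<gamma> (?piece \<gamma>) = (\<Sum>i\<in>{i \<in> {..<n}. U i \<inter> ?R a b = W}. \<beta> b i)"
          unfolding coord_piece[OF arr]
        proof (rule sum.cong)
          fix i assume i: "i \<in> {i \<in> {..<n}. U i \<inter> ?R a b = W}"
          then have "\<gamma> \<in> U i" "i < n" using \<gamma>(1) by auto
          then show "complex_of_real (\<rho> a (s \<gamma>) * \<rho> b (t \<gamma>)) * coord \<gamma> (fs i \<gamma>) = \<beta> b i"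
            using \<gamma>(2) \<tau>[of i \<gamma>] val_leg[OF _ s, of i \<gamma>] by (simp add: \<beta>_def)
        qed simp
        finally show ?thesis by simp
      qed (simp add: push_def)
      then have "(\<Sum>W\<in>(\<lambda>i. U i \<inter> ?R a b) ` {..<n}. ?P a b W) \<le> class_sum {..<n} (\<lambda>i. U i \<inter> ?R a b) (\<beta> b)"
        unfolding class_sum_def by (rule sum_mono)
      also have "\<dots> \<le> class_sum {..<n} ?k (\<beta> b)"
      proof (rule class_sum_coarser)
        fix i j assume "i \<in> {..<n}" "j \<in> {..<n}" "?k i = ?k j"
        then show "U i \<inter> ?R a b = U j \<inter> ?R a b"
          unfolding key_def rect_def by blast
      qed simp
      also have "\<dots> = (\<Sum>v\<in>?k ` {..<n}. \<rho> a x * \<rho> b (\<tau> v) * N v)"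
        unfolding class_sum_def
      proof (rule sum.cong)
        fix v
        have "(\<Sum>i\<in>{i \<in> {..<n}. ?k i = v}. \<beta> b i) =
            complex_of_real (\<rho> a x * \<rho> b (\<tau> v)) * (\<Sum>i\<in>{i \<in> {..<n}. ?k i = v}. val s i x)"
          unfolding sum_distrib_left by (rule sum.cong) (auto simp: \<beta>_def)
        then show "cmod (\<Sum>i\<in>{i \<in> {..<n}. ?k i = v}. \<beta> b i) = \<rho> a x * \<rho> b (\<tau> v) * N v"
          using \<rho>0[OF a] \<rho>0[OF b] by (simp add: norm_mult N_def)
      qed simp
      finally show ?thesis .
    qed
    have "(\<Sum>b<m. \<Sum>W\<in>(\<lambda>i. U i \<inter> ?R a b) ` {..<n}. ?P a b W)
        \<le> (\<Sum>b<m. \<Sum>v\<in>?k ` {..<n}. \<rho> a x * \<rho> b (\<tau> v) * N v)"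
      by (rule sum_mono) (use col in simp)
    also have "\<dots> = (\<Sum>v\<in>?k ` {..<n}. \<Sum>b<m. \<rho> a x * \<rho> b (\<tau> v) * N v)"
      by (rule sum.swap)
    also have "\<dots> \<le> (\<Sum>v\<in>?k ` {..<n}. \<rho> a x * N v)"
    proof (rule sum_mono)
      fix v
      have "(\<Sum>b<m. \<rho> a x * \<rho> b (\<tau> v) * N v) = (\<rho> a x * N v) * (\<Sum>b<m. \<rho> b (\<tau> v))"
        by (simp add: sum_distrib_left mult_ac)
      also have "\<dots> \<le> (\<rho> a x * N v) * 1"
        by (rule mult_left_mono[OF \<rho>1]) (simp add: \<rho>0[OF a] N_def)
      finally show "(\<Sum>b<m. \<rho> a x * \<rho> b (\<tau> v) * N v) \<le> \<rho> a x * N v" by simp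
    qed
    also have "\<dots> = \<rho> a x * class_sum {..<n} ?k (\<lambda>i. val s i x)"
      by (simp add: class_sum_def N_def sum_distrib_left)
    also have "\<dots> \<le> \<rho> a x * B"
      by (rule mult_left_mono[OF est[OF a True] \<rho>0[OF a]])
    finally show ?thesis .
  qed
  have "(\<Sum>a<m. \<Sum>b<m. \<Sum>W\<in>(\<lambda>i. U i \<inter> ?R a b) ` {..<n}. ?P a b W) \<le> (\<Sum>a<m. \<rho> a x * B)"
    by (rule sum_mono) (use row in simp)
  also have "\<dots> = (\<Sum>a<m. \<rho> a x) * B" by (simp add: sum_distrib_right)
  also have "\<dots> \<le> 1 * B" by (rule mult_right_mono[OF \<rho>1 B])
  finally show ?thesis by simp
qed

text \<open>In a non-Hausdorff groupoid the summands of a section may cancel, so that the fibre sums of their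
  moduli exceed those of the section. Take a partition of unity on the unit space that is fine enough
  for the local estimates, for both legs at once, and cut the sections into pieces over rectangles.
  In each rectangle the sections with the same bisection are added up. A rectangle has one side
  for each leg, so a single splitting satisfies both bounds.\<close>

lemma splitting_exists:
  assumes e: "0 < e"
    and M: "\<And>s x S. s \<in> legs \<Longrightarrow> x \<in> gunits G \<Longrightarrow> finite S \<Longrightarrow> S \<subseteq> {\<gamma> \<in> arrows G. s \<gamma> = x} \<Longrightarrow>
      (\<Sum>\<gamma>\<in>S. cmod (\<Sum>i<n. coord \<gamma> (fs i \<gamma>))) \<le> M s"
  obtains Q :: "(nat \<times> nat \<times> 'g set) set" and W h where "finite Q"
    and "\<And>q. q \<in> Q \<Longrightarrow> W q \<in> bisections G" and "\<And>q. q \<in> Q \<Longrightarrow> h q \<in> Cc G L (W q)"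
    and "\<And>\<gamma>. \<gamma> \<in> arrows G \<Longrightarrow> (\<Sum>q\<in>Q. coord \<gamma> (h q \<gamma>)) = (\<Sum>i<n. coord \<gamma> (fs i \<gamma>))"
    and "\<And>s x. s \<in> legs \<Longrightarrow> x \<in> gunits G \<Longrightarrow> (\<Sum>q\<in>Q. push s (W q) (\<lambda>\<gamma>. lmod L (h q \<gamma>)) x) \<le> M s + e"
proof -
  have "\<forall>x\<in>gunits G. \<exists>V. openin (unit_space G) V \<and> x \<in> V \<and>
      (\<forall>s\<in>legs. \<forall>y\<in>V. class_sum {..<n} (key s V) (\<lambda>i. val s i y) \<le> M s + e)"
    by (intro ballI local_estimate_both_legs e M)
  from bchoice[OF this] obtain V where V: "\<forall>x\<in>gunits G. openin (unit_space G) (V x) \<and> x \<in> V x \<and>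
      (\<forall>s\<in>legs. \<forall>y\<in>V x. class_sum {..<n} (key s (V x)) (\<lambda>i. val s i y) \<le> M s + e)"
    by (elim exE)
  have "\<forall>i\<in>{..<n}. \<exists>K. compactin (garr G) K \<and> K \<subseteq> U i \<and> (\<forall>\<gamma>\<in>arrows G - K. fs i \<gamma> = \<zero>\<^bsub>lfib L \<gamma>\<^esub>)"
    using fs Cc_iff[OF U] by simp
  from bchoice[OF this] obtain K where K: "\<forall>i\<in>{..<n}. compactin (garr G) (K i) \<and> K i \<subseteq> U i \<and>
      (\<forall>\<gamma>\<in>arrows G - K i. fs i \<gamma> = \<zero>\<^bsub>lfib L \<gamma>\<^esub>)"
    by (elim exE)
  define KX where "KX = \<Union>((\<lambda>(s, i). s ` K i) ` (legs \<times> {..<n}))"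
  have KX: "compactin (unit_space G) KX"
    unfolding KX_def
  proof (rule compactin_Union)
    fix S assume "S \<in> (\<lambda>(s, i). s ` K i) ` (legs \<times> {..<n})"
    then obtain s i where "s \<in> legs" "i < n" "S = s ` K i" by auto
    then show "compactin (unit_space G) S"
      using K image_compactin[OF _ leg_continuous] by blast
  qed simp
  show thesis
  proof (rule partition_of_unity[of KX V])
    show "compactin (unit_space G) KX" by (rule KX)
    show "openin (unit_space G) (V x)" "x \<in> V x" if "x \<in> gunits G" for x
      using V that by simp_all
  next
    fix m :: nat and p :: "nat \<Rightarrow> 'g" and \<rho> :: "nat \<Rightarrow> 'g \<Rightarrow> real" and C :: "nat \<Rightarrow> 'g set"
    assume p: "\<And>j. j < m \<Longrightarrow> p j \<in> gunits G"
      and \<rho>c: "\<And>j. j < m \<Longrightarrow> continuous_map (unit_space G) euclideanreal (\<rho> j)"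
      and C: "\<And>j. j < m \<Longrightarrow> closedin (unit_space G) (C j)" "\<And>j. j < m \<Longrightarrow> C j \<subseteq> V (p j)"
      and \<rho>off: "\<And>j x. j < m \<Longrightarrow> x \<in> gunits G \<Longrightarrow> x \<notin> C j \<Longrightarrow> \<rho> j x = 0"
      and \<rho>0: "\<And>j x. j < m \<Longrightarrow> 0 \<le> \<rho> j x" and \<rho>1: "\<And>x. (\<Sum>j<m. \<rho> j x) \<le> 1"
      and \<rho>K: "\<And>x. x \<in> KX \<Longrightarrow> (\<Sum>j<m. \<rho> j x) = 1"
    define A where "A j = V (p j)" for j
    have A: "openin (unit_space G) (A j)" if "j < m" for j
      using V p[OF that] by (simp add: A_def)
    define R where "R a b = rect (gdom G) (gran G) (A a) (A b)" for a b
    define w where "w a b = (\<lambda>\<gamma>. \<rho> a (gdom G \<gamma>) * \<rho> b (gran G \<gamma>))" for a b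
    define keys where "keys a b = (\<lambda>i. U i \<inter> R a b) ` {..<n}" for a b
    define Q where "Q = (SIGMA a:{..<m}. SIGMA b:{..<m}. keys a b)"
    define W :: "nat \<times> nat \<times> 'g set \<Rightarrow> 'g set" where "W q = snd (snd q)" for q
    define h where "h q = piece (w (fst q) (fst (snd q))) (R (fst q) (fst (snd q))) (snd (snd q))" for q
    have finQ: "finite Q" by (simp add: Q_def keys_def)
    have sumQ: "(\<Sum>q\<in>Q. g q) = (\<Sum>a<m. \<Sum>b<m. \<Sum>W\<in>keys a b. g (a, b, W))" for g :: "_ \<Rightarrow> 'z :: comm_monoid_add"
      by (simp add: Q_def keys_def sum.Sigma split_def)
    have R: "openin (garr G) (R a b)" if "a < m" "b < m" for a b
    proof -
      have "openin (garr G) {\<gamma> \<in> arrows G. s \<gamma> \<in> A j}" if "s \<in> legs" "j < m" for s j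
        by (rule openin_continuous_map_preimage[OF leg_continuous[OF that(1)] A[OF that(2)]])
      then have "openin (garr G) ({\<gamma> \<in> arrows G. gdom G \<gamma> \<in> A a} \<inter> {\<gamma> \<in> arrows G. gran G \<gamma> \<in> A b})"
        using that by (intro openin_Int) auto
      also have "{\<gamma> \<in> arrows G. gdom G \<gamma> \<in> A a} \<inter> {\<gamma> \<in> arrows G. gran G \<gamma> \<in> A b} = R a b"
        by (auto simp: R_def rect_def)
      finally show ?thesis .
    qed
    have cut: "cut (w a b) (fs i) \<in> Cc G L (U i \<inter> R a b)" if ab: "a < m" "b < m" and i: "i < n" for a b i
    proof (rule cut_Cc[OF U[OF i] fs[OF i] R[OF ab]])
      let ?D = "{\<gamma> \<in> arrows G. gdom G \<gamma> \<in> C a} \<inter> {\<gamma> \<in> arrows G. gran G \<gamma> \<in> C b}"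
      have "closedin (garr G) {\<gamma> \<in> arrows G. s \<gamma> \<in> C j}" if "s \<in> legs" "j < m" for s j
        by (rule closedin_continuous_map_preimage[OF leg_continuous[OF that(1)] C(1)[OF that(2)]])
      then show "closedin (garr G) ?D"
        using ab by (intro closedin_Int) auto
      show "?D \<subseteq> R a b"
        using C(2)[OF ab(1)] C(2)[OF ab(2)] by (auto simp: R_def rect_def A_def)
      have "continuous_map (garr G) euclideanreal (\<rho> j \<circ> s)" if "s \<in> legs" "j < m" for s j
        by (rule continuous_map_compose[OF leg_continuous[OF that(1)] \<rho>c[OF that(2)]])
      then show "continuous_map (garr G) euclideanreal (w a b)"
        unfolding w_def using ab by (intro continuous_map_real_mult) (auto simp: o_def)
      show "w a b \<gamma> = 0" if "\<gamma> \<in> arrows G" "\<gamma> \<notin> ?D" for \<gamma>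
        using that \<rho>off[OF ab(1) dom_units] \<rho>off[OF ab(2) ran_units] by (auto simp: w_def)
    qed
    show thesis
    proof (rule that[OF finQ])
      fix q assume "q \<in> Q"
      then obtain a b i where q: "q = (a, b, U i \<inter> R a b)" and ab: "a < m" "b < m" and i: "i < n"
        by (auto simp: Q_def keys_def)
      have Wq: "W q = U i \<inter> R a b" by (simp add: W_def q)
      show bis: "W q \<in> bisections G"
        unfolding Wq by (intro bisection_subset[OF U[OF i]] openin_Int bisection_open[OF U[OF i]] R ab) auto
      show "h q \<in> Cc G L (W q)"
        unfolding h_def piece_def
      proof (rule Cc_secsum[OF bis])
        show "set (map (\<lambda>i. cut (w (fst q) (fst (snd q))) (fs i))
            (filter (\<lambda>i. U i \<inter> R (fst q) (fst (snd q)) = snd (snd q)) [0..<n])) \<subseteq> Cc G L (W q)"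
        proof
          fix f assume "f \<in> set (map (\<lambda>i. cut (w (fst q) (fst (snd q))) (fs i))
            (filter (\<lambda>i. U i \<inter> R (fst q) (fst (snd q)) = snd (snd q)) [0..<n]))"
          then obtain j where "j < n" "f = cut (w a b) (fs j)" "U j \<inter> R a b = W q"
            by (auto simp: q W_def)
          then show "f \<in> Cc G L (W q)" using cut[OF ab, of j] by simp
        qed
      qed
    next
      fix \<gamma> assume \<gamma>: "\<gamma> \<in> arrows G"
      let ?tot = "\<Sum>i<n. coord \<gamma> (fs i \<gamma>)"
      have weights: "(\<Sum>a<m. \<Sum>b<m. complex_of_real (w a b \<gamma>) * T) =
          complex_of_real ((\<Sum>a<m. \<rho> a (gdom G \<gamma>)) * (\<Sum>b<m. \<rho> b (gran G \<gamma>))) * T" for T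
        by (simp only: w_def sum_product, simp only: of_real_sum sum_distrib_right)
      have "(\<Sum>q\<in>Q. coord \<gamma> (h q \<gamma>)) = (\<Sum>a<m. \<Sum>b<m. complex_of_real (w a b \<gamma>) * ?tot)"
        unfolding sumQ
      proof (intro sum.cong refl)
        fix a b
        have "(\<Sum>W\<in>keys a b. coord \<gamma> (h (a, b, W) \<gamma>)) =
            (\<Sum>W\<in>keys a b. \<Sum>i\<in>{i \<in> {..<n}. U i \<inter> R a b = W}. complex_of_real (w a b \<gamma>) * coord \<gamma> (fs i \<gamma>))"
          by (simp add: h_def coord_piece[OF \<gamma>])
        also have "\<dots> = (\<Sum>i<n. complex_of_real (w a b \<gamma>) * coord \<gamma> (fs i \<gamma>))"
          unfolding keys_def by (rule sum.image_gen[symmetric]) simp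
        finally show "(\<Sum>W\<in>keys a b. coord \<gamma> (h (a, b, W) \<gamma>)) = complex_of_real (w a b \<gamma>) * ?tot"
          by (simp add: sum_distrib_left)
      qed
      also have "\<dots> = complex_of_real ((\<Sum>a<m. \<rho> a (gdom G \<gamma>)) * (\<Sum>b<m. \<rho> b (gran G \<gamma>))) * ?tot"
        by (rule weights)
      also have "\<dots> = ?tot"
      proof (cases "?tot = 0")
        case False
        then obtain i where i: "i < n" "coord \<gamma> (fs i \<gamma>) \<noteq> 0"
          by (metis (mono_tags, lifting) lessThan_iff sum.neutral)
        have "\<gamma> \<in> K i"
        proof (rule ccontr)
          assume "\<gamma> \<notin> K i"
          then have "fs i \<gamma> = \<zero>\<^bsub>lfib L \<gamma>\<^esub>" using K i(1) \<gamma> by simp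
          then show False using i(2) coord_zero[OF \<gamma>] by simp
        qed
        then have "gdom G \<gamma> \<in> KX" "gran G \<gamma> \<in> KX" using i(1) by (auto simp: KX_def)
        then show ?thesis by (simp add: \<rho>K)
      qed simp
      finally show "(\<Sum>q\<in>Q. coord \<gamma> (h q \<gamma>)) = ?tot" .
    next
      fix s x assume s: "s \<in> legs" and x: "x \<in> gunits G"
      have B: "0 \<le> M r + e" if "r \<in> legs" for r
        using M[OF that x, of "{}"] e by simp
      have est: "class_sum {..<n} (key r (A j)) (\<lambda>i. val r i x) \<le> M r + e" if "r \<in> legs" "j < m" "x \<in> A j" for r j
        using V p[OF that(2)] that by (auto simp: A_def)
      have off: "\<rho> j x = 0" if "j < m" "x \<notin> A j" for j
        using \<rho>off[OF that(1) x] C(2)[OF that(1)] that(2) by (auto simp: A_def)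
      have "(\<Sum>a<m. \<Sum>b<m. \<Sum>V\<in>keys a b. push s V (\<lambda>\<gamma>. lmod L (piece (w a b) (R a b) V \<gamma>)) x) \<le> M s + e"
      proof (cases "s = gdom G")
        case True
        show ?thesis
          unfolding True keys_def R_def w_def
          by (rule rectangle_estimate[where m = m and A = A and \<rho> = \<rho>, OF _ _ x B A \<rho>0 \<rho>1 off est]) auto
      next
        case False
        then have sr: "s = gran G" using s by auto
        have swap: "R a b = rect (gran G) (gdom G) (A b) (A a)" "w a b = (\<lambda>\<gamma>. \<rho> b (gran G \<gamma>) * \<rho> a (gdom G \<gamma>))" for a b
          by (auto simp: R_def rect_def w_def)
        show ?thesis
          unfolding sr keys_def swap
          by (subst sum.swap,
              rule rectangle_estimate[where m = m and A = A and \<rho> = \<rho>, OF _ _ x B A \<rho>0 \<rho>1 off est]) auto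
      qed
      then show "(\<Sum>q\<in>Q. push s (W q) (\<lambda>\<gamma>. lmod L (h q \<gamma>)) x) \<le> M s + e"
        by (simp add: sumQ W_def h_def)
    qed
  qed
qed

end

end

section \<open>The estimate for *-homomorphisms\<close>

context twisted_etale_groupoid
begin

lemma fn_cong: "(\<And>x. x \<in> gunits G \<Longrightarrow> g x = h x) \<Longrightarrow> fn g = fn h"
  by (auto simp: fn_def restrict_def)

lemma Cc_alg_section: "f \<in> Cc_alg F G L \<Longrightarrow> f \<in> sections G L"
  by (induction rule: Cc_alg.induct) (auto intro: sections_closed Cc_section)

text \<open>The norms \<open>norm_d\<close> and \<open>norm_r\<close> in one definition, so that each estimate is proved once.\<close>

definition norm_leg :: "('g \<Rightarrow> 'g) \<Rightarrow> ('g \<Rightarrow> 'l) \<Rightarrow> real" where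
  "norm_leg s f = enn2real (SUP x\<in>gunits G. \<Sum>\<^sub>\<infinity>\<gamma>\<in>{\<gamma> \<in> arrows G. s \<gamma> = x}. ennreal (lmod L (f \<gamma>)))"

lemma norm_leg_nonneg: "0 \<le> norm_leg s f"
  by (simp add: norm_leg_def)

lemma Cc_bounded:
  assumes U: "U \<in> bisections G" and f: "f \<in> Cc G L U"
  obtains c where "0 \<le> c" "\<And>\<gamma>. \<gamma> \<in> arrows G \<Longrightarrow> cmod (coord \<gamma> (f \<gamma>)) \<le> c"
proof -
  obtain K where K: "compactin (garr G) K" "K \<subseteq> U" "\<And>\<gamma>. \<gamma> \<in> arrows G \<Longrightarrow> \<gamma> \<notin> K \<Longrightarrow> f \<gamma> = \<zero>\<^bsub>lfib L \<gamma>\<^esub>"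
    using CcE[OF U f] by blast
  have "compactin (subtopology (garr G) U) K" using K by (simp add: compactin_subtopology)
  then have "compact ((\<lambda>\<gamma>. lmod L (f \<gamma>)) ` K)"
    using image_compactin[OF _ Cc_lmod_continuous[OF f]] by simp
  then have "bounded ((\<lambda>\<gamma>. lmod L (f \<gamma>)) ` K)" by (rule compact_imp_bounded)
  then obtain c where c: "\<And>\<gamma>. \<gamma> \<in> K \<Longrightarrow> \<bar>lmod L (f \<gamma>)\<bar> \<le> c"
    by (auto simp: bounded_iff)
  show thesis
  proof (rule that[of "max 0 c"])
    fix \<gamma> assume \<gamma>: "\<gamma> \<in> arrows G"
    have "cmod (coord \<gamma> (f \<gamma>)) = lmod L (f \<gamma>)"
      by (rule coord_norm[OF \<gamma> section_fibre[OF Cc_section[OF f] \<gamma>]])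
    also have "\<dots> \<le> max 0 c"
    proof (cases "\<gamma> \<in> K")
      case True
      then show ?thesis using c[of \<gamma>] by auto
    next
      case False
      then show ?thesis using K(3)[OF \<gamma>] lmod_zero[OF \<gamma>] by simp
    qed
    finally show "cmod (coord \<gamma> (f \<gamma>)) \<le> max 0 c" .
  qed simp
qed

text \<open>Finiteness of the two norms, in terms of finite partial sums.\<close>

definition fibre_bound :: "('g \<Rightarrow> 'l) \<Rightarrow> real \<Rightarrow> bool" where
  "fibre_bound f c \<longleftrightarrow> 0 \<le> c \<and> (\<forall>s\<in>legs. \<forall>x S. finite S \<longrightarrow> S \<subseteq> {\<gamma> \<in> arrows G. s \<gamma> = x} \<longrightarrow>
    (\<Sum>\<gamma>\<in>S. cmod (coord \<gamma> (f \<gamma>))) \<le> c)"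

lemma fibre_boundD:
  assumes "fibre_bound f c"
  shows "0 \<le> c" and "s \<in> legs \<Longrightarrow> finite S \<Longrightarrow> S \<subseteq> {\<gamma> \<in> arrows G. s \<gamma> = x} \<Longrightarrow> (\<Sum>\<gamma>\<in>S. cmod (coord \<gamma> (f \<gamma>))) \<le> c"
  using assms unfolding fibre_bound_def by (simp, blast)

text \<open>A bisection contains at most one arrow over each unit, so that the fibre sums of a sum of
  sections supported in bisections are bounded by the sum of their suprema.\<close>

lemma fibre_sums_bounded:
  assumes f: "f \<in> Cc_alg F G L"
  shows "\<exists>c. fibre_bound f c"
  using f
proof induction
  case zero
  show ?case
  proof (unfold fibre_bound_def, intro exI[of _ 0] conjI ballI allI impI)
    fix s x S assume "S \<subseteq> {\<gamma> \<in> arrows G. s \<gamma> = x}"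
    then show "(\<Sum>\<gamma>\<in>S. cmod (coord \<gamma> (sec_zero G L \<gamma>))) \<le> 0"
      by (intro sum_nonpos) (auto simp: sec_zero_def coord_zero subset_iff)
  qed simp
next
  case (base U f)
  obtain c where c: "0 \<le> c" "\<And>\<gamma>. \<gamma> \<in> arrows G \<Longrightarrow> cmod (coord \<gamma> (f \<gamma>)) \<le> c"
    using Cc_bounded[OF base(1,2)] by blast
  show ?case
  proof (unfold fibre_bound_def, intro exI[of _ c] conjI ballI allI impI)
    fix s x S assume s: "s \<in> legs" and S: "finite S" "S \<subseteq> {\<gamma> \<in> arrows G. s \<gamma> = x}"
    have zero: "cmod (coord \<gamma> (f \<gamma>)) = 0" if "\<gamma> \<in> S" "\<gamma> \<notin> U" for \<gamma>
    proof -
      have "\<gamma> \<in> arrows G" using that(1) S by auto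
      then show ?thesis using Cc_zero_off[OF base(2) _ that(2)] by (simp add: coord_zero)
    qed
    have "(\<Sum>\<gamma>\<in>S. cmod (coord \<gamma> (f \<gamma>))) = (\<Sum>\<gamma>\<in>S \<inter> U. cmod (coord \<gamma> (f \<gamma>)))"
      by (rule sum.mono_neutral_right) (use S zero in auto)
    also have "\<dots> \<le> c"
    proof (cases "S \<inter> U = {}")
      case False
      then obtain \<gamma> where \<gamma>: "\<gamma> \<in> S \<inter> U" by blast
      have "\<gamma>' = \<gamma>" if "\<gamma>' \<in> S \<inter> U" for \<gamma>'
      proof (rule inj_onD[OF bisection_leg(1)[OF base(1) s]])
        show "s \<gamma>' = s \<gamma>" using that \<gamma> S by auto
      qed (use that \<gamma> in auto)
      then have "S \<inter> U = {\<gamma>}" using \<gamma> by blast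
      then show ?thesis using c(2)[of \<gamma>] \<gamma> S by auto
    qed (use c in simp)
    finally show "(\<Sum>\<gamma>\<in>S. cmod (coord \<gamma> (f \<gamma>))) \<le> c" .
  qed (rule c(1))
next
  case (add f g)
  from add.IH(1) obtain c where c: "fibre_bound f c" by (elim exE)
  from add.IH(2) obtain d where d: "fibre_bound g d" by (elim exE)
  show ?case
  proof (unfold fibre_bound_def, intro exI[of _ "c + d"] conjI ballI allI impI)
    fix s x S assume S: "s \<in> legs" "finite S" "S \<subseteq> {\<gamma> \<in> arrows G. s \<gamma> = x}"
    have "(\<Sum>\<gamma>\<in>S. cmod (coord \<gamma> (sec_add G L f g \<gamma>))) \<le> (\<Sum>\<gamma>\<in>S. cmod (coord \<gamma> (f \<gamma>)) + cmod (coord \<gamma> (g \<gamma>)))"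
    proof (rule sum_mono)
      fix \<gamma> assume "\<gamma> \<in> S"
      then have \<gamma>: "\<gamma> \<in> arrows G" using S by auto
      show "cmod (coord \<gamma> (sec_add G L f g \<gamma>)) \<le> cmod (coord \<gamma> (f \<gamma>)) + cmod (coord \<gamma> (g \<gamma>))"
        using \<gamma> coord_add[OF \<gamma> section_fibre[OF Cc_alg_section \<gamma>] section_fibre[OF Cc_alg_section \<gamma>]] add.hyps
        by (simp add: sec_add_def norm_triangle_ineq)
    qed
    also have "\<dots> \<le> c + d"
      unfolding sum.distrib by (rule add_mono[OF fibre_boundD(2)[OF c S] fibre_boundD(2)[OF d S]])
    finally show "(\<Sum>\<gamma>\<in>S. cmod (coord \<gamma> (sec_add G L f g \<gamma>))) \<le> c + d" .
  qed (use fibre_boundD(1)[OF c] fibre_boundD(1)[OF d] in simp)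
next
  case (scale r f)
  from scale.IH obtain c where c: "fibre_bound f c" by (elim exE)
  show ?case
  proof (unfold fibre_bound_def, intro exI[of _ "cmod r * c"] conjI ballI allI impI)
    fix s x S assume S: "s \<in> legs" "finite S" "S \<subseteq> {\<gamma> \<in> arrows G. s \<gamma> = x}"
    have "(\<Sum>\<gamma>\<in>S. cmod (coord \<gamma> (sec_scale G L r f \<gamma>))) = (\<Sum>\<gamma>\<in>S. cmod r * cmod (coord \<gamma> (f \<gamma>)))"
    proof (rule sum.cong)
      fix \<gamma> assume "\<gamma> \<in> S"
      then have \<gamma>: "\<gamma> \<in> arrows G" using S by auto
      show "cmod (coord \<gamma> (sec_scale G L r f \<gamma>)) = cmod r * cmod (coord \<gamma> (f \<gamma>))"
        using \<gamma> coord_scale[OF \<gamma> section_fibre[OF Cc_alg_section \<gamma>]] scale.hyps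
        by (simp add: sec_scale_def norm_mult)
    qed simp
    also have "\<dots> \<le> cmod r * c"
      unfolding sum_distrib_left[symmetric] by (intro mult_left_mono fibre_boundD(2)[OF c S]) simp
    finally show "(\<Sum>\<gamma>\<in>S. cmod (coord \<gamma> (sec_scale G L r f \<gamma>))) \<le> cmod r * c" .
  qed (use fibre_boundD(1)[OF c] in simp)
qed

lemma fibre_sum_le_norm_leg:
  assumes f: "f \<in> Cc_alg F G L" and s: "s \<in> legs" and x: "x \<in> gunits G"
    and S: "finite S" "S \<subseteq> {\<gamma> \<in> arrows G. s \<gamma> = x}"
  shows "(\<Sum>\<gamma>\<in>S. cmod (coord \<gamma> (f \<gamma>))) \<le> norm_leg s f"
proof -
  from fibre_sums_bounded[OF f] obtain c where c: "fibre_bound f c" by (elim exE)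
  let ?fib = "\<lambda>x. {\<gamma> \<in> arrows G. s \<gamma> = x}"
  let ?I = "\<lambda>x. \<Sum>\<^sub>\<infinity>\<gamma>\<in>?fib x. ennreal (lmod L (f \<gamma>))"
  have I: "?I x = (SUP S\<in>{S. finite S \<and> S \<subseteq> ?fib x}. \<Sum>\<gamma>\<in>S. ennreal (lmod L (f \<gamma>)))" for x
    by (rule nonneg_infsum_complete) simp
  have eq: "(\<Sum>\<gamma>\<in>S. ennreal (lmod L (f \<gamma>))) = ennreal (\<Sum>\<gamma>\<in>S. cmod (coord \<gamma> (f \<gamma>)))"
    if "S \<subseteq> ?fib x" for S x
  proof -
    have "(\<Sum>\<gamma>\<in>S. ennreal (lmod L (f \<gamma>))) = (\<Sum>\<gamma>\<in>S. ennreal (cmod (coord \<gamma> (f \<gamma>))))"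
    proof (rule sum.cong)
      fix \<gamma> assume "\<gamma> \<in> S"
      then have \<gamma>: "\<gamma> \<in> arrows G" using that by auto
      show "ennreal (lmod L (f \<gamma>)) = ennreal (cmod (coord \<gamma> (f \<gamma>)))"
        by (simp add: coord_norm[OF \<gamma> section_fibre[OF Cc_alg_section[OF f] \<gamma>]])
    qed simp
    then show ?thesis by simp
  qed
  have "(SUP x\<in>gunits G. ?I x) \<le> ennreal c"
    unfolding I using fibre_boundD(2)[OF c s] by (intro SUP_least) (auto simp: eq intro!: ennreal_leI)
  then have fin: "(SUP x\<in>gunits G. ?I x) < Orderings.top_class.top"
    by (rule le_less_trans) simp
  have "ennreal (\<Sum>\<gamma>\<in>S. cmod (coord \<gamma> (f \<gamma>))) \<le> ?I x"
    unfolding I eq[OF S(2), symmetric] using S by (intro SUP_upper) simp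
  also have "\<dots> \<le> (SUP x\<in>gunits G. ?I x)" by (rule SUP_upper[OF x])
  finally have "enn2real (ennreal (\<Sum>\<gamma>\<in>S. cmod (coord \<gamma> (f \<gamma>)))) \<le> norm_leg s f"
    unfolding norm_leg_def by (rule enn2real_mono[OF _ fin])
  then show ?thesis by (simp add: sum_nonneg)
qed

end

locale groupoid_representation = twisted_etale_groupoid F G L + cstar_algebra F sc st
  for F :: "complex set" and G :: "'g groupoid" and L :: "('g, 'l) line_bundle"
    and sc :: "complex \<Rightarrow> 'b \<Rightarrow> 'b :: {real_normed_algebra, banach}" and st :: "'b \<Rightarrow> 'b" +
  fixes \<psi> :: "('g \<Rightarrow> 'l) \<Rightarrow> 'b"
  assumes hom: "star_homomorphism F G L sc st \<psi>"
begin

lemma hom_add: "f \<in> Cc_alg F G L \<Longrightarrow> g \<in> Cc_alg F G L \<Longrightarrow> \<psi> (sec_add G L f g) = \<psi> f + \<psi> g"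
  and hom_scale: "c \<in> F \<Longrightarrow> f \<in> Cc_alg F G L \<Longrightarrow> \<psi> (sec_scale G L c f) = sc c (\<psi> f)"
  and hom_conv: "f \<in> Cc_alg F G L \<Longrightarrow> g \<in> Cc_alg F G L \<Longrightarrow> \<psi> (conv G L f g) = \<psi> f * \<psi> g"
  and hom_star: "f \<in> Cc_alg F G L \<Longrightarrow> \<psi> (sec_star G L f) = st (\<psi> f)"
  using hom by (auto simp: star_homomorphism_def)

lemma hom_scaleR: "f \<in> Cc_alg F G L \<Longrightarrow> \<psi> (sec_scale G L (complex_of_real r) f) = r *\<^sub>R \<psi> f"
  by (simp add: hom_scale scalars_in_F sc_of_real)

lemma hom_zero: "\<psi> (sec_zero G L) = 0"
proof -
  have "sec_add G L (sec_zero G L) (sec_zero G L) = sec_zero G L"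
    by (auto simp: sec_add_def sec_zero_def add_zero_zero restrict_def)
  then show ?thesis using hom_add[OF Cc_alg.zero Cc_alg.zero] by simp
qed

lemma hom_secsum: "set fs \<subseteq> Cc_alg F G L \<Longrightarrow> \<psi> (secsum fs) = (\<Sum>f\<leftarrow>fs. \<psi> f)"
  by (induction fs) (auto simp: hom_zero hom_add secsum_in_alg)

lemma hom_fn_add: "g \<in> Cc_units \<Longrightarrow> h \<in> Cc_units \<Longrightarrow> \<psi> (fn (\<lambda>x. g x + h x)) = \<psi> (fn g) + \<psi> (fn h)"
  by (simp add: fn_add hom_add fn_in_alg)

lemma hom_fn_scale: "g \<in> Cc_units \<Longrightarrow> \<psi> (fn (\<lambda>x. r * g x)) = r *\<^sub>R \<psi> (fn g)"
  by (simp add: fn_scale hom_scaleR fn_in_alg)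

lemma hom_fn_mult: "g \<in> Cc_units \<Longrightarrow> h \<in> Cc_units \<Longrightarrow> \<psi> (fn (\<lambda>x. g x * h x)) = \<psi> (fn g) * \<psi> (fn h)"
  by (simp add: hom_conv fn_in_alg flip: conv_fn_fn)

lemma hom_fn_zero: "\<psi> (fn (\<lambda>x. 0)) = 0"
  using hom_fn_scale[OF Cc_units_zero, of 0] by simp

lemma hom_fn_sum: "(\<And>i. i \<in> I \<Longrightarrow> g i \<in> Cc_units) \<Longrightarrow> \<psi> (fn (\<lambda>x. \<Sum>i\<in>I. g i x)) = (\<Sum>i\<in>I. \<psi> (fn (g i)))"
  by (induction I rule: infinite_finite_induct) (auto simp: hom_fn_zero hom_fn_add Cc_units_sum)

lemma Cc_units_scale: "g \<in> Cc_units \<Longrightarrow> (\<lambda>x. r * g x) \<in> Cc_units"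
  by (rule Cc_units_compose) (auto intro!: continuous_intros)

text \<open>The action on \<open>B\<close> of the function \<open>r + g\<close> on the unit space, whose constant part acts by a multiple
  of the identity.\<close>

definition \<Phi> :: "real \<Rightarrow> ('g \<Rightarrow> real) \<Rightarrow> 'b endo" where
  "\<Phi> r g = r *\<^sub>R 1 + lmult (\<psi> (fn g))"

lemma sym_\<Phi>: "g \<in> Cc_units \<Longrightarrow> sym (\<Phi> r g)"
  unfolding \<Phi>_def using hom_star[OF fn_in_alg, of g] by (intro sym_intros) (simp add: sec_star_fn)

lemma \<Phi>_square:
  assumes g: "g \<in> Cc_units"
  shows "\<Phi> r g * \<Phi> r g = \<Phi> (r * r) (\<lambda>x. 2 * r * g x + g x * g x)"
proof -
  have "\<psi> (fn (\<lambda>x. 2 * r * g x + g x * g x)) = \<psi> (fn (\<lambda>x. 2 * r * g x)) + \<psi> (fn (\<lambda>x. g x * g x))"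
    by (rule hom_fn_add[OF Cc_units_scale[OF g] Cc_units_mult[OF g g]])
  also have "\<dots> = (2 * r) *\<^sub>R \<psi> (fn g) + \<psi> (fn g) * \<psi> (fn g)"
    by (simp only: hom_fn_scale[OF g] hom_fn_mult[OF g g])
  finally have "\<psi> (fn (\<lambda>x. 2 * r * g x + g x * g x)) = (2 * r) *\<^sub>R \<psi> (fn g) + \<psi> (fn g) * \<psi> (fn g)" .
  moreover have "(r *\<^sub>R 1 + T) * (r *\<^sub>R 1 + T) = (r * r) *\<^sub>R 1 + ((2 * r) *\<^sub>R T + T * T)" for T :: "'b endo"
  proof -
    have two: "(2 * r) *\<^sub>R T = r *\<^sub>R T + r *\<^sub>R T"
      by (simp only: mult_2 scaleR_left_distrib)
    show ?thesis unfolding two by (simp add: distrib_left distrib_right scaleR_right_distrib)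
  qed
  ultimately show ?thesis by (simp add: \<Phi>_def)
qed

lemma \<Phi>_cong: "(\<And>x. x \<in> gunits G \<Longrightarrow> g x = h x) \<Longrightarrow> \<Phi> r g = \<Phi> r h"
  unfolding \<Phi>_def using fn_cong[of g h] by simp

text \<open>The root of \<open>r + g\<close> again has the form \<open>sqrt r + h\<close> with \<open>h\<close> compactly supported.\<close>

lemma \<Phi>_square_root:
  assumes g: "g \<in> Cc_units" and r: "0 \<le> r" and nonneg: "\<And>x. x \<in> gunits G \<Longrightarrow> 0 \<le> r + g x"
  obtains V where "sym V" "V * V = \<Phi> r g"
proof
  let ?h = "\<lambda>x. sqrt (r + g x) - sqrt r"
  have h: "?h \<in> Cc_units"
    by (rule Cc_units_compose[OF g, where h = "\<lambda>t. sqrt (r + t) - sqrt r"]) (auto intro!: continuous_intros)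
  show "sym (\<Phi> (sqrt r) ?h)" by (rule sym_\<Phi>[OF h])
  have "\<Phi> (sqrt r * sqrt r) (\<lambda>x. 2 * sqrt r * ?h x + ?h x * ?h x) = \<Phi> r g"
  proof -
    have "2 * sqrt r * ?h x + ?h x * ?h x = g x" if "x \<in> gunits G" for x
    proof -
      have "2 * sqrt r * ?h x + ?h x * ?h x = sqrt (r + g x) * sqrt (r + g x) - sqrt r * sqrt r"
        by (simp add: algebra_simps)
      also have "\<dots> = g x" using nonneg[OF that] r by simp
      finally show ?thesis .
    qed
    then have "\<Phi> (sqrt r * sqrt r) (\<lambda>x. 2 * sqrt r * ?h x + ?h x * ?h x) = \<Phi> (sqrt r * sqrt r) g"
      by (rule \<Phi>_cong)
    then show ?thesis using r by simp
  qed
  then show "\<Phi> (sqrt r) ?h * \<Phi> (sqrt r) ?h = \<Phi> r g"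
    by (simp only: \<Phi>_square[OF h])
qed

text \<open>Each piece \<open>h\<close> is written as \<open>a b\<close> with \<open>a\<^sup>2 = |h| + \<delta>\<close> as a function of the range and
  \<open>b = h / sqrt (|h| + \<delta>)\<close>, so that \<open>st b * b \<le> |h|\<close> as a function of the domain. The constant
  \<open>\<delta>\<close> keeps \<open>b\<close> continuous at the zeros of \<open>h\<close>.\<close>

lemma piece_factorization:
  assumes W: "W \<in> bisections G" and h: "h \<in> Cc G L W" and d: "0 < \<delta>"
  shows "\<exists>a b g. sym a \<and> a * a = \<Phi> \<delta> (push (gran G) W (\<lambda>\<gamma>. lmod L (h \<gamma>))) \<and> a \<bullet>\<^sub>e b = \<psi> h \<and>
    g \<in> Cc_units \<and> st b * b = \<psi> (fn g) \<and> (\<forall>x. g x \<le> push (gdom G) W (\<lambda>\<gamma>. lmod L (h \<gamma>)) x)"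
proof -
  let ?n = "\<lambda>\<gamma>. lmod L (h \<gamma>)"
  note hs = Cc_section[OF h]
  obtain K where K: "compactin (garr G) K" "K \<subseteq> W" "\<And>\<gamma>. \<gamma> \<in> arrows G \<Longrightarrow> \<gamma> \<notin> K \<Longrightarrow> h \<gamma> = \<zero>\<^bsub>lfib L \<gamma>\<^esub>"
    using CcE[OF W h] by blast
  have Wa: "\<gamma> \<in> arrows G" if "\<gamma> \<in> W" for \<gamma> using bisection_arrows[OF W] that by blast
  have n0: "0 \<le> ?n \<gamma>" if "\<gamma> \<in> arrows G" for \<gamma>
    using coord_norm[OF that section_fibre[OF hs that]] by (metis norm_ge_zero)
  have nK: "?n \<gamma> = 0" if "\<gamma> \<in> W" "\<gamma> \<notin> K" for \<gamma>
    using K(3)[OF Wa[OF that(1)] that(2)] lmod_zero[OF Wa[OF that(1)]] by simp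
  define w where "w \<gamma> = 1 / sqrt (?n \<gamma> + \<delta>)" for \<gamma>
  define b where "b = cut w h"
  have bs: "b \<in> sections G L" unfolding b_def by (rule cut_section[OF hs])
  have bCc: "b \<in> Cc G L W"
  proof (rule Cc_rescale[OF W h bisection_open[OF W] order_refl, where w = "\<lambda>\<gamma>. complex_of_real (w \<gamma>)" and K = K])
    have "continuous_on {0..} (\<lambda>t::real. complex_of_real (1 / sqrt (t + \<delta>)))"
      using d by (intro continuous_intros) auto
    then have "continuous_map (top_of_set {0..}) euclidean (\<lambda>t::real. complex_of_real (1 / sqrt (t + \<delta>)))"
      by simp
    moreover have "continuous_map (subtopology (garr G) W) (top_of_set {0..}) ?n"
      using Cc_lmod_continuous[OF h] n0 by (auto simp: continuous_map_in_subtopology)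
    ultimately have "continuous_map (subtopology (garr G) W) euclidean ((\<lambda>t::real. complex_of_real (1 / sqrt (t + \<delta>))) \<circ> ?n)"
      by (rule continuous_map_compose[rotated])
    then show "continuous_map (subtopology (garr G) W) euclidean (\<lambda>\<gamma>. complex_of_real (w \<gamma>))"
      by (simp add: w_def o_def)
    show "b \<in> sections G L" by (rule bs)
    show "b \<gamma> = complex_of_real (w \<gamma>) \<odot>\<^bsub>lfib L \<gamma>\<^esub> h \<gamma>" if "\<gamma> \<in> W" for \<gamma>
      using Wa[OF that] by (simp add: b_def cut_def)
    show "b \<gamma> = \<zero>\<^bsub>lfib L \<gamma>\<^esub>" if "\<gamma> \<in> arrows G" "\<gamma> \<notin> K" for \<gamma>
      using that K(3) scale_zero_right[OF _ scalars_in_F(1)] by (simp add: b_def cut_def)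
  qed (use K scalars_in_F in auto)
  have b_alg: "b \<in> Cc_alg F G L" by (rule Cc_alg.base[OF W bCc])
  define N where "N = push (gran G) W ?n"
  have N: "N \<in> Cc_units"
    unfolding N_def by (rule push_in_Cc_units[OF W _ Cc_lmod_continuous[OF h] K(1,2) nK]) auto
  have N0: "0 \<le> N x" for x
    using n0 Wa inv_into_into[of x "gran G" W] by (auto simp: N_def push_def)
  define g where "g x = sqrt (\<delta> + N x) - sqrt \<delta>" for x
  have g: "g \<in> Cc_units"
    unfolding g_def by (rule Cc_units_compose[OF N, where h = "\<lambda>t. sqrt (\<delta> + t) - sqrt \<delta>"]) (auto intro!: continuous_intros)
  have cont_g: "continuous_map (garr G) euclideanreal (\<lambda>\<gamma>. g (gran G \<gamma>))"
    using continuous_map_compose[OF leg_continuous[of "gran G"], of euclideanreal g] g by (simp add: Cc_units_def o_def)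
  have gb: "cut (\<lambda>\<gamma>. g (gran G \<gamma>)) b \<in> Cc_alg F G L"
  proof -
    have "cut (\<lambda>\<gamma>. g (gran G \<gamma>)) b \<in> Cc G L (W \<inter> arrows G)"
      by (rule cut_Cc[OF W bCc openin_topspace closedin_topspace order_refl cont_g]) auto
    then show ?thesis using Cc_alg.base[OF W] bisection_arrows[OF W] by (simp add: Int_absorb2)
  qed
  have conv_eq: "conv G L (fn g) b = cut (\<lambda>\<gamma>. g (gran G \<gamma>)) b"
    unfolding cut_def by (rule conv_fn[OF bs])
  let ?sb = "sec_scale G L (complex_of_real (sqrt \<delta>)) b"
  have sb: "?sb \<in> Cc_alg F G L" by (rule Cc_alg.scale[OF scalars_in_F(1) b_alg])
  have "h = sec_add G L ?sb (cut (\<lambda>\<gamma>. g (gran G \<gamma>)) b)"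
  proof (rule section_eqI[OF hs Cc_alg_section[OF Cc_alg.add[OF sb gb]]])
    fix \<gamma> assume \<gamma>: "\<gamma> \<in> arrows G"
    have "coord \<gamma> (sec_add G L ?sb (cut (\<lambda>\<gamma>. g (gran G \<gamma>)) b) \<gamma>) =
        complex_of_real (sqrt \<delta> + g (gran G \<gamma>)) * (complex_of_real (w \<gamma>) * coord \<gamma> (h \<gamma>))"
      using \<gamma> coord_add[OF \<gamma> section_fibre[OF Cc_alg_section[OF sb] \<gamma>] section_fibre[OF Cc_alg_section[OF gb] \<gamma>]]
        coord_scale[OF \<gamma> section_fibre[OF bs \<gamma>] scalars_in_F(1)] coord_cut[OF bs \<gamma>] coord_cut[OF hs \<gamma>]
      by (simp add: sec_add_def sec_scale_def b_def[symmetric] algebra_simps) (simp add: b_def)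
    also have "\<dots> = coord \<gamma> (h \<gamma>)"
    proof (cases "\<gamma> \<in> W")
      case True
      then have "(sqrt \<delta> + g (gran G \<gamma>)) * w \<gamma> = 1"
        using push_leg[OF W _ True, of "gran G" ?n] d n0[OF \<gamma>] by (simp add: g_def N_def w_def add.commute)
      then have "complex_of_real (sqrt \<delta> + g (gran G \<gamma>)) * complex_of_real (w \<gamma>) = 1"
        by (metis of_real_1 of_real_mult)
      then show ?thesis by (simp add: mult.assoc[symmetric])
    next
      case False
      then show ?thesis using Cc_zero_off[OF h \<gamma>] coord_zero[OF \<gamma>] by simp
    qed
    finally show "coord \<gamma> (h \<gamma>) = coord \<gamma> (sec_add G L ?sb (cut (\<lambda>\<gamma>. g (gran G \<gamma>)) b) \<gamma>)" by simp
  qed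
  then have "\<psi> h = sqrt \<delta> *\<^sub>R \<psi> b + \<psi> (fn g) * \<psi> b"
    using hom_add[OF sb gb] hom_scaleR[OF b_alg] hom_conv[OF fn_in_alg[OF g] b_alg] conv_eq by simp
  then have ab: "\<Phi> (sqrt \<delta>) g \<bullet>\<^sub>e \<psi> b = \<psi> h"
    by (simp add: \<Phi>_def)
  have "2 * sqrt \<delta> * g x + g x * g x = N x" for x
  proof -
    have "2 * sqrt \<delta> * g x + g x * g x = sqrt (\<delta> + N x) * sqrt (\<delta> + N x) - sqrt \<delta> * sqrt \<delta>"
      by (simp add: g_def algebra_simps)
    then show ?thesis using d N0[of x] by simp
  qed
  then have aa: "\<Phi> (sqrt \<delta>) g * \<Phi> (sqrt \<delta>) g = \<Phi> \<delta> N"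
    using d by (simp add: \<Phi>_square[OF g])
  let ?q = "push (gdom G) W (\<lambda>\<gamma>. (lmod L (b \<gamma>))\<^sup>2)"
  have lb: "(lmod L (b \<gamma>))\<^sup>2 \<le> ?n \<gamma>" if \<gamma>: "\<gamma> \<in> arrows G" for \<gamma>
  proof -
    have "lmod L (b \<gamma>) = w \<gamma> * ?n \<gamma>"
      using coord_norm[OF \<gamma> section_fibre[OF bs \<gamma>]] coord_norm[OF \<gamma> section_fibre[OF hs \<gamma>]] coord_cut[OF hs \<gamma>, of w] d n0[OF \<gamma>]
      by (simp add: b_def[symmetric] norm_mult norm_divide w_def)
    then have "(lmod L (b \<gamma>))\<^sup>2 = ?n \<gamma> * (?n \<gamma> / (?n \<gamma> + \<delta>))"
      using d n0[OF \<gamma>] by (simp add: w_def power_mult_distrib power_divide power2_eq_square)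
    also have "\<dots> \<le> ?n \<gamma> * 1"
      using d n0[OF \<gamma>] by (intro mult_left_mono) (auto simp: divide_le_eq_1)
    finally show ?thesis by simp
  qed
  have "?q \<in> Cc_units"
  proof (rule push_in_Cc_units[OF W _ _ K(1,2)])
    show "continuous_map (subtopology (garr G) W) euclideanreal (\<lambda>\<gamma>. (lmod L (b \<gamma>))\<^sup>2)"
      by (rule continuous_map_real_pow[OF Cc_lmod_continuous[OF bCc]])
    show "(lmod L (b \<gamma>))\<^sup>2 = 0" if "\<gamma> \<in> W" "\<gamma> \<notin> K" for \<gamma>
      using lb[OF Wa[OF that(1)]] nK[OF that] by simp
  qed simp
  moreover have "st (\<psi> b) * \<psi> b = \<psi> (fn ?q)"
    using hom_conv[OF Cc_alg.base[OF bisection_inv[OF W] sec_star_Cc[OF W bCc]] b_alg] hom_star[OF b_alg]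
    by (simp add: conv_star_self[OF W bCc])
  moreover have "?q x \<le> push (gdom G) W ?n x" for x
    using lb[OF Wa[OF inv_into_into[of x "gdom G" W]]] by (simp add: push_def)
  ultimately show ?thesis
    using sym_\<Phi>[OF g] aa[unfolded N_def] ab
    by (intro exI[of _ "\<Phi> (sqrt \<delta>) g"] exI[of _ "\<psi> b"] exI[of _ ?q] conjI allI)
qed

text \<open>Split \<open>f\<close> with bounds exceeding the two norms by \<open>e / 2\<close>, factor every piece as \<open>a b\<close>, and apply the
  Cauchy--Schwarz inequality: \<open>\<Sum> a\<^sup>2\<close> and \<open>\<Sum> st b * b\<close> are functions on the unit space that are bounded by
  the fibre sums over the range and the domain map.\<close>

lemma norm_hom_square_le:
  assumes f: "f \<in> Cc_alg F G L" and e: "0 < e"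
  shows "(norm (\<psi> f))\<^sup>2 \<le> (norm_leg (gran G) f + e) * (norm_leg (gdom G) f + e)"
proof -
  obtain ps where ps: "f = secsum (map snd ps)" "\<And>U h. (U, h) \<in> set ps \<Longrightarrow> U \<in> bisections G \<and> h \<in> Cc G L U"
    using Cc_alg_decomposition[OF f] by blast
  define n U fs where "n = length ps" and "U i = fst (ps ! i)" and "fs i = snd (ps ! i)" for i
  have U: "U i \<in> bisections G" "fs i \<in> Cc G L (U i)" if "i < n" for i
    using ps(2)[of "U i" "fs i"] that by (auto simp: n_def U_def fs_def)
  have tot: "coord \<gamma> (f \<gamma>) = (\<Sum>i<n. coord \<gamma> (fs i \<gamma>))" if \<gamma>: "\<gamma> \<in> arrows G" for \<gamma>
  proof -
    have "set (map snd ps) \<subseteq> sections G L"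
      using ps(2) Cc_section by fastforce
    then have "coord \<gamma> (f \<gamma>) = (\<Sum>p\<leftarrow>ps. coord \<gamma> (snd p \<gamma>))"
      unfolding ps(1) using coord_secsum[OF _ \<gamma>] by (simp add: o_def)
    then show ?thesis
      by (simp add: sum_list_sum_nth n_def fs_def atLeast0LessThan)
  qed
  have bound: "(\<Sum>\<gamma>\<in>S. cmod (\<Sum>i<n. coord \<gamma> (fs i \<gamma>))) \<le> norm_leg s f"
    if "s \<in> legs" "x \<in> gunits G" "finite S" "S \<subseteq> {\<gamma> \<in> arrows G. s \<gamma> = x}" for s x S
  proof -
    have "(\<Sum>\<gamma>\<in>S. cmod (\<Sum>i<n. coord \<gamma> (fs i \<gamma>))) = (\<Sum>\<gamma>\<in>S. cmod (coord \<gamma> (f \<gamma>)))"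
      using that(4) tot by (intro sum.cong) auto
    then show ?thesis using fibre_sum_le_norm_leg[OF f that] by simp
  qed
  have e2: "0 < e / 2" using e by simp
  show ?thesis
  proof (rule splitting_exists[OF U e2 bound])
    fix Q :: "(nat \<times> nat \<times> 'g set) set" and W h
    assume Q: "finite Q" and W: "\<And>q. q \<in> Q \<Longrightarrow> W q \<in> bisections G" and h: "\<And>q. q \<in> Q \<Longrightarrow> h q \<in> Cc G L (W q)"
      and sum_h: "\<And>\<gamma>. \<gamma> \<in> arrows G \<Longrightarrow> (\<Sum>q\<in>Q. coord \<gamma> (h q \<gamma>)) = (\<Sum>i<n. coord \<gamma> (fs i \<gamma>))"
      and le: "\<And>s x. s \<in> legs \<Longrightarrow> x \<in> gunits G \<Longrightarrow>
        (\<Sum>q\<in>Q. push s (W q) (\<lambda>\<gamma>. lmod L (h q \<gamma>)) x) \<le> norm_leg s f + e / 2"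
    let ?N = "\<lambda>s q. push s (W q) (\<lambda>\<gamma>. lmod L (h q \<gamma>))"
    \<comment> \<open>the constants of all pieces together cost at most \<open>e / 2\<close>\<close>
    define \<delta> where "\<delta> = e / (2 * (real (card Q) + 1))"
    have d: "0 < \<delta>" "real (card Q) * \<delta> \<le> e / 2"
    proof -
      show "0 < \<delta>" using e by (simp add: \<delta>_def add_nonneg_pos)
      have "real (card Q) * \<delta> = (real (card Q) / (real (card Q) + 1)) * (e / 2)"
        by (simp add: \<delta>_def)
      also have "\<dots> \<le> 1 * (e / 2)"
        using e by (intro mult_right_mono) auto
      finally show "real (card Q) * \<delta> \<le> e / 2" by simp
    qed
    have "\<forall>q\<in>Q. \<exists>p. sym (fst p) \<and> fst p * fst p = \<Phi> \<delta> (?N (gran G) q) \<and> fst p \<bullet>\<^sub>e fst (snd p) = \<psi> (h q) \<and>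
        snd (snd p) \<in> Cc_units \<and> st (fst (snd p)) * fst (snd p) = \<psi> (fn (snd (snd p))) \<and>
        (\<forall>x. snd (snd p) x \<le> ?N (gdom G) q x)"
    proof
      fix q assume q: "q \<in> Q"
      from piece_factorization[OF W[OF q] h[OF q] d(1)]
      obtain a b g where "sym a \<and> a * a = \<Phi> \<delta> (?N (gran G) q) \<and> a \<bullet>\<^sub>e b = \<psi> (h q) \<and>
        g \<in> Cc_units \<and> st b * b = \<psi> (fn g) \<and> (\<forall>x. g x \<le> ?N (gdom G) q x)"
        by (elim exE)
      then show "\<exists>p. sym (fst p) \<and> fst p * fst p = \<Phi> \<delta> (?N (gran G) q) \<and> fst p \<bullet>\<^sub>e fst (snd p) = \<psi> (h q) \<and>
        snd (snd p) \<in> Cc_units \<and> st (fst (snd p)) * fst (snd p) = \<psi> (fn (snd (snd p))) \<and>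
        (\<forall>x. snd (snd p) x \<le> ?N (gdom G) q x)"
        by (intro exI[of _ "(a, b, g)"]) simp
    qed
    from bchoice[OF this] obtain p where p: "\<forall>q\<in>Q. sym (fst (p q)) \<and>
        fst (p q) * fst (p q) = \<Phi> \<delta> (?N (gran G) q) \<and> fst (p q) \<bullet>\<^sub>e fst (snd (p q)) = \<psi> (h q) \<and>
        snd (snd (p q)) \<in> Cc_units \<and> st (fst (snd (p q))) * fst (snd (p q)) = \<psi> (fn (snd (snd (p q)))) \<and>
        (\<forall>x. snd (snd (p q)) x \<le> ?N (gdom G) q x)"
      by (elim exE)
    define a b g where "a q = fst (p q)" and "b q = fst (snd (p q))" and "g q = snd (snd (p q))" for q
    have fac: "\<And>q. q \<in> Q \<Longrightarrow> sym (a q)" "\<And>q. q \<in> Q \<Longrightarrow> a q * a q = \<Phi> \<delta> (?N (gran G) q)"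
      "\<And>q. q \<in> Q \<Longrightarrow> a q \<bullet>\<^sub>e b q = \<psi> (h q)" "\<And>q. q \<in> Q \<Longrightarrow> g q \<in> Cc_units"
      "\<And>q. q \<in> Q \<Longrightarrow> st (b q) * b q = \<psi> (fn (g q))" "\<And>q x. q \<in> Q \<Longrightarrow> g q x \<le> ?N (gdom G) q x"
      using p by (simp_all add: a_def b_def g_def)
    define \<rho> \<delta>' where "\<rho> = norm_leg (gran G) f + e" and "\<delta>' = norm_leg (gdom G) f + e"
    have pos: "0 < \<rho>" "0 \<le> \<delta>'" "0 \<le> \<rho> - real (card Q) * \<delta>"
      using e d(2) norm_leg_nonneg[of "gran G" f] norm_leg_nonneg[of "gdom G" f] by (simp_all add: \<rho>_def \<delta>'_def)
    have N: "?N (gran G) q \<in> Cc_units" if q: "q \<in> Q" for q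
    proof -
      obtain K where K: "compactin (garr G) K" "K \<subseteq> W q" "\<And>\<gamma>. \<gamma> \<in> arrows G \<Longrightarrow> \<gamma> \<notin> K \<Longrightarrow> h q \<gamma> = \<zero>\<^bsub>lfib L \<gamma>\<^esub>"
        using CcE[OF W[OF q] h[OF q]] by blast
      show ?thesis
      proof (rule push_in_Cc_units[OF W[OF q] _ Cc_lmod_continuous[OF h[OF q]] K(1,2)])
        show "lmod L (h q \<gamma>) = 0" if "\<gamma> \<in> W q" "\<gamma> \<notin> K" for \<gamma>
          using bisection_arrows[OF W[OF q]] that K(3) lmod_zero by (metis subsetD)
      qed simp
    qed
    have "\<psi> f = (\<Sum>q\<in>Q. a q \<bullet>\<^sub>e b q)"
    proof -
      obtain qs where qs: "set qs = Q" "distinct qs" using finite_distinct_list[OF Q] by blast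
      have alg: "set (map h qs) \<subseteq> Cc_alg F G L"
        unfolding set_map qs(1) using Cc_alg.base[OF W h] by (rule image_subsetI)
      have sec: "set (map h qs) \<subseteq> sections G L"
        using alg Cc_alg_section by blast
      have "f = secsum (map h qs)"
      proof (rule section_eqI[OF Cc_alg_section[OF f] secsum_section[OF sec]])
        fix \<gamma> assume \<gamma>: "\<gamma> \<in> arrows G"
        have "coord \<gamma> (secsum (map h qs) \<gamma>) = (\<Sum>q\<in>Q. coord \<gamma> (h q \<gamma>))"
          unfolding coord_secsum[OF sec \<gamma>] using qs by (simp add: o_def sum_list_distinct_conv_sum_set)
        then show "coord \<gamma> (f \<gamma>) = coord \<gamma> (secsum (map h qs) \<gamma>)"
          using sum_h[OF \<gamma>] tot[OF \<gamma>] by simp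
      qed
      then have "\<psi> f = (\<Sum>q\<leftarrow>qs. \<psi> (h q))"
        using hom_secsum[OF alg] by (simp add: o_def)
      also have "\<dots> = (\<Sum>q\<in>Q. \<psi> (h q))"
        using qs by (simp add: sum_list_distinct_conv_sum_set)
      also have "\<dots> = (\<Sum>q\<in>Q. a q \<bullet>\<^sub>e b q)"
        by (rule sum.cong) (simp_all add: fac(3))
      finally show ?thesis .
    qed
    moreover have "(norm (\<Sum>q\<in>Q. a q \<bullet>\<^sub>e b q))\<^sup>2 \<le> \<rho> * \<delta>'"
    proof -
      have Nsum: "(\<lambda>x. \<Sum>q\<in>Q. ?N (gran G) q x) \<in> Cc_units"
        by (rule Cc_units_sum[OF N])
      have "0 \<le> (\<rho> - real (card Q) * \<delta>) + - 1 * (\<Sum>q\<in>Q. ?N (gran G) q x)" if "x \<in> gunits G" for x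
        using le[OF _ that, of "gran G"] d(2) by (simp add: \<rho>_def)
      then obtain V where V: "sym V" "V * V = \<Phi> (\<rho> - real (card Q) * \<delta>) (\<lambda>x. - 1 * (\<Sum>q\<in>Q. ?N (gran G) q x))"
        using \<Phi>_square_root[OF Cc_units_scale[OF Nsum] pos(3)] by blast
      have "(\<Sum>q\<in>Q. a q * a q) = (real (card Q) * \<delta>) *\<^sub>R 1 + lmult (\<psi> (fn (\<lambda>x. \<Sum>q\<in>Q. ?N (gran G) q x)))"
        using fac(2) by (simp add: \<Phi>_def sum.distrib hom_fn_sum[OF N] lmult_sum sum_constant_scaleR)
      then have VV: "V * V = \<rho> *\<^sub>R 1 - (\<Sum>q\<in>Q. a q * a q)"
        unfolding V(2) \<Phi>_def hom_fn_scale[OF Nsum] by (simp add: algebra_simps)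
      have gsum: "(\<lambda>x. \<Sum>q\<in>Q. g q x) \<in> Cc_units"
        by (rule Cc_units_sum[OF fac(4)])
      have "\<psi> (fn (\<lambda>x. \<Sum>q\<in>Q. g q x)) = (\<Sum>q\<in>Q. \<psi> (fn (g q)))"
        by (rule hom_fn_sum[OF fac(4)])
      also have "\<dots> = (\<Sum>q\<in>Q. st (b q) * b q)"
        by (rule sum.cong) (simp_all add: fac(5))
      finally have hom_gsum: "\<psi> (fn (\<lambda>x. \<Sum>q\<in>Q. g q x)) = (\<Sum>q\<in>Q. st (b q) * b q)" .
      have "0 \<le> \<delta>' + - 1 * (\<Sum>q\<in>Q. g q x)" if x: "x \<in> gunits G" for x
      proof -
        have "(\<Sum>q\<in>Q. g q x) \<le> (\<Sum>q\<in>Q. ?N (gdom G) q x)"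
          by (rule sum_mono[OF fac(6)])
        also have "\<dots> \<le> \<delta>'" using le[OF _ x, of "gdom G"] e by (simp add: \<delta>'_def)
        finally show ?thesis by simp
      qed
      then obtain Z where Z: "sym Z" "Z * Z = \<Phi> \<delta>' (\<lambda>x. - 1 * (\<Sum>q\<in>Q. g q x))"
        using \<Phi>_square_root[OF Cc_units_scale[OF gsum] pos(2)] by blast
      have "Z * Z = \<delta>' *\<^sub>R 1 - lmult (\<Sum>q\<in>Q. st (b q) * b q)"
        unfolding Z(2) \<Phi>_def hom_fn_scale[OF gsum] hom_gsum by simp
      then have pos_b: "pos (\<delta>' *\<^sub>R 1 - lmult (\<Sum>q\<in>Q. st (b q) * b q))"
        using pos_square[OF Z(1)] by simp
      show ?thesis
        by (rule Cauchy_Schwarz_operators[OF fac(1) pos(1,2) V(1) VV pos_b])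
    qed
    ultimately show ?thesis by (simp add: \<rho>_def \<delta>'_def)
  qed
qed

theorem norm_hom_le: 
  assumes f: "f \<in> Cc_alg F G L"
  shows "norm (\<psi> f) \<le> sqrt (norm_leg (gdom G) f) * sqrt (norm_leg (gran G) f)"
proof -
  define d r where "d = norm_leg (gdom G) f" and "r = norm_leg (gran G) f"
  have dr: "0 \<le> d" "0 \<le> r" by (simp_all add: d_def r_def norm_leg_nonneg)
  have "(norm (\<psi> f))\<^sup>2 \<le> d * r"
  proof (rule field_le_epsilon)
    fix \<epsilon> :: real assume \<epsilon>: "0 < \<epsilon>"
    \<comment> \<open>then \<open>(r + e) * (d + e) \<le> d * r + e * (r + d + 1)\<close>, as \<open>e \<le> 1\<close>\<close>
    define e where "e = min 1 (\<epsilon> / (r + d + 1))"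
    have e: "0 < e" "e \<le> 1" "e * (r + d + 1) \<le> \<epsilon>"
      using \<epsilon> dr by (auto simp: e_def min_mult_distrib_right pos_le_divide_eq[symmetric])
    have "(norm (\<psi> f))\<^sup>2 \<le> (r + e) * (d + e)"
      unfolding d_def r_def by (rule norm_hom_square_le[OF f e(1)])
    also have "\<dots> = d * r + e * (r + d + e)" by (simp add: algebra_simps)
    also have "\<dots> \<le> d * r + e * (r + d + 1)"
      using e by (intro add_left_mono mult_left_mono) auto
    also have "\<dots> \<le> d * r + \<epsilon>" using e(3) by simp
    finally show "(norm (\<psi> f))\<^sup>2 \<le> d * r + \<epsilon>" .
  qed
  then have "norm (\<psi> f) \<le> sqrt (d * r)" by (rule real_le_rsqrt)
  then show ?thesis by (simp add: d_def r_def real_sqrt_mult)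
qed

end

theorem corollary5p8:
  fixes F :: "complex set"
    and G :: "'g groupoid"
    and L :: "('g, 'l) line_bundle"
    and sc :: "complex \<Rightarrow> 'b \<Rightarrow> 'b :: {real_normed_algebra, banach}"
    and st :: "'b \<Rightarrow> 'b"
    and \<psi> :: "('g \<Rightarrow> 'l) \<Rightarrow> 'b"
  assumes "twisted_etale_groupoid F G L"
    and "cstar_algebra F sc st"
    and "star_homomorphism F G L sc st \<psi>"
  shows "(\<forall>f\<in>Cc_alg F G L. norm (\<psi> f) \<le> norm_I G L f) \<and>
         (\<forall>f\<in>Cc_alg F G L.
            norm (\<psi> f) \<le> norm_d G L f powr (1/2) * norm_r G L f powr (1/2) \<and>
            norm_d G L f powr (1/2) * norm_r G L f powr (1/2) \<le> norm_I G L f)"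
proof -
  interpret groupoid_representation F G L sc st \<psi>
    using assms by (simp add: groupoid_representation_def groupoid_representation_axioms_def)
  have main: "norm (\<psi> f) \<le> norm_d G L f powr (1/2) * norm_r G L f powr (1/2)" if "f \<in> Cc_alg F G L" for f
    using norm_hom_le[OF that] by (simp add: norm_d_def norm_r_def norm_leg_def powr_half_sqrt)
  have le_I: "norm_d G L f powr (1/2) * norm_r G L f powr (1/2) \<le> norm_I G L f" for f
  proof -
    have d: "0 \<le> norm_d G L f" "0 \<le> norm_r G L f"
      by (simp_all add: norm_d_def norm_r_def)
    have "sqrt (norm_d G L f) * sqrt (norm_r G L f) \<le> sqrt (norm_I G L f) * sqrt (norm_I G L f)"
      using d by (intro mult_mono) (auto simp: norm_I_def)
    also have "\<dots> = norm_I G L f"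
      using d by (simp add: norm_I_def)
    finally show ?thesis using d by (simp add: powr_half_sqrt)
  qed
  show ?thesis
    using main le_I order_trans by blast
qed

end
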